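(* The generalized simplicial complex $\Delta_3$ (which is homeomorphic to $X_{3,0}$) is collapsible.
   Context: Graphs are finite, undirected and connected; loops and multiple edges are allowed. The genus of $G$ is $|E(G)|-|V(G)|+1$. A graph is stable if it has no bridges and no vertex of valency $2$ unless that vertex is adjacent to a loop. A filtered graph of depth $m$ is a pair $(G,\pi)$ with $\pi=(E_1,\dots,E_m)$ an ordered partition of $E(G)$ into nonempty blocks; it is filtered by forests if the subgraph induced by $E_1\cup\dots\cup E_{m-1}$ contains no cycles (automatically satisfied if $m=1$). Two filtered graphs are isomorphic if there is a graph isomorphism taking the $i$-th block to the $i$-th block for all $i$. A generalized simplicial complex is a cell complex whose cells are simplices, glued along their faces, where different simplices may share the same vertex set; it is collapsible if it can be reduced to a point by a sequence of elementary simplicial collapses (removing a simplex together with a free codimension-one face of it). For $g\ge 2$, $\Delta_g$ is the generalized simplicial complex whose $m$-simplices are indexed by the isomorphism classes of filtered by forests stable graphs $(G,\pi)$ of genus $g$ and depth $m+1$. For an $m$-simplex, $m\ge1$, represented by $(G,(E_1,\dots,E_{m+1}))$, its codimension-one faces are represented by: (a) the graph $G/E_1$ obtained by shrinking all edges of $E_1$, with ordered partition $(E_2,\dots,E_{m+1})$; (b) the graph $G$ with the ordered partition obtained by merging $E_i$ and $E_{i+1}$, for $i=1,\dots,m$. (The vertices of the simplex are $v_1,\dots,v_{m+1}$, where $v_i$ is indexed by the isomorphism class of $G/(E_1\cup\dots\cup E_{i-1})$; face (a) omits $v_1$ and face (b) omits $v_{i+1}$.) $X_{g,0}$ is the moduli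 space of isometry classes of metric graphs $(G,l_G)$ with $G$ stable of genus $g$, $l_G:E(G)\to(0,1]$ with maximal value $1$, such that the edges of length strictly less than $1$ form a forest; its topology is induced from the quotient topology on $\coprod_G\{l:E(G)\to[0,\infty): l^{-1}(0)\text{ is a forest}\}$ obtained by contracting edges of length $0$ and passing to isometry classes. *)

theory Defs
  imports "HOL-Analysis.Analysis" "HOL-Homology.Simplices"
begin

section \<open>Graphs\<close>

text \<open>Undirected multigraphs: \<open>ends G e\<close> is the set of endpoints of \<open>e\<close>, a singleton exactly when
  \<open>e\<close> is a loop.  The values of \<open>ends G\<close> outside \<open>edges G\<close> are irrelevant.\<close>

record ('v, 'e) mgraph =
  verts :: "'v set"
  edges :: "'e set"
  ends :: "'e \<Rightarrow> 'v set"

definition adj :: "('v, 'e) mgraph \<Rightarrow> 'e set \<Rightarrow> ('v \<times> 'v) set" where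
  "adj G F = {(u, v). \<exists>e\<in>F. ends G e = {u, v}}"

definition connected_by :: "('v, 'e) mgraph \<Rightarrow> 'e set \<Rightarrow> bool" where
  "connected_by G F \<longleftrightarrow> (\<forall>u\<in>verts G. \<forall>v\<in>verts G. (u, v) \<in> (adj G F)\<^sup>*)"

definition graph :: "('v, 'e) mgraph \<Rightarrow> bool" where
  "graph G \<longleftrightarrow> finite (verts G) \<and> finite (edges G) \<and> verts G \<noteq> {} \<and>
     (\<forall>e\<in>edges G. ends G e \<subseteq> verts G \<and> card (ends G e) \<in> {1, 2}) \<and>
     connected_by G (edges G)"

definition genus :: "('v, 'e) mgraph \<Rightarrow> int" where
  "genus G = int (card (edges G)) - int (card (verts G)) + 1"

definition bridge :: "('v, 'e) mgraph \<Rightarrow> 'e \<Rightarrow> bool" where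
  "bridge G e \<longleftrightarrow> e \<in> edges G \<and> \<not> connected_by G (edges G - {e})"

text \<open>A loop contributes 2 to the valency of its vertex.\<close>

definition valency :: "('v, 'e) mgraph \<Rightarrow> 'v \<Rightarrow> nat" where
  "valency G v = card {e \<in> edges G. v \<in> ends G e} + card {e \<in> edges G. ends G e = {v}}"

definition stable :: "('v, 'e) mgraph \<Rightarrow> bool" where
  "stable G \<longleftrightarrow> graph G \<and> (\<forall>e. \<not> bridge G e) \<and>
     (\<forall>v\<in>verts G. valency G v = 2 \<longrightarrow> (\<exists>e\<in>edges G. ends G e = {v}))"

text \<open>A cycle with edges in \<open>F\<close>, as the cyclic sequences of its (distinct) vertices and edges.
  Loops (length 1) and pairs of parallel edges (length 2) are cycles.\<close>

definition is_cycle :: "('v, 'e) mgraph \<Rightarrow> 'e set \<Rightarrow> 'v list \<Rightarrow> 'e list \<Rightarrow> bool" where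
  "is_cycle G F vs es \<longleftrightarrow> es \<noteq> [] \<and> length vs = length es \<and> distinct vs \<and> distinct es \<and>
     set es \<subseteq> F \<and> (\<forall>i<length es. ends G (es ! i) = {vs ! i, vs ! (Suc i mod length es)})"

definition forest :: "('v, 'e) mgraph \<Rightarrow> 'e set \<Rightarrow> bool" where
  "forest G F \<longleftrightarrow> (\<nexists>vs es. is_cycle G F vs es)"

text \<open>\<open>contract G F\<close> is the graph \<open>G/F\<close>: its vertices are the classes of vertices of \<open>G\<close> connected
  to each other through \<open>F\<close>.\<close>

definition contract :: "('v, 'e) mgraph \<Rightarrow> 'e set \<Rightarrow> ('v set, 'e) mgraph" where
  "contract G F =
     (let comp = (\<lambda>v. (adj G F)\<^sup>* `` {v})
      in \<lparr>verts = comp ` verts G, edges = edges G - F, ends = (\<lambda>e. comp ` ends G e)\<rparr>)"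

definition graph_iso ::
  "('v, 'e) mgraph \<Rightarrow> ('w, 'f) mgraph \<Rightarrow> ('v \<Rightarrow> 'w) \<Rightarrow> ('e \<Rightarrow> 'f) \<Rightarrow> bool" where
  "graph_iso G H f h \<longleftrightarrow> bij_betw f (verts G) (verts H) \<and> bij_betw h (edges G) (edges H) \<and>
     (\<forall>e\<in>edges G. ends H (h e) = f ` ends G e)"


section \<open>Filtered graphs\<close>

type_synonym ('v, 'e) fgraph = "('v, 'e) mgraph \<times> 'e set list"

definition filtered :: "('v, 'e) fgraph \<Rightarrow> bool" where
  "filtered = (\<lambda>(G, \<pi>). graph G \<and> \<pi> \<noteq> [] \<and> (\<forall>A\<in>set \<pi>. A \<noteq> {}) \<and> \<Union> (set \<pi>) = edges G \<and>
     (\<forall>i<length \<pi>. \<forall>j<length \<pi>. i \<noteq> j \<longrightarrow> \<pi> ! i \<inter> \<pi> ! j = {}))"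

definition filtered_by_forests :: "('v, 'e) fgraph \<Rightarrow> bool" where
  "filtered_by_forests = (\<lambda>(G, \<pi>). filtered (G, \<pi>) \<and> forest G (\<Union> (set (butlast \<pi>))))"

definition fgraph_isomorphic :: "('v, 'e) fgraph \<Rightarrow> ('w, 'f) fgraph \<Rightarrow> bool" where
  "fgraph_isomorphic = (\<lambda>(G, \<pi>) (H, \<rho>). \<exists>f h. graph_iso G H f h \<and> map ((`) h) \<pi> = \<rho>)"

text \<open>The isomorphism class of a finite filtered graph with arbitrary types of vertices and edges is
  represented by the set of its isomorphic copies on natural numbers.\<close>

definition fclass :: "('v, 'e) fgraph \<Rightarrow> (nat, nat) fgraph set" where
  "fclass x = {y. fgraph_isomorphic x y}"

text \<open>The blocks with (1-based) numbers \<open>i\<close> and \<open>i + 1\<close> are merged.\<close>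

definition merge_blocks :: "nat \<Rightarrow> 'e set list \<Rightarrow> 'e set list" where
  "merge_blocks i \<pi> = take (i - 1) \<pi> @ [\<pi> ! (i - 1) \<union> \<pi> ! i] @ drop (i + 1) \<pi>"


section \<open>Generalized simplicial complexes\<close>

text \<open>\<open>cells K m\<close> is the set of \<open>m\<close>-simplices, and \<open>face K m i \<sigma>\<close> is the face of the \<open>m\<close>-simplex \<open>\<sigma>\<close>
  opposite to its vertex number \<open>i \<in> {0..m}\<close>.\<close>

record 'a gcomplex =
  cells :: "nat \<Rightarrow> 'a set"
  face :: "nat \<Rightarrow> nat \<Rightarrow> 'a \<Rightarrow> 'a"

text \<open>Vertex number \<open>i\<close> of a simplex is reached by omitting all the others: the last vertex as long as it
  is not the wanted one, and otherwise the first.\<close>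

fun vertex :: "'a gcomplex \<Rightarrow> nat \<Rightarrow> nat \<Rightarrow> 'a \<Rightarrow> 'a" where
  "vertex K 0 i \<sigma> = \<sigma>"
| "vertex K (Suc m) i \<sigma> =
     (if i \<le> m then vertex K m i (face K (Suc m) (Suc m) \<sigma>)
      else vertex K m m (face K (Suc m) 0 \<sigma>))"

text \<open>The last condition says that the vertices of each simplex are pairwise distinct, so that no simplex
  is glued to itself; different simplices may have the same vertices.\<close>

definition gen_simplicial_complex :: "'a gcomplex \<Rightarrow> bool" where
  "gen_simplicial_complex K \<longleftrightarrow>
     (\<forall>m i. \<forall>\<sigma>\<in>cells K (Suc m). i \<le> Suc m \<longrightarrow> face K (Suc m) i \<sigma> \<in> cells K m) \<and>
     (\<forall>m i j. \<forall>\<sigma>\<in>cells K (Suc (Suc m)). i < j \<and> j \<le> Suc (Suc m) \<longrightarrow>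
        face K (Suc m) i (face K (Suc (Suc m)) j \<sigma>) =
        face K (Suc m) (j - 1) (face K (Suc (Suc m)) i \<sigma>)) \<and>
     (\<forall>m. \<forall>\<sigma>\<in>cells K m. inj_on (\<lambda>i. vertex K m i \<sigma>) {..m})"

text \<open>Simplices are tagged with their dimension.\<close>

definition simplices :: "'a gcomplex \<Rightarrow> (nat \<times> 'a) set" where
  "simplices K = Sigma UNIV (cells K)"

definition facet_rel :: "'a gcomplex \<Rightarrow> ((nat \<times> 'a) \<times> (nat \<times> 'a)) set" where
  "facet_rel K = {((m, face K (Suc m) i \<sigma>), (Suc m, \<sigma>)) | m i \<sigma>. \<sigma> \<in> cells K (Suc m) \<and> i \<le> Suc m}"

text \<open>\<open>S\<close> is the set of simplices of a subcomplex.  Its simplex \<open>\<sigma>\<close> is removed together with a facet \<open>\<tau>\<close> of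
  \<open>\<sigma>\<close> that is free, i.e. not a proper face of any other simplex of \<open>S\<close>.  (As the vertices of \<open>\<sigma>\<close> are
  distinct, \<open>\<tau>\<close> occurs only once among the facets of \<open>\<sigma>\<close>.)\<close>

definition elementary_collapse ::
  "'a gcomplex \<Rightarrow> (nat \<times> 'a) set \<Rightarrow> (nat \<times> 'a) set \<Rightarrow> bool" where
  "elementary_collapse K S T \<longleftrightarrow>
     (\<exists>\<sigma>\<in>S. \<exists>\<tau>\<in>S. (\<tau>, \<sigma>) \<in> facet_rel K \<and> (\<forall>\<rho>\<in>S. (\<tau>, \<rho>) \<in> (facet_rel K)\<^sup>+ \<longrightarrow> \<rho> = \<sigma>) \<and>
        T = S - {\<sigma>, \<tau>})"

definition collapsible :: "'a gcomplex \<Rightarrow> bool" where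
  "collapsible K \<longleftrightarrow>
     (\<exists>v\<in>cells K 0. (elementary_collapse K)\<^sup>*\<^sup>* (simplices K) {(0, v)})"


section \<open>Geometric realization\<close>

text \<open>The quotient topology on the image of \<open>f\<close>.\<close>

definition quotient_topology :: "'a topology \<Rightarrow> ('a \<Rightarrow> 'b) \<Rightarrow> 'b topology" where
  "quotient_topology X f =
     topology (\<lambda>U. U \<subseteq> f ` topspace X \<and> openin X {x \<in> topspace X. f x \<in> U})"

lemma openin_quotient_topology:
  "openin (quotient_topology X f) U \<longleftrightarrow>
     U \<subseteq> f ` topspace X \<and> openin X {x \<in> topspace X. f x \<in> U}"
proof -
  have 1: "{x \<in> topspace X. f x \<in> S \<inter> T} =
      {x \<in> topspace X. f x \<in> S} \<inter> {x \<in> topspace X. f x \<in> T}" for S T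
    by auto
  have 2: "{x \<in> topspace X. f x \<in> \<Union>\<K>} = (\<Union>S\<in>\<K>. {x \<in> topspace X. f x \<in> S})" for \<K>
    by auto
  have "istopology (\<lambda>U. U \<subseteq> f ` topspace X \<and> openin X {x \<in> topspace X. f x \<in> U})"
    unfolding istopology_def 1 2 by (auto intro!: openin_Int openin_Union)
  then show ?thesis
    by (simp add: quotient_topology_def topology_inverse')
qed

lemma topspace_quotient_topology [simp]: "topspace (quotient_topology X f) = f ` topspace X"
proof (rule antisym)
  show "topspace (quotient_topology X f) \<subseteq> f ` topspace X"
    using openin_topspace[of "quotient_topology X f"] unfolding openin_quotient_topology by (rule conjunct1)
  have "{x \<in> topspace X. f x \<in> f ` topspace X} = topspace X"
    by auto
  then show "f ` topspace X \<subseteq> topspace (quotient_topology X f)"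
    by (intro openin_subset) (simp add: openin_quotient_topology)
qed

lemma quotient_map_quotient_topology: "quotient_map X (quotient_topology X f) f"
  by (simp add: quotient_map_def openin_quotient_topology)

text \<open>The gluing relation on the disjoint union of one standard \<open>m\<close>-simplex for each \<open>m\<close>-simplex of \<open>K\<close>:
  the equivalence relation generated by identifying the simplex of each facet with the corresponding
  geometric face.\<close>

definition glue :: "'a gcomplex \<Rightarrow> (((nat \<times> 'a) \<times> (nat \<Rightarrow> real)) \<times> ((nat \<times> 'a) \<times> (nat \<Rightarrow> real))) set" where
  "glue K =
     (let r = {(((m, face K (Suc m) i \<sigma>), t), ((Suc m, \<sigma>), simplical_face i t)) | m i \<sigma> t.
                 \<sigma> \<in> cells K (Suc m) \<and> i \<le> Suc m \<and> t \<in> standard_simplex m}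
      in (r \<union> r\<inverse>)\<^sup>*)"

definition realization :: "'a gcomplex \<Rightarrow> ((nat \<times> 'a) \<times> (nat \<Rightarrow> real)) set topology" where
  "realization K =
     quotient_topology
       (sum_topology (\<lambda>(m, \<sigma>). subtopology (powertop_real UNIV) (standard_simplex m)) (simplices K))
       (\<lambda>x. glue K `` {x})"


section \<open>The complex of filtered graphs and the moduli space of metric graphs\<close>

text \<open>Both kinds of faces are compatible with isomorphisms of filtered graphs, so each of the unions below is
  a single isomorphism class.\<close>

definition Delta :: "int \<Rightarrow> (nat, nat) fgraph set gcomplex" where
  "Delta g =
     \<lparr>cells = (\<lambda>m. {fclass (G, \<pi>) | (G :: (nat, nat) mgraph) \<pi>.
                 stable G \<and> genus G = g \<and> filtered_by_forests (G, \<pi>) \<and> length \<pi> = m + 1}),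
      face = (\<lambda>m i c.
        if i = 0 then \<Union>(G, \<pi>)\<in>c. fclass (contract G (hd \<pi>), tl \<pi>)
        else \<Union>(G, \<pi>)\<in>c. fclass (G, merge_blocks i \<pi>))\<rparr>"

text \<open>Isometries of metric graphs are length-preserving graph isomorphisms; isometry classes are again
  represented by sets of copies on natural numbers.\<close>

definition isometry_class ::
  "('v, 'e) mgraph \<Rightarrow> ('e \<Rightarrow> real) \<Rightarrow> ((nat, nat) mgraph \<times> (nat \<Rightarrow> real)) set" where
  "isometry_class G l =
     {(H, k). \<exists>f h. graph_iso G H f h \<and> (\<forall>e\<in>edges G. k (h e) = l e)}"

definition length_space :: "(nat, nat) mgraph \<Rightarrow> (nat \<Rightarrow> real) topology" where
  "length_space G =
     subtopology (product_topology (\<lambda>_. euclideanreal) (edges G))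
       {l \<in> edges G \<rightarrow>\<^sub>E {0..}. forest G {e \<in> edges G. l e = 0}}"

definition metric_graphs ::
  "int \<Rightarrow> ((nat, nat) mgraph \<times> (nat \<Rightarrow> real)) set topology" where
  "metric_graphs g =
     quotient_topology
       (sum_topology length_space {G. stable G \<and> genus G = g})
       (\<lambda>(G, l). isometry_class (contract G {e \<in> edges G. l e = 0}) l)"

definition X0 :: "int \<Rightarrow> ((nat, nat) mgraph \<times> (nat \<Rightarrow> real)) set topology" where
  "X0 g =
     subtopology (metric_graphs g)
       {isometry_class G l | (G :: (nat, nat) mgraph) l.
          stable G \<and> genus G = g \<and> (\<forall>e\<in>edges G. 0 < l e \<and> l e \<le> 1) \<and> (\<exists>e\<in>edges G. l e = 1) \<and>
          forest G {e \<in> edges G. l e < 1}}"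

end

theory Submission
  imports Defs
begin

text \<open>
  A simplex of \<open>Delta g\<close> is a stable graph \<open>G\<close> with a chain of forests \<open>{} = F\<^sub>0 \<subset> F\<^sub>1 \<subset> \<dots> \<subset> F\<^sub>m\<close>, up to isomorphism, where
  \<open>F\<^sub>i\<close> is the union of the first \<open>i\<close> blocks.  Its vertices are the graphs \<open>G/F\<^sub>i\<close>, which differ in their
  numbers of edges.  That \<open>Delta g\<close> is a complex (\<open>gen_simplicial_complex_Delta\<close>) rests on the calculus of
  contractions: forests can be contracted in stages, and this preserves stability and genus.

  \<^bold>\<open>The moduli space.\<close>  A metric graph in \<open>X0 g\<close> is determined by its level sets of lengths in increasing
  order, which form a filtration by forests, and by the differences of successive lengths, which are
  barycentric coordinates.  Both \<open>realization (Delta g)\<close> and \<open>X0 g\<close> are therefore quotients of the disjoint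
  union of one simplex for each filtered graph on natural numbers.  For the realization, this is immediate
  (\<open>quotient_map_to_cell\<close>).  For \<open>X0 g\<close>, it holds because the length functions of one graph are covered by
  finitely many compact simplices, so that the relevant maps are closed (\<open>quotient_map_metric_point\<close>).  The
  two quotient maps have the same fibres (\<open>fibres_agree\<close>): both identify a point that has vanishing
  coordinates with a point in the interior of a face, and interior points only up to isomorphism.

  \<^bold>\<open>The collapse.\<close>  The complex \<open>Delta 3\<close> is collapsed with an acyclic matching of its simplices
  (\<open>collapsible_matching\<close>), which leaves only the graph with one vertex.  The simplices that start with the
  same graph \<open>G\<close> are matched with each other: a chain of forests is matched with one that has an additional
  member.  A facet that starts with another graph starts with one that has fewer vertices, so the
  graphs are treated by decreasing number of vertices, and for each graph it remains to collapse the space of chains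
  of forests of \<open>G\<close> modulo automorphisms.

  Since valencies are at least three, \<open>G\<close> has at most four vertices.  The forests have at most three edges,
  and there are eight shapes of chains (\<open>chain_shape\<close>).  The matching (\<open>partner\<close>) is given by rules in terms
  of these shapes, of parallel edges and of disjoint pairs of edges, so that its acyclicity can be read off
  from the shapes alone (\<open>merge_rank\<close>).  The graphs of genus three enter in the proof that the additional
  forest exists and is unique up to automorphisms (\<open>partner_exists\<close>, \<open>partner_unique\<close>).  Counting edges at
  the vertices shows that there are enough automorphisms: a graph with four vertices is cubic without
  loops, so the pairs \<open>pq\<close> and \<open>xy\<close> of a partition of the vertices carry equally many edges, and Klein's
  four-group acts; with three vertices, two of them can be exchanged.
\<close>

section \<open>Linked vertices and forests\<close>

lemma adj_iff: "(u, v) \<in> adj G F \<longleftrightarrow> (\<exists>e\<in>F. ends G e = {u, v})"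
  by (simp add: adj_def)

lemma sym_adj: "sym (adj G F)"
  by (auto simp: adj_def sym_def insert_commute)

lemma adj_mono: "F \<subseteq> F' \<Longrightarrow> adj G F \<subseteq> adj G F'"
  by (auto simp: adj_def)

lemma linked_mono: "(u, v) \<in> (adj G F)\<^sup>* \<Longrightarrow> F \<subseteq> F' \<Longrightarrow> (u, v) \<in> (adj G F')\<^sup>*"
  using rtrancl_mono[OF adj_mono] by blast

lemma linked_sym: "(u, v) \<in> (adj G F)\<^sup>* \<Longrightarrow> (v, u) \<in> (adj G F)\<^sup>*"
  using sym_rtrancl[OF sym_adj] by (metis symD)

lemma unlinked_iff:
  assumes "ends G e = {x, y}"
  shows "(\<forall>u v. ends G e = {u, v} \<longrightarrow> (u, v) \<notin> (adj G F)\<^sup>*) \<longleftrightarrow> (x, y) \<notin> (adj G F)\<^sup>*"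
proof
  assume n: "(x, y) \<notin> (adj G F)\<^sup>*"
  then have "(y, x) \<notin> (adj G F)\<^sup>*" using linked_sym[of y x] by blast
  with n show "\<forall>u v. ends G e = {u, v} \<longrightarrow> (u, v) \<notin> (adj G F)\<^sup>*"
    unfolding assms doubleton_eq_iff by (intro allI impI) (elim disjE conjE, simp_all)
qed (use assms in blast)

lemma linked_edge: "e \<in> F \<Longrightarrow> u \<in> ends G e \<Longrightarrow> v \<in> ends G e \<Longrightarrow> ends G e = {x, y} \<Longrightarrow> (u, v) \<in> (adj G F)\<^sup>*"
  by (cases "u = v") (auto simp: adj_def doubleton_eq_iff intro!: r_into_rtrancl)

lemma linked_insert:
  assumes "(u, v) \<in> (adj G (insert f H))\<^sup>*" and "ends G f = {a, b}"
  shows "(u, v) \<in> (adj G H)\<^sup>* \<or> (u, a) \<in> (adj G H)\<^sup>* \<and> (b, v) \<in> (adj G H)\<^sup>* \<or>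
    (u, b) \<in> (adj G H)\<^sup>* \<and> (a, v) \<in> (adj G H)\<^sup>*"
  using assms(1)
proof (induction rule: rtrancl_induct)
  case base
  then show ?case by simp
next
  case (step y z)
  have "(y, z) \<in> adj G H \<or> (y = a \<and> z = b) \<or> (y = b \<and> z = a)"
    using step(2) assms(2) by (auto simp: adj_def doubleton_eq_iff)
  then show ?case
    using step(3) by (meson linked_sym rtrancl.rtrancl_into_rtrancl rtrancl_trans rtrancl.rtrancl_refl)
qed

lemma graph_ends:
  assumes "graph G" "e \<in> edges G"
  obtains u v where "ends G e = {u, v}" "u \<in> verts G" "v \<in> verts G"
proof -
  have "ends G e \<subseteq> verts G" "card (ends G e) = 1 \<or> card (ends G e) = 2"
    using assms by (auto simp: graph_def)
  moreover from this(2) have "\<exists>u v. ends G e = {u, v}"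
    by (auto simp: card_1_singleton_iff card_2_iff)
  ultimately show thesis using that by auto
qed

lemma linked_in_verts:
  assumes "(u, v) \<in> (adj G F)\<^sup>*" "graph G" "F \<subseteq> edges G" "u \<in> verts G"
  shows "v \<in> verts G"
  using assms(1)
proof (cases rule: rtranclE)
  case base
  then show ?thesis using assms by simp
next
  case (step y)
  then obtain e where "e \<in> F" "ends G e = {y, v}" by (auto simp: adj_def)
  then show ?thesis using assms by (auto simp: graph_def)
qed

text \<open>A shortest walk is a path: revisiting a vertex cuts the walk back to its first visit.\<close>

lemma linked_path:
  assumes "(u, v) \<in> (adj G F)\<^sup>*"
  shows "\<exists>vs es. hd vs = u \<and> last vs = v \<and> distinct vs \<and> length vs = Suc (length es) \<and> set es \<subseteq> F \<and>
    (\<forall>i<length es. ends G (es ! i) = {vs ! i, vs ! Suc i})"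
  using assms
proof (induction rule: rtrancl_induct)
  case base
  show ?case by (rule exI[of _ "[u]"], rule exI[of _ "[]"]) simp
next
  case (step y z)
  then obtain vs es where vs: "hd vs = u" "last vs = y" "distinct vs" "length vs = Suc (length es)"
    "set es \<subseteq> F" "\<forall>i<length es. ends G (es ! i) = {vs ! i, vs ! Suc i}" by blast
  obtain e where e: "e \<in> F" "ends G e = {y, z}" using step(2) by (auto simp: adj_def)
  have ne: "vs \<noteq> []" using vs(4) by auto
  show ?case
  proof (cases "z \<in> set vs")
    case True
    then obtain k where k: "k < length vs" "vs ! k = z" by (auto simp: in_set_conv_nth)
    have "hd (take (Suc k) vs) = u" using vs(1) ne by simp
    moreover have "last (take (Suc k) vs) = z" using k by (simp add: take_Suc_conv_app_nth)
    moreover have "length (take (Suc k) vs) = Suc (length (take k es))" using k vs(4) by simp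
    moreover have "\<forall>i<length (take k es). ends G (take k es ! i) = {take (Suc k) vs ! i, take (Suc k) vs ! Suc i}"
      using vs(6) by simp
    moreover have "set (take k es) \<subseteq> F" using vs(5) set_take_subset by fast
    ultimately show ?thesis using vs(3) distinct_take by blast
  next
    case False
    have "vs ! length es = y" using vs(2,4) ne by (simp add: last_conv_nth)
    then have "\<forall>i<length (es @ [e]). ends G ((es @ [e]) ! i) = {(vs @ [z]) ! i, (vs @ [z]) ! Suc i}"
      using vs(4,6) e(2) by (auto simp: nth_append less_Suc_eq)
    then show ?thesis using vs ne e(1) False
      by (intro exI[of _ "vs @ [z]"] exI[of _ "es @ [e]"]) auto
  qed
qed

text \<open>A path between the ends of an edge closes up to a cycle.  In contrast to cycles, links behave well under
  contractions.\<close>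

lemma forest_iff:
  "forest G F \<longleftrightarrow> (\<forall>e\<in>F. \<forall>u v. ends G e = {u, v} \<longrightarrow> (u, v) \<notin> (adj G (F - {e}))\<^sup>*)"
proof
  assume fo: "forest G F"
  show "\<forall>e\<in>F. \<forall>u v. ends G e = {u, v} \<longrightarrow> (u, v) \<notin> (adj G (F - {e}))\<^sup>*"
  proof (intro ballI allI impI notI)
    fix e u v assume e: "e \<in> F" "ends G e = {u, v}" "(u, v) \<in> (adj G (F - {e}))\<^sup>*"
    obtain vs es where vs: "hd vs = u" "last vs = v" "distinct vs" "length vs = Suc (length es)"
      "set es \<subseteq> F - {e}" "\<forall>i<length es. ends G (es ! i) = {vs ! i, vs ! Suc i}"
      using linked_path[OF e(3)] by blast
    have ne: "vs \<noteq> []" using vs(4) by auto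
    have "distinct es"
      unfolding distinct_conv_nth
    proof (intro allI impI notI)
      fix i j assume ij: "i < length es" "j < length es" "i \<noteq> j" "es ! i = es ! j"
      then have "{vs ! i, vs ! Suc i} = {vs ! j, vs ! Suc j}" using vs(6) by metis
      then show False using ij vs(3,4)
        by (auto simp: doubleton_eq_iff nth_eq_iff_index_eq)
    qed
    moreover have "vs ! length es = v" "vs ! 0 = u"
      using vs(1,2,4) ne by (auto simp: last_conv_nth hd_conv_nth)
    then have "\<forall>i<length (es @ [e]). ends G ((es @ [e]) ! i) = {vs ! i, vs ! (Suc i mod length (es @ [e]))}"
      using vs(6) e(2) by (simp add: nth_append less_Suc_eq all_conj_distrib) (auto simp: insert_commute)
    ultimately have "is_cycle G F vs (es @ [e])"
      using vs e(1) by (auto simp: is_cycle_def)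
    then show False using fo by (auto simp: forest_def)
  qed
next
  assume *: "\<forall>e\<in>F. \<forall>u v. ends G e = {u, v} \<longrightarrow> (u, v) \<notin> (adj G (F - {e}))\<^sup>*"
  show "forest G F"
    unfolding forest_def
  proof (intro notI, elim exE)
    fix vs es assume c: "is_cycle G F vs es"
    define n where "n = length es"
    have n: "n > 0" using c by (auto simp: is_cycle_def n_def)
    define e where "e = es ! (n - 1)"
    have ends: "\<And>i. i < n \<Longrightarrow> ends G (es ! i) = {vs ! i, vs ! (Suc i mod n)}"
      and d: "distinct es" and sub: "set es \<subseteq> F" using c by (auto simp: is_cycle_def n_def)
    have "(vs ! 0, vs ! k) \<in> (adj G (F - {e}))\<^sup>*" if "k < n" for k
      using that
    proof (induction k)
      case (Suc k)
      have "es ! k \<noteq> e" "es ! k \<in> F" using Suc(2) d sub n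
        by (auto simp: e_def n_def nth_eq_iff_index_eq)
      moreover have "ends G (es ! k) = {vs ! k, vs ! Suc k}" using ends[of k] Suc(2) by simp
      ultimately have "(vs ! k, vs ! Suc k) \<in> adj G (F - {e})" by (auto simp: adj_def)
      then show ?case using Suc by (meson Suc_lessD rtrancl.rtrancl_into_rtrancl)
    qed simp
    then have "(vs ! 0, vs ! (n - 1)) \<in> (adj G (F - {e}))\<^sup>*" using n by simp
    moreover have "ends G e = {vs ! 0, vs ! (n - 1)}" using ends[of "n - 1"] n by (simp add: e_def insert_commute)
    moreover have "e \<in> F" using sub n by (auto simp: e_def n_def)
    ultimately show False using * by blast
  qed
qed

lemma forest_subset: "forest G F \<Longrightarrow> F' \<subseteq> F \<Longrightarrow> forest G F'"
  by (auto simp: forest_def is_cycle_def)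

lemma forest_empty: "forest G {}"
  by (simp add: forest_iff)

text \<open>A new link between the ends of an old edge \<open>e\<close> would run through \<open>f\<close>.  The rest of it, together with \<open>e\<close>,
  would link the ends of \<open>f\<close>.\<close>

lemma forest_insert:
  assumes "forest G F" "ends G f = {a, b}" "(a, b) \<notin> (adj G F)\<^sup>*"
  shows "forest G (insert f F)"
  unfolding forest_iff
proof (intro ballI allI impI notI)
  fix e u v assume e: "e \<in> insert f F" "ends G e = {u, v}" "(u, v) \<in> (adj G (insert f F - {e}))\<^sup>*"
  have fF: "f \<notin> F" using assms(2,3) by (auto simp: adj_def)
  have ab: "(b, a) \<notin> (adj G F)\<^sup>*" using assms(3) linked_sym by metis
  show False
  proof (cases "e = f")
    case True
    then have "(u, v) \<in> (adj G F)\<^sup>*" using e(3) fF by simp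
    then show False using True e(2) assms(2,3) ab by (auto simp: doubleton_eq_iff)
  next
    case False
    let ?H = "F - {e}"
    have eF: "e \<in> F" using False e(1) by simp
    have up: "(y, x) \<in> (adj G F)\<^sup>*" if "(x, y) \<in> (adj G ?H)\<^sup>*" for x y
      by (rule linked_sym[OF linked_mono[OF that]]) blast
    have uv: "(u, v) \<in> (adj G F)\<^sup>*" by (rule linked_edge[OF eF _ _ e(2)]) (use e(2) in auto)
    have "(u, v) \<in> (adj G (insert f ?H))\<^sup>*" using e(3) False by (simp add: insert_Diff_if)
    from linked_insert[OF this assms(2)] show False
    proof (elim disjE conjE)
      assume "(u, v) \<in> (adj G ?H)\<^sup>*"
      then show False using assms(1) eF e(2) by (auto simp: forest_iff)
    next
      assume "(u, a) \<in> (adj G ?H)\<^sup>*" "(b, v) \<in> (adj G ?H)\<^sup>*"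
      then have "(a, b) \<in> (adj G F)\<^sup>*" using rtrancl_trans[OF rtrancl_trans[OF up uv] up] by blast
      then show False using assms(3) by simp
    next
      assume "(u, b) \<in> (adj G ?H)\<^sup>*" "(a, v) \<in> (adj G ?H)\<^sup>*"
      then have "(b, a) \<in> (adj G F)\<^sup>*" using rtrancl_trans[OF rtrancl_trans[OF up uv] up] by blast
      then show False using ab by simp
    qed
  qed
qed

section \<open>Isomorphisms of graphs\<close>

lemma graph_iso_ends: "graph_iso G H f h \<Longrightarrow> e \<in> edges G \<Longrightarrow> ends H (h e) = f ` ends G e"
  by (simp add: graph_iso_def)

lemma graph_iso_id: "graph_iso G G id id"
  by (simp add: graph_iso_def)

lemma graph_iso_trans: "graph_iso G H f h \<Longrightarrow> graph_iso H K f' h' \<Longrightarrow> graph_iso G K (f' \<circ> f) (h' \<circ> h)"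
  by (auto simp: graph_iso_def image_comp intro: bij_betw_trans dest: bij_betwE)

lemma graph_iso_inv:
  assumes "graph_iso G H f h" "\<forall>e\<in>edges G. ends G e \<subseteq> verts G"
  shows "graph_iso H G (inv_into (verts G) f) (inv_into (edges G) h)"
proof -
  let ?h = "inv_into (edges G) h"
  have f: "bij_betw f (verts G) (verts H)" and h: "bij_betw h (edges G) (edges H)"
    using assms(1) by (auto simp: graph_iso_def)
  have "ends G (?h e) = inv_into (verts G) f ` ends H e" if "e \<in> edges H" for e
  proof -
    have e: "?h e \<in> edges G" "h (?h e) = e" using that h
      by (auto simp: bij_betw_def inv_into_into f_inv_into_f)
    then have "ends H e = f ` ends G (?h e)" using graph_iso_ends[OF assms(1) e(1)] by simp
    then show ?thesis using e(1) assms(2) f by (simp add: bij_betw_def)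
  qed
  then show ?thesis using f h by (simp add: graph_iso_def bij_betw_inv_into)
qed

lemma linked_iso:
  assumes "graph_iso G H f h" "F \<subseteq> edges G" "(u, v) \<in> (adj G F)\<^sup>*"
  shows "(f u, f v) \<in> (adj H (h ` F))\<^sup>*"
  using assms(3)
proof (induction rule: rtrancl_induct)
  case (step y z)
  then obtain e where "e \<in> F" "ends G e = {y, z}" by (auto simp: adj_def)
  then have "ends H (h e) = {f y, f z}" "h e \<in> h ` F"
    using assms graph_iso_ends by fastforce+
  then have "(f y, f z) \<in> adj H (h ` F)" unfolding adj_def by blast
  then show ?case using step.IH by (rule rtrancl.rtrancl_into_rtrancl[rotated])
qed simp

lemma linked_iso_iff:
  assumes "graph_iso G H f h" "graph G" "F \<subseteq> edges G" "u \<in> verts G" "v \<in> verts G"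
  shows "(f u, f v) \<in> (adj H (h ` F))\<^sup>* \<longleftrightarrow> (u, v) \<in> (adj G F)\<^sup>*"
proof
  let ?f = "inv_into (verts G) f" and ?h = "inv_into (edges G) h"
  have i: "graph_iso H G ?f ?h" using graph_iso_inv[OF assms(1)] assms(2) by (auto simp: graph_def)
  have *: "inj_on f (verts G)" "inj_on h (edges G)" "h ` edges G = edges H"
    using assms(1) by (auto simp: graph_iso_def bij_betw_def)
  assume "(f u, f v) \<in> (adj H (h ` F))\<^sup>*"
  from linked_iso[OF i _ this] have "(?f (f u), ?f (f v)) \<in> (adj G (?h ` h ` F))\<^sup>*"
    using *(3) assms(3) by blast
  then show "(u, v) \<in> (adj G F)\<^sup>*"
    using * assms(3-5) by (simp add: inv_into_image_cancel)
qed (rule linked_iso[OF assms(1,3)])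

lemma graph_iso_forest:
  assumes "graph_iso G H f h" "graph G" "F \<subseteq> edges G"
  shows "forest H (h ` F) \<longleftrightarrow> forest G F"
proof -
  have inj: "inj_on h (edges G)" "inj_on f (verts G)" using assms(1) by (auto simp: graph_iso_def bij_betw_def)
  have "(\<forall>u v. ends H (h e) = {u, v} \<longrightarrow> (u, v) \<notin> (adj H (h ` F - {h e}))\<^sup>*) \<longleftrightarrow>
        (\<forall>u v. ends G e = {u, v} \<longrightarrow> (u, v) \<notin> (adj G (F - {e}))\<^sup>*)" if e: "e \<in> F" for e
  proof -
    have eE: "e \<in> edges G" using e assms(3) by blast
    obtain x y where xy: "ends G e = {x, y}" "x \<in> verts G" "y \<in> verts G"
      using graph_ends[OF assms(2) eE] by blast
    have d: "h ` F - {h e} = h ` (F - {e})" using inj(1) assms(3) e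
      by (auto simp: inj_on_def)
    have "ends H (h e) = {f x, f y}" using graph_iso_ends[OF assms(1) eE] xy by simp
    moreover have "(f x, f y) \<in> (adj H (h ` (F - {e})))\<^sup>* \<longleftrightarrow> (x, y) \<in> (adj G (F - {e}))\<^sup>*"
      by (rule linked_iso_iff[OF assms(1,2)]) (use assms(3) xy in auto)
    ultimately show ?thesis unfolding d unlinked_iff[OF xy(1)] using unlinked_iff[of H "h e"] by simp
  qed
  then show ?thesis unfolding forest_iff by simp
qed

lemma graph_iso_connected_by:
  assumes "graph_iso G H f h" "graph G" "F \<subseteq> edges G"
  shows "connected_by H (h ` F) \<longleftrightarrow> connected_by G F"
proof -
  have "verts H = f ` verts G" using assms(1) by (auto simp: graph_iso_def bij_betw_def)
  then show ?thesis using linked_iso_iff[OF assms] by (auto simp: connected_by_def)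
qed

lemma graph_iso_graph:
  assumes "graph_iso G H f h" "graph G"
  shows "graph H"
proof -
  have V: "verts H = f ` verts G" "inj_on f (verts G)" and E: "edges H = h ` edges G"
    using assms(1) by (auto simp: graph_iso_def bij_betw_def)
  have "ends H (h e) \<subseteq> verts H \<and> card (ends H (h e)) = card (ends G e)" if "e \<in> edges G" for e
  proof -
    have s: "ends G e \<subseteq> verts G" using assms(2) that by (auto simp: graph_def)
    have "card (f ` ends G e) = card (ends G e)"
      by (rule card_image) (rule inj_on_subset[OF V(2) s])
    then show ?thesis using s V graph_iso_ends[OF assms(1) that] by auto
  qed
  moreover have "connected_by H (edges H)"
    using graph_iso_connected_by[OF assms order_refl] E assms(2) by (simp add: graph_def)
  ultimately show ?thesis using assms(2) V E by (auto simp: graph_def)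
qed

lemma graph_iso_card:
  "graph_iso G H f h \<Longrightarrow> card (verts H) = card (verts G)"
  "graph_iso G H f h \<Longrightarrow> card (edges H) = card (edges G)"
  by (auto simp: graph_iso_def dest: bij_betw_same_card)

lemma graph_iso_genus: "graph_iso G H f h \<Longrightarrow> genus H = genus G"
  by (simp add: genus_def graph_iso_card)

lemma graph_iso_card_edges:
  assumes "graph_iso G H f h" "graph G" "\<And>e. e \<in> edges G \<Longrightarrow> Q (h e) \<longleftrightarrow> P e"
  shows "card {e \<in> edges H. Q e} = card {e \<in> edges G. P e}"
proof -
  have h: "inj_on h (edges G)" "edges H = h ` edges G" using assms(1) by (auto simp: graph_iso_def bij_betw_def)
  have "{e \<in> edges H. Q e} = h ` {e \<in> edges G. P e}" using assms(3) h(2) by auto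
  then show ?thesis using h(1) by (simp add: card_image inj_on_subset[OF h(1)])
qed

lemma graph_iso_valency:
  assumes "graph_iso G H f h" "graph G" "v \<in> verts G"
  shows "valency H (f v) = valency G v"
proof -
  have inj: "inj_on f (verts G)" using assms(1) by (auto simp: graph_iso_def bij_betw_def)
  have "f v \<in> ends H (h e) \<longleftrightarrow> v \<in> ends G e" "ends H (h e) = {f v} \<longleftrightarrow> ends G e = {v}"
    if "e \<in> edges G" for e
  proof -
    have s: "ends G e \<subseteq> verts G" using assms(2) that by (auto simp: graph_def)
    show "f v \<in> ends H (h e) \<longleftrightarrow> v \<in> ends G e"
      using graph_iso_ends[OF assms(1) that] inj_on_image_mem_iff[OF inj assms(3) s] by simp
    show "ends H (h e) = {f v} \<longleftrightarrow> ends G e = {v}"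
      using graph_iso_ends[OF assms(1) that] inj_on_image_eq_iff[OF inj s, of "{v}"] assms(3) by simp
  qed
  then show ?thesis unfolding valency_def
    by (simp add: graph_iso_card_edges[OF assms(1,2)])
qed

lemma graph_iso_stable:
  assumes "graph_iso G H f h" "stable G"
  shows "stable H"
proof -
  have g: "graph G" using assms(2) by (simp add: stable_def)
  have V: "verts H = f ` verts G" "inj_on f (verts G)" and E: "edges H = h ` edges G" "inj_on h (edges G)"
    using assms(1) by (auto simp: graph_iso_def bij_betw_def)
  have "\<not> bridge H (h e)" if "e \<in> edges G" for e
  proof -
    have "edges H - {h e} = h ` (edges G - {e})" using E that by (auto simp: inj_on_def)
    moreover have "connected_by G (edges G - {e})" using assms(2) that by (auto simp: stable_def bridge_def)
    ultimately show ?thesis using graph_iso_connected_by[OF assms(1) g, of "edges G - {e}"]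
      by (auto simp: bridge_def)
  qed
  moreover have "\<exists>e\<in>edges H. ends H e = {f v}" if "v \<in> verts G" "valency H (f v) = 2" for v
  proof -
    have "valency G v = 2" using that graph_iso_valency[OF assms(1) g that(1)] by simp
    then obtain e where e: "e \<in> edges G" "ends G e = {v}"
      using assms(2) \<open>v \<in> verts G\<close> unfolding stable_def by blast
    then have "ends H (h e) = {f v}" using graph_iso_ends[OF assms(1)] by simp
    then show ?thesis using e(1) E by blast
  qed
  ultimately show ?thesis
    using graph_iso_graph[OF assms(1) g] V E by (auto simp: stable_def bridge_def)
qed

section \<open>Contraction of edges\<close>

definition component :: "('v, 'e) mgraph \<Rightarrow> 'e set \<Rightarrow> 'v \<Rightarrow> 'v set" where
  "component G F v = (adj G F)\<^sup>* `` {v}"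

lemma component_eq_iff: "component G F u = component G F v \<longleftrightarrow> (u, v) \<in> (adj G F)\<^sup>*"
  by (auto simp: component_def intro: rtrancl_trans linked_sym)

lemma contract_simps [simp]:
  "verts (contract G F) = component G F ` verts G"
  "edges (contract G F) = edges G - F"
  "ends (contract G F) e = component G F ` ends G e"
  by (simp_all add: contract_def Let_def component_def)

text \<open>A walk in the contraction lifts to a walk in \<open>G\<close> that moves inside the components of \<open>Z\<close> as needed.\<close>

lemma linked_contract:
  assumes "graph G" "F \<subseteq> edges G"
  shows "(component G Z u, component G Z v) \<in> (adj (contract G Z) F)\<^sup>* \<longleftrightarrow> (u, v) \<in> (adj G (Z \<union> F))\<^sup>*"
proof
  assume "(component G Z u, component G Z v) \<in> (adj (contract G Z) F)\<^sup>*"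
  then have "\<exists>w. component G Z v = component G Z w \<and> (u, w) \<in> (adj G (Z \<union> F))\<^sup>*"
  proof (induction rule: rtrancl_induct)
    case (step B C)
    then obtain w where w: "B = component G Z w" "(u, w) \<in> (adj G (Z \<union> F))\<^sup>*" by auto
    obtain e where e: "e \<in> F" "component G Z ` ends G e = {B, C}"
      using step(2)[unfolded adj_iff contract_simps] by (rule bexE)
    have "e \<in> edges G" using e(1) assms(2) by (rule subsetD[rotated])
    then obtain a b where ab: "ends G e = {a, b}" by (rule graph_ends[OF assms(1)])
    obtain x where x: "x \<in> ends G e" "B = component G Z x" using e(2) by (metis imageE insertI1)
    obtain y where y: "y \<in> ends G e" "C = component G Z y" using e(2) by (metis imageE insertI1 insertI2)
    note xy = x(1) y(1) x(2) y(2)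
    have "(x, y) \<in> (adj G (Z \<union> F))\<^sup>*" using linked_edge[OF _ xy(1,2) ab] e(1) by simp
    moreover have "(w, x) \<in> (adj G Z)\<^sup>*" using w(1) xy(3) component_eq_iff by metis
    then have "(w, x) \<in> (adj G (Z \<union> F))\<^sup>*" by (rule linked_mono) simp
    ultimately have "(u, y) \<in> (adj G (Z \<union> F))\<^sup>*" using w(2) by (meson rtrancl_trans)
    then show ?case using xy(4) by blast
  qed auto
  then obtain w where "component G Z v = component G Z w" "(u, w) \<in> (adj G (Z \<union> F))\<^sup>*" by blast
  moreover from this(1) have "(w, v) \<in> (adj G (Z \<union> F))\<^sup>*"
    using component_eq_iff linked_mono by (metis Un_upper1)
  ultimately show "(u, v) \<in> (adj G (Z \<union> F))\<^sup>*" by (meson rtrancl_trans)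
next
  assume "(u, v) \<in> (adj G (Z \<union> F))\<^sup>*"
  then show "(component G Z u, component G Z v) \<in> (adj (contract G Z) F)\<^sup>*"
  proof (induction rule: rtrancl_induct)
    case (step y z)
    then obtain e where e: "e \<in> Z \<or> e \<in> F" "ends G e = {y, z}" by (auto simp: adj_def)
    show ?case
    proof (cases "e \<in> Z")
      case True
      then have "(y, z) \<in> (adj G Z)\<^sup>*" using e(2) by (auto simp: adj_def)
      then have "component G Z y = component G Z z" using component_eq_iff by metis
      then show ?thesis using step by simp
    next
      case False
      then have "e \<in> F" using e(1) by simp
      moreover have "ends (contract G Z) e = {component G Z y, component G Z z}" using e(2) by simp
      ultimately have "(component G Z y, component G Z z) \<in> adj (contract G Z) F"
        unfolding adj_def by blast
      then show ?thesis using step.IH by (rule rtrancl.rtrancl_into_rtrancl[rotated])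
    qed
  qed simp
qed

text \<open>Links after the contraction are links through \<open>Z\<close>.  In the direction from right to left, the edges of
  \<open>F - Z\<close> are added to \<open>Z\<close> one by one, as none of them joins linked vertices.\<close>

lemma forest_contract:
  assumes "graph G" "Z \<subseteq> F" "F \<subseteq> edges G"
  shows "forest G F \<longleftrightarrow> forest G Z \<and> forest (contract G Z) (F - Z)"
proof (intro iffI conjI)
  assume fo: "forest G F"
  then show "forest G Z" using assms(2) forest_subset by blast
  show "forest (contract G Z) (F - Z)"
    unfolding forest_iff
  proof (intro ballI allI impI notI)
    fix e A B assume e: "e \<in> F - Z" "ends (contract G Z) e = {A, B}"
      "(A, B) \<in> (adj (contract G Z) (F - Z - {e}))\<^sup>*"
    have "e \<in> edges G" using e(1) assms(3) by blast
    then obtain x y where xy: "ends G e = {x, y}" by (rule graph_ends[OF assms(1)])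
    have "(component G Z x, component G Z y) \<in> (adj (contract G Z) (F - Z - {e}))\<^sup>*"
    proof -
      have "component G Z x = A \<and> component G Z y = B \<or> component G Z x = B \<and> component G Z y = A"
        using e(2) by (simp add: xy doubleton_eq_iff)
      then show ?thesis using e(3) linked_sym[OF e(3)] by (elim disjE conjE) simp_all
    qed
    then have "(x, y) \<in> (adj G (Z \<union> (F - Z - {e})))\<^sup>*"
      by (rule iffD1[OF linked_contract[OF assms(1)], rotated]) (use assms(3) in auto)
    moreover have "Z \<union> (F - Z - {e}) = F - {e}" using assms(2) e(1) by blast
    moreover have "e \<in> F" using e(1) by simp
    ultimately show False using fo[unfolded forest_iff] unlinked_iff[OF xy, of "F - {e}"] by simp
  qed
next
  assume *: "forest G Z \<and> forest (contract G Z) (F - Z)"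
  have fin: "finite (F - Z)" using assms(1,3) finite_subset[of F "edges G"] by (simp add: graph_def)
  have "forest G (Z \<union> H)" if "finite H" "H \<subseteq> F - Z" for H
    using that
  proof (induction H)
    case empty
    then show ?case using * by simp
  next
    case (insert f H)
    have "f \<in> edges G" using insert(4) assms(3) by blast
    then obtain x y where xy: "ends G f = {x, y}" by (rule graph_ends[OF assms(1)])
    have "forest (contract G Z) (insert f H)" using * insert(4) forest_subset by blast
    then have "(component G Z x, component G Z y) \<notin> (adj (contract G Z) (insert f H - {f}))\<^sup>*"
      using unlinked_iff[of "contract G Z" f] xy unfolding forest_iff by simp
    then have "(x, y) \<notin> (adj G (Z \<union> H))\<^sup>*"
      using linked_contract[OF assms(1), of H Z x y] insert(2,4) assms(3) by auto
    moreover have "forest G (Z \<union> H)" using insert by simp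
    ultimately have "forest G (insert f (Z \<union> H))" by (rule forest_insert[OF _ xy, rotated])
    then show ?case by simp
  qed
  moreover have "Z \<union> (F - Z) = F" using assms(2) by blast
  ultimately show "forest G F" using fin by force
qed

lemma graph_contract:
  assumes "graph G" "Z \<subseteq> edges G"
  shows "graph (contract G Z)"
proof -
  have "card (component G Z ` ends G e) \<in> {1, 2}" if "e \<in> edges G" for e
  proof -
    obtain u v where "ends G e = {u, v}" by (rule graph_ends[OF assms(1) \<open>e \<in> edges G\<close>])
    then show ?thesis by (simp add: card_insert_if)
  qed
  moreover have "component G Z ` ends G e \<subseteq> component G Z ` verts G" if "e \<in> edges G" for e
    using that assms(1) unfolding graph_def by (meson image_mono)
  moreover have "connected_by (contract G Z) (edges G - Z)"
    using assms linked_contract[OF assms(1), of "edges G - Z" Z]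
    by (simp add: connected_by_def graph_def Un_absorb1)
  ultimately show ?thesis using assms(1) by (simp add: graph_def)
qed

lemma bridge_contract:
  assumes "graph G" "Z \<subseteq> edges G" "\<And>e. \<not> bridge G e"
  shows "\<not> bridge (contract G Z) e"
proof
  assume "bridge (contract G Z) e"
  then have e: "e \<in> edges G - Z" "\<not> connected_by (contract G Z) (edges G - Z - {e})"
    by (auto simp: bridge_def)
  have "connected_by G (edges G - {e})" using assms(3)[of e] e(1) by (auto simp: bridge_def)
  moreover have "Z \<union> (edges G - Z - {e}) = edges G - {e}" using e(1) assms(2) by auto
  ultimately show False using e(2) linked_contract[OF assms(1), of "edges G - Z - {e}" Z]
    unfolding connected_by_def by force
qed

text \<open>A contraction is determined by its fibres, so every map of vertices with the right fibres
  exhibits it.\<close>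

lemma contract_iso_via:
  assumes G: "graph G" and Z: "Z \<subseteq> edges G" and surj: "\<phi> ` verts G = verts H"
    and fib: "\<And>u v. u \<in> verts G \<Longrightarrow> v \<in> verts G \<Longrightarrow> \<phi> u = \<phi> v \<longleftrightarrow> (u, v) \<in> (adj G Z)\<^sup>*"
    and h: "bij_betw h (edges G - Z) (edges H)"
    and ends: "\<And>e. e \<in> edges G - Z \<Longrightarrow> ends H (h e) = \<phi> ` ends G e"
  shows "\<exists>g. graph_iso (contract G Z) H g h"
proof -
  define g where "g C = the_elem (\<phi> ` C)" for C
  have g: "g (component G Z v) = \<phi> v" if "v \<in> verts G" for v
  proof -
    have "\<phi> w = \<phi> v" if "w \<in> component G Z v" for w
      using that fib[of v w] \<open>v \<in> verts G\<close> linked_in_verts[OF _ G Z] by (auto simp: component_def)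
    moreover have "v \<in> component G Z v" by (simp add: component_def)
    ultimately have "\<phi> ` component G Z v = {\<phi> v}" by blast
    then show ?thesis by (simp add: g_def)
  qed
  have "inj_on g (component G Z ` verts G)"
  proof (rule inj_onI)
    fix A B assume AB: "A \<in> component G Z ` verts G" "B \<in> component G Z ` verts G" "g A = g B"
    obtain u v where uv: "A = component G Z u" "u \<in> verts G" "B = component G Z v" "v \<in> verts G"
      using AB(1,2) by (elim imageE)
    then have "\<phi> u = \<phi> v" using AB(3) g by simp
    then show "A = B" using fib[OF uv(2,4)] component_eq_iff[of G Z u v] uv by simp
  qed
  moreover have "g ` component G Z ` verts G = verts H"
    using g surj by (auto simp: image_image)
  moreover have "ends H (h e) = g ` component G Z ` ends G e" if "e \<in> edges G - Z" for e
  proof -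
    have "g ` component G Z ` ends G e = \<phi> ` ends G e"
      unfolding image_image using g that G by (intro image_cong) (auto simp: graph_def)
    then show ?thesis using ends[OF that] by simp
  qed
  ultimately show ?thesis using h by (auto simp: graph_iso_def bij_betw_def)
qed

lemma contract_empty_iso:
  assumes "graph G"
  shows "\<exists>g. graph_iso (contract G {}) G g id"
  by (rule contract_iso_via[where \<phi> = id]) (use assms in \<open>auto simp: adj_def bij_betw_def\<close>)

lemma contract_contract_iso:
  assumes "graph G" "Z \<union> F \<subseteq> edges G"
  shows "\<exists>g. graph_iso (contract G (Z \<union> F)) (contract (contract G Z) F) g id"
proof (rule contract_iso_via[where \<phi> = "\<lambda>v. component (contract G Z) F (component G Z v)"])
  fix u v
  show "component (contract G Z) F (component G Z u) = component (contract G Z) F (component G Z v) \<longleftrightarrow>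
    (u, v) \<in> (adj G (Z \<union> F))\<^sup>*"
    unfolding component_eq_iff using linked_contract[OF assms(1)] assms(2) by simp
qed (use assms in \<open>auto simp: bij_betw_def image_image\<close>)

lemma contract_iso:
  assumes "graph_iso G H f h" "graph G" "Z \<subseteq> edges G"
  shows "\<exists>g. graph_iso (contract G Z) (contract H (h ` Z)) g h"
proof (rule contract_iso_via[where \<phi> = "\<lambda>v. component H (h ` Z) (f v)"])
  have f: "bij_betw f (verts G) (verts H)" and h: "bij_betw h (edges G) (edges H)"
    using assms(1) by (auto simp: graph_iso_def)
  show "(\<lambda>v. component H (h ` Z) (f v)) ` verts G = verts (contract H (h ` Z))"
    using f by (simp add: bij_betw_def image_image[symmetric])
  show "bij_betw h (edges G - Z) (edges (contract H (h ` Z)))"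
    using bij_betw_DiffI[OF h bij_betw_subset[OF h assms(3)]] assms(3) h by (auto simp: bij_betw_def)
  show "component H (h ` Z) (f u) = component H (h ` Z) (f v) \<longleftrightarrow> (u, v) \<in> (adj G Z)\<^sup>*"
    if "u \<in> verts G" "v \<in> verts G" for u v
    unfolding component_eq_iff by (rule linked_iso_iff[OF assms that])
  show "ends (contract H (h ` Z)) (h e) = (\<lambda>v. component H (h ` Z) (f v)) ` ends G e"
    if "e \<in> edges G - Z" for e
    using that graph_iso_ends[OF assms(1)] by (auto simp: image_image)
qed (use assms in auto)

section \<open>Stability of contractions\<close>

text \<open>Valency one occurs only at a bridge.  An isolated vertex and a vertex with one loop and no other edges
  are whole graphs, of genus zero and one.\<close>

lemma stable_iff_valency:
  assumes "genus G \<ge> 2"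
  shows "stable G \<longleftrightarrow> graph G \<and> (\<forall>e. \<not> bridge G e) \<and> (\<forall>v\<in>verts G. valency G v \<ge> 3)"
proof
  assume st: "stable G"
  then have g: "graph G" and nb: "\<And>e. \<not> bridge G e" by (auto simp: stable_def)
  have fin: "finite (edges G)" "finite (verts G)" using g by (auto simp: graph_def)
  have "valency G v \<ge> 3" if v: "v \<in> verts G" for v
  proof (rule ccontr)
    assume "\<not> 3 \<le> valency G v"
    then have val: "valency G v \<le> 2" by simp
    define A where "A = {e \<in> edges G. v \<in> ends G e}"
    define L where "L = {e \<in> edges G. ends G e = {v}}"
    have LA: "L \<subseteq> A" "finite A" using fin by (auto simp: A_def L_def)
    have cA: "card A + card L \<le> 2" using val by (simp add: valency_def A_def[symmetric] L_def[symmetric])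
    have "L \<noteq> {}" if "A \<noteq> {}"
    proof
      assume "L = {}"
      then have "valency G v = card A" by (simp add: valency_def A_def[symmetric] L_def[symmetric])
      moreover have "valency G v \<noteq> 2" using st v \<open>L = {}\<close> by (auto simp: stable_def L_def)
      moreover have "card A > 0" using that LA(2) by (simp add: card_gt_0_iff)
      ultimately have "card A = 1" using cA by linarith
      then obtain e where e: "A = {e}" by (auto simp: card_1_singleton_iff)
      then have eE: "e \<in> edges G" "v \<in> ends G e" by (auto simp: A_def)
      have "ends G e \<noteq> {v}" using \<open>L = {}\<close> eE by (auto simp: L_def)
      then obtain w where w: "w \<in> ends G e" "w \<noteq> v" using eE(2) by blast
      then have "w \<in> verts G" using g eE(1) by (auto simp: graph_def)
      have "connected_by G (edges G - {e})" using nb eE(1) by (auto simp: bridge_def)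
      then have "(v, w) \<in> (adj G (edges G - {e}))\<^sup>*"
        using v \<open>w \<in> verts G\<close> by (auto simp: connected_by_def)
      then show False
      proof (cases rule: converse_rtranclE)
        case (step y)
        then obtain e' where e': "e' \<in> edges G" "e' \<noteq> e" "ends G e' = {v, y}" by (auto simp: adj_def)
        then have "e' \<in> A" by (simp add: A_def)
        then show False using e e'(2) by simp
      qed (use w in simp)
    qed
    then have AL: "A = L" "card A \<le> 1"
    proof -
      have f: "finite L" using LA finite_subset by blast
      have le: "card L \<le> card A" using LA card_mono by blast
      have "A = L \<and> card A \<le> 1"
      proof (cases "A = {}")
        case True
        then show ?thesis using LA by simp
      next
        case False
        then have "card L \<ge> 1" using \<open>A \<noteq> {} \<Longrightarrow> L \<noteq> {}\<close> f by (simp add: Suc_le_eq card_gt_0_iff)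
        then have "card A = card L" "card A \<le> 1" using cA le by linarith+
        then show ?thesis using LA card_subset_eq by metis
      qed
      then show "A = L" "card A \<le> 1" by auto
    qed
    have "verts G = {v}"
    proof (rule ccontr)
      assume "verts G \<noteq> {v}"
      then obtain w where w: "w \<in> verts G" "w \<noteq> v" using v by blast
      then have "(v, w) \<in> (adj G (edges G))\<^sup>*" using g v by (auto simp: graph_def connected_by_def)
      then have "w = v"
      proof (induction rule: rtrancl_induct)
        case (step y z)
        then obtain e where "e \<in> edges G" "ends G e = {v, z}" by (auto simp: adj_def)
        moreover from this have "e \<in> L" using AL(1) by (auto simp: A_def)
        ultimately show ?case by (auto simp: L_def)
      qed simp
      then show False using w(2) by simp
    qed
    have "edges G \<subseteq> A"
    proof
      fix e assume "e \<in> edges G"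
      moreover from this obtain x y where "ends G e = {x, y}" "x \<in> verts G" by (rule graph_ends[OF g])
      ultimately show "e \<in> A" using \<open>verts G = {v}\<close> by (auto simp: A_def)
    qed
    then have "card (edges G) \<le> 1" using AL(2) LA(2) card_mono le_trans by blast
    then show False using assms \<open>verts G = {v}\<close> by (simp add: genus_def)
  qed
  then show "graph G \<and> (\<forall>e. \<not> bridge G e) \<and> (\<forall>v\<in>verts G. valency G v \<ge> 3)" using g nb by blast
next
  assume "graph G \<and> (\<forall>e. \<not> bridge G e) \<and> (\<forall>v\<in>verts G. valency G v \<ge> 3)"
  then show "stable G" by (force simp: stable_def)
qed

lemma linked_single:
  assumes "ends G e = {a, b}"
  shows "(u, v) \<in> (adj G {e})\<^sup>* \<longleftrightarrow> u = v \<or> u \<in> {a, b} \<and> v \<in> {a, b}"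
proof
  assume "(u, v) \<in> (adj G {e})\<^sup>*"
  then show "u = v \<or> u \<in> {a, b} \<and> v \<in> {a, b}"
    by (induction rule: rtrancl_induct) (auto simp: adj_iff assms doubleton_eq_iff)
next
  assume "u = v \<or> u \<in> {a, b} \<and> v \<in> {a, b}"
  then show "(u, v) \<in> (adj G {e})\<^sup>*"
    using linked_edge[of e "{e}" u G v a b] assms by auto
qed

lemma component_single:
  assumes "ends G e = {a, b}"
  shows "component G {e} v = (if v \<in> {a, b} then {a, b} else {v})"
  by (auto simp: component_def linked_single[OF assms])

lemma forest_single_iff: "ends G e = {a, b} \<Longrightarrow> forest G {e} \<longleftrightarrow> a \<noteq> b"
  unfolding forest_iff by (auto simp: adj_def doubleton_eq_iff)

lemma card_verts_contract_edge:
  assumes "graph G" "e \<in> edges G" "forest G {e}"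
  shows "Suc (card (verts (contract G {e}))) = card (verts G)"
proof -
  obtain a b where ab: "ends G e = {a, b}" "a \<in> verts G" "b \<in> verts G"
    by (rule graph_ends[OF assms(1,2)])
  have "a \<noteq> b" using assms(3) ab(1) forest_single_iff by metis
  have fin: "finite (verts G)" using assms(1) by (simp add: graph_def)
  have "verts (contract G {e}) = insert {a, b} ((\<lambda>v. {v}) ` (verts G - {a, b}))"
    using ab(2,3) by (auto simp: component_single[OF ab(1)])
  moreover have "{a, b} \<notin> (\<lambda>v. {v}) ` (verts G - {a, b})" by auto
  ultimately have "card (verts (contract G {e})) = Suc (card (verts G - {a, b}))"
    using fin by (simp add: card_image)
  also have "card (verts G - {a, b}) = card (verts G) - 2"
    using ab \<open>a \<noteq> b\<close> fin by (subst card_Diff_subset) auto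
  moreover have "card {a, b} \<le> card (verts G)" using ab fin by (intro card_mono) auto
  ultimately show ?thesis using \<open>a \<noteq> b\<close> by simp
qed

text \<open>Contracting a non-loop \<open>e\<close> with ends \<open>a\<close> and \<open>b\<close> yields a vertex of valency
  \<open>val a + val b - 2\<close>, as the edges parallel to \<open>e\<close> turn into loops, which still count twice.\<close>

lemma valency_contract_edge:
  assumes G: "graph G" and e: "e \<in> edges G" "forest G {e}" and val: "\<forall>v\<in>verts G. valency G v \<ge> 3"
    and C: "C \<in> verts (contract G {e})"
  shows "valency (contract G {e}) C \<ge> 3"
proof -
  obtain a b where ab: "ends G e = {a, b}" "a \<in> verts G" "b \<in> verts G"
    by (rule graph_ends[OF G e(1)])
  have neq: "a \<noteq> b" using e(2) ab(1) forest_single_iff by metis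
  have fin: "finite (edges G)" using G by (simp add: graph_def)
  note comp = component_single[OF ab(1)]
  show ?thesis
  proof (cases "C = {a, b}")
    case True
    define A B where "A = {x \<in> edges G. a \<in> ends G x}" and "B = {x \<in> edges G. b \<in> ends G x}"
    define LA LB where "LA = {x \<in> edges G. ends G x = {a}}" and "LB = {x \<in> edges G. ends G x = {b}}"
    have F: "finite A" "finite B" "finite LA" "finite LB" using fin by (auto simp: A_def B_def LA_def LB_def)
    have AB: "A \<inter> B = {x \<in> edges G. ends G x = {a, b}}"
    proof -
      have "ends G x = {a, b}" if x: "x \<in> edges G" "a \<in> ends G x" "b \<in> ends G x" for x
      proof -
        obtain u v where "ends G x = {u, v}" by (rule graph_ends[OF G x(1)])
        then show ?thesis using x(2,3) neq by auto
      qed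
      then show ?thesis by (auto simp: A_def B_def)
    qed
    have in_C: "C \<in> component G {e} ` ends G x \<longleftrightarrow> a \<in> ends G x \<or> b \<in> ends G x" for x
      unfolding True comp using neq by auto
    have loop_C: "component G {e} ` ends G x = {C} \<longleftrightarrow> ends G x = {a} \<or> ends G x = {b} \<or> ends G x = {a, b}"
      if x: "x \<in> edges G" for x
    proof -
      obtain u v where "ends G x = {u, v}" by (rule graph_ends[OF G x])
      then show ?thesis unfolding True comp using neq by auto
    qed
    have "{x \<in> edges (contract G {e}). C \<in> ends (contract G {e}) x} = A \<union> B - {e}"
      by (auto simp: in_C A_def B_def)
    moreover have "{x \<in> edges (contract G {e}). ends (contract G {e}) x = {C}} = LA \<union> LB \<union> (A \<inter> B - {e})"
      unfolding AB using loop_C ab(1) neq by (auto simp: LA_def LB_def)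
    ultimately have v: "valency (contract G {e}) C = card (A \<union> B - {e}) + card (LA \<union> LB \<union> (A \<inter> B - {e}))"
      by (simp only: valency_def)
    have eAB: "e \<in> A \<inter> B" using e(1) ab(1) by (simp add: AB)
    have "(LA \<union> LB) \<inter> (A \<inter> B - {e}) = {}" using neq unfolding AB by (auto simp: LA_def LB_def)
    then have "card (LA \<union> LB \<union> (A \<inter> B - {e})) = card (LA \<union> LB) + card (A \<inter> B - {e})"
      using F by (intro card_Un_disjoint) simp_all
    moreover have "card (LA \<union> LB) = card LA + card LB"
      using F neq by (intro card_Un_disjoint) (auto simp: LA_def LB_def)
    moreover have "card (A \<inter> B - {e}) = card (A \<inter> B) - 1" "card (A \<union> B - {e}) = card (A \<union> B) - 1"
      using card_Diff_singleton[OF eAB] card_Diff_singleton[of e "A \<union> B"] eAB by auto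
    moreover have "card (A \<union> B) + card (A \<inter> B) = card A + card B"
      using card_Un_Int[OF F(1,2)] by simp
    moreover have "card (A \<inter> B) > 0" "card (A \<union> B) > 0" using eAB F by (auto simp: card_gt_0_iff)
    moreover have "card A + card LA \<ge> 3" "card B + card LB \<ge> 3"
      using val ab(2,3) by (auto simp: valency_def A_def B_def LA_def LB_def)
    ultimately show ?thesis unfolding v by linarith
  next
    case False
    then obtain v where v: "v \<in> verts G" "v \<noteq> a" "v \<noteq> b" "C = {v}"
      using C by (auto simp: comp split: if_splits)
    have in_C: "C \<in> component G {e} ` ends G x \<longleftrightarrow> v \<in> ends G x" for x
      unfolding v(4) comp using v(2,3) by auto
    have loop_C: "component G {e} ` ends G x = {C} \<longleftrightarrow> ends G x = {v}" if x: "x \<in> edges G" for x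
    proof -
      obtain u w where uw: "ends G x = {u, w}" by (rule graph_ends[OF G x])
      have "component G {e} y = {v} \<longleftrightarrow> y = v" for y unfolding comp using v(2,3) by auto
      then show ?thesis unfolding v(4) uw by auto
    qed
    have "{x \<in> edges (contract G {e}). C \<in> ends (contract G {e}) x} = {x \<in> edges G. v \<in> ends G x}"
      using ab(1) v(2,3) by (auto simp: in_C)
    moreover have "{x \<in> edges (contract G {e}). ends (contract G {e}) x = {C}} = {x \<in> edges G. ends G x = {v}}"
      using loop_C ab(1) v(2,3) by auto
    ultimately have "valency (contract G {e}) C = valency G v" by (simp only: valency_def)
    then show ?thesis using val v(1) by simp
  qed
qed

lemma contract_edge:
  assumes "stable G" "genus G \<ge> 2" "e \<in> edges G" "forest G {e}"
  shows "stable (contract G {e}) \<and> genus (contract G {e}) = genus G"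
proof -
  have G: "graph G" and nb: "\<And>e. \<not> bridge G e" using assms(1) by (auto simp: stable_def)
  have fin: "finite (edges G)" using G by (simp add: graph_def)
  then have "Suc (card (edges (contract G {e}))) = card (edges G)"
    using card_Suc_Diff1[of "edges G" e] assms(3) by simp
  then have gen: "genus (contract G {e}) = genus G"
    using card_verts_contract_edge[OF G assms(3,4)] unfolding genus_def by linarith
  have "graph (contract G {e})" using graph_contract[OF G] assms(3) by simp
  moreover have "\<not> bridge (contract G {e}) x" for x using bridge_contract[OF G _ nb] assms(3) by simp
  moreover have "\<forall>C\<in>verts (contract G {e}). valency (contract G {e}) C \<ge> 3"
    using valency_contract_edge[OF G assms(3,4)] assms(1,2) stable_iff_valency by blast
  ultimately show ?thesis using gen assms(2) stable_iff_valency[of "contract G {e}"] by simp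
qed

text \<open>The edges are contracted one by one; what is left of the forest remains a forest.\<close>

lemma contract_forest:
  assumes "stable G" "genus G \<ge> 2" "Z \<subseteq> edges G" "forest G Z"
  shows "stable (contract G Z) \<and> genus (contract G Z) = genus G"
proof -
  have G: "graph G" using assms(1) by (simp add: stable_def)
  have "finite Z" using G assms(3) finite_subset by (auto simp: graph_def)
  then show ?thesis using assms(3,4)
  proof (induction Z)
    case empty
    obtain g where "graph_iso (contract G {}) G g id" using contract_empty_iso[OF G] by blast
    then have "graph_iso G (contract G {}) (inv_into (verts (contract G {})) g) (inv_into (edges (contract G {})) id)"
      by (rule graph_iso_inv) (use graph_contract[OF G, of "{}"] in \<open>simp add: graph_def\<close>)
    then show ?case using graph_iso_stable graph_iso_genus assms(1) by metis
  next
    case (insert f Z)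
    let ?H = "contract G Z"
    have H: "stable ?H" "genus ?H = genus G" using insert forest_subset[of G "insert f Z" Z] by auto
    have "forest ?H (insert f Z - Z)" using insert(5) forest_contract[OF G, of Z "insert f Z"] insert(4) by auto
    then have "forest ?H {f}" using insert(2) by (simp add: insert_Diff_if)
    then have K: "stable (contract ?H {f})" "genus (contract ?H {f}) = genus G"
      using contract_edge[of ?H f] H assms(2) insert(2,4) by auto
    obtain g where "graph_iso (contract G (Z \<union> {f})) (contract ?H {f}) g id"
      using contract_contract_iso[OF G, of Z "{f}"] insert(4) by auto
    then have i: "graph_iso (contract G (insert f Z)) (contract ?H {f}) g id" by simp
    have "graph (contract G (insert f Z))" using graph_contract[OF G insert(4)] .
    note graph_iso_inv[OF i] this
    then have "\<exists>f' h'. graph_iso (contract ?H {f}) (contract G (insert f Z)) f' h'"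
      unfolding graph_def by blast
    then show ?case using graph_iso_stable[OF _ K(1)] graph_iso_genus K(2) by metis
  qed
qed

lemma card_verts_contract:
  assumes "stable G" "genus G \<ge> 2" "Z \<subseteq> edges G" "forest G Z"
  shows "card (verts (contract G Z)) + card Z = card (verts G)"
proof -
  have f: "finite (edges G)" using assms(1) by (simp add: stable_def graph_def)
  then have "card (edges (contract G Z)) + card Z = card (edges G)"
    using assms(3) card_Diff_subset[OF finite_subset[OF assms(3) f] assms(3)] card_mono[OF f assms(3)]
    by simp
  then show ?thesis using contract_forest[OF assms] unfolding genus_def by linarith
qed

section \<open>Isomorphism classes of filtered graphs\<close>

lemma fgraph_isomorphic_iff:
  "fgraph_isomorphic (G, \<pi>) (H, \<rho>) \<longleftrightarrow> (\<exists>f h. graph_iso G H f h \<and> map ((`) h) \<pi> = \<rho>)"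
  by (simp add: fgraph_isomorphic_def)

text \<open>Disjointness as a property of sorted lists is easy to follow through merging and removal of blocks.\<close>

lemma filtered_iff:
  "filtered (G, \<pi>) \<longleftrightarrow> graph G \<and> \<pi> \<noteq> [] \<and> {} \<notin> set \<pi> \<and> \<Union> (set \<pi>) = edges G \<and>
     sorted_wrt (\<lambda>A B. A \<inter> B = {}) \<pi>"
proof -
  have "(\<forall>i<length \<pi>. \<forall>j<length \<pi>. i \<noteq> j \<longrightarrow> \<pi> ! i \<inter> \<pi> ! j = {}) \<longleftrightarrow>
    sorted_wrt (\<lambda>A B. A \<inter> B = {}) \<pi>"
    unfolding sorted_wrt_iff_nth_less
  proof (intro iffI allI impI)
    fix i j assume *: "\<forall>i j. i < j \<longrightarrow> j < length \<pi> \<longrightarrow> \<pi> ! i \<inter> \<pi> ! j = {}"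
      "i < length \<pi>" "j < length \<pi>" "i \<noteq> j"
    then show "\<pi> ! i \<inter> \<pi> ! j = {}" by (metis Int_commute linorder_neqE_nat)
  qed auto
  then show ?thesis by (auto simp: filtered_def)
qed

lemma filtered_subset: "filtered (G, \<pi>) \<Longrightarrow> A \<in> set \<pi> \<Longrightarrow> A \<subseteq> edges G"
  by (auto simp: filtered_iff)

lemma fgraph_isomorphic_trans:
  "fgraph_isomorphic x y \<Longrightarrow> fgraph_isomorphic y z \<Longrightarrow> fgraph_isomorphic x z"
  by (cases x; cases y; cases z) (fastforce simp: fgraph_isomorphic_iff image_comp intro: graph_iso_trans)

lemma fgraph_isomorphic_sym:
  assumes "fgraph_isomorphic x y" "filtered x"
  shows "fgraph_isomorphic y x"
proof -
  obtain G \<pi> H \<rho> where xy: "x = (G, \<pi>)" "y = (H, \<rho>)" by fastforce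
  obtain f h where i: "graph_iso G H f h" and m: "map ((`) h) \<pi> = \<rho>"
    using assms(1) by (auto simp: xy fgraph_isomorphic_iff)
  have inj: "inj_on h (edges G)" using i by (simp add: graph_iso_def bij_betw_def)
  have "inv_into (edges G) h ` h ` A = A" if "A \<in> set \<pi>" for A
    using inv_into_image_cancel[OF inj filtered_subset] assms(2) that xy(1) by blast
  then have "map ((`) (inv_into (edges G) h)) \<rho> = \<pi>" by (simp add: m[symmetric] map_idI)
  moreover have "graph_iso H G (inv_into (verts G) f) (inv_into (edges G) h)"
    using graph_iso_inv[OF i] assms(2) by (simp add: xy filtered_iff graph_def)
  ultimately show ?thesis unfolding xy fgraph_isomorphic_iff by blast
qed

text \<open>The index set of the \<open>m\<close>-simplices of \<open>Delta g\<close>, with arbitrary types of vertices and edges.\<close>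

definition simplex_graph :: "int \<Rightarrow> nat \<Rightarrow> ('v, 'e) fgraph \<Rightarrow> bool" where
  "simplex_graph g m = (\<lambda>(G, \<pi>). stable G \<and> genus G = g \<and> filtered_by_forests (G, \<pi>) \<and> length \<pi> = Suc m)"

lemma simplex_graph_iff:
  "simplex_graph g m (G, \<pi>) \<longleftrightarrow> stable G \<and> genus G = g \<and> {} \<notin> set \<pi> \<and> \<Union> (set \<pi>) = edges G \<and>
     sorted_wrt (\<lambda>A B. A \<inter> B = {}) \<pi> \<and> forest G (\<Union> (set (butlast \<pi>))) \<and> length \<pi> = Suc m"
  by (auto simp: simplex_graph_def filtered_by_forests_def filtered_iff stable_def)

lemma simplex_graph_filtered: "simplex_graph g m x \<Longrightarrow> filtered x"
  by (cases x) (auto simp: simplex_graph_def filtered_by_forests_def)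

lemma simplex_graph_iso:
  assumes "simplex_graph g m x" "fgraph_isomorphic x y"
  shows "simplex_graph g m y"
proof -
  obtain G \<pi> H \<rho> where xy: "x = (G, \<pi>)" "y = (H, \<rho>)" by fastforce
  obtain f h where i: "graph_iso G H f h" and m: "\<rho> = map ((`) h) \<pi>"
    using assms(2) by (auto simp: xy fgraph_isomorphic_iff)
  have x: "stable G" "genus G = g" "{} \<notin> set \<pi>" "\<Union> (set \<pi>) = edges G"
    "sorted_wrt (\<lambda>A B. A \<inter> B = {}) \<pi>" "forest G (\<Union> (set (butlast \<pi>)))" "length \<pi> = Suc m"
    using assms(1) by (auto simp: xy simplex_graph_iff)
  have h: "inj_on h (edges G)" "edges H = h ` edges G" using i by (auto simp: graph_iso_def bij_betw_def)
  have "h ` A \<inter> h ` B = {}" if "A \<in> set \<pi>" "B \<in> set \<pi>" "A \<inter> B = {}" for A B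
  proof -
    have "h ` (A \<inter> B) = h ` A \<inter> h ` B"
      by (rule inj_on_image_Int[OF h(1)]) (use that x(4) in auto)
    then show ?thesis using that(3) by simp
  qed
  then have "sorted_wrt (\<lambda>A B. A \<inter> B = {}) \<rho>"
    unfolding m sorted_wrt_map by (rule sorted_wrt_mono_rel[OF _ x(5)])
  moreover have "\<Union> (set (butlast \<rho>)) = h ` \<Union> (set (butlast \<pi>))" by (auto simp: m map_butlast[symmetric])
  moreover have "\<Union> (set (butlast \<pi>)) \<subseteq> edges G" using x(4) in_set_butlastD by fastforce
  ultimately have "forest H (\<Union> (set (butlast \<rho>)))" "sorted_wrt (\<lambda>A B. A \<inter> B = {}) \<rho>"
    using graph_iso_forest[OF i] x(1,6) by (auto simp: stable_def)
  moreover have "\<Union> (set \<rho>) = edges H" by (simp add: m h(2) x(4)[symmetric] image_Union)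
  moreover have "{} \<notin> set \<rho>" "length \<rho> = Suc m" using x(3,7) by (auto simp: m)
  ultimately show ?thesis
    using x(1,2) graph_iso_stable[OF i] graph_iso_genus[OF i] by (simp add: xy simplex_graph_iff)
qed

lemma graph_nat_copy:
  assumes "graph (G :: ('v, 'e) mgraph)"
  shows "\<exists>(H :: (nat, nat) mgraph) f h. graph_iso G H f h"
proof -
  obtain f where f: "bij_betw f (verts G) {0..<card (verts G)}"
    using assms ex_bij_betw_finite_nat[of "verts G"] unfolding graph_def by blast
  obtain h where h: "bij_betw h (edges G) {0..<card (edges G)}"
    using assms ex_bij_betw_finite_nat[of "edges G"] unfolding graph_def by blast
  let ?H = "\<lparr>verts = {0..<card (verts G)}, edges = {0..<card (edges G)},
    ends = (\<lambda>e. f ` ends G (inv_into (edges G) h e))\<rparr>"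
  have "graph_iso G ?H f h" using f h by (auto simp: graph_iso_def bij_betw_def)
  then show ?thesis by blast
qed

lemma fgraph_nat_copy:
  assumes "filtered (x :: ('v, 'e) fgraph)"
  shows "\<exists>y :: (nat, nat) fgraph. fgraph_isomorphic x y"
proof -
  obtain G \<pi> where x: "x = (G, \<pi>)" by fastforce
  obtain H :: "(nat, nat) mgraph" and f h where "graph_iso G H f h"
    using graph_nat_copy[of G] assms by (auto simp: x filtered_iff)
  then show ?thesis unfolding x by (meson fgraph_isomorphic_iff)
qed

lemma fclass_eq_iff:
  assumes "filtered x" "filtered y"
  shows "fclass x = fclass y \<longleftrightarrow> fgraph_isomorphic x y"
proof
  assume e: "fclass x = fclass y"
  obtain z :: "(nat, nat) fgraph" where z: "fgraph_isomorphic x z" using fgraph_nat_copy[OF assms(1)] by blast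
  then have "fgraph_isomorphic y z" using e by (auto simp: fclass_def)
  then show "fgraph_isomorphic x y" using z fgraph_isomorphic_sym[OF _ assms(2)] fgraph_isomorphic_trans by blast
next
  assume xy: "fgraph_isomorphic x y"
  note yx = fgraph_isomorphic_sym[OF xy assms(1)]
  show "fclass x = fclass y"
    by (auto simp: fclass_def intro: fgraph_isomorphic_trans[OF xy] fgraph_isomorphic_trans[OF yx])
qed

lemma cells_Delta: "cells (Delta g) m = {fclass x | x :: (nat, nat) fgraph. simplex_graph g m x}"
  by (fastforce simp: Delta_def simplex_graph_def)

lemma fclass_in_cells:
  assumes "simplex_graph g m (x :: ('v, 'e) fgraph)"
  shows "fclass x \<in> cells (Delta g) m"
proof -
  note f = simplex_graph_filtered[OF assms]
  obtain y :: "(nat, nat) fgraph" where y: "fgraph_isomorphic x y" using fgraph_nat_copy[OF f] by blast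
  then have "simplex_graph g m y" using simplex_graph_iso[OF assms] by blast
  moreover from this have "fclass x = fclass y" using y fclass_eq_iff[OF f] simplex_graph_filtered by blast
  ultimately show ?thesis unfolding cells_Delta by blast
qed

section \<open>The faces of a simplex\<close>

lemma merge_blocks_append: "merge_blocks (Suc (length xs)) (xs @ A # B # ys) = xs @ (A \<union> B) # ys"
  by (simp add: merge_blocks_def nth_append)

lemma split_at_block:
  assumes "0 < i" "i < length \<pi>"
  obtains xs A B ys where "\<pi> = xs @ A # B # ys" "i = Suc (length xs)"
proof -
  obtain k where k: "i = Suc k" using assms(1) by (cases i) auto
  have "\<pi> = take k \<pi> @ \<pi> ! k # \<pi> ! Suc k # drop (Suc (Suc k)) \<pi>"
    using assms(2) k by (metis Cons_nth_drop_Suc Suc_lessD id_take_nth_drop)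
  then show thesis using that[of "take k \<pi>"] assms(2) k by simp
qed

lemma map_merge_blocks:
  assumes "0 < i" "i < length \<pi>"
  shows "map ((`) h) (merge_blocks i \<pi>) = merge_blocks i (map ((`) h) \<pi>)"
proof -
  obtain xs A B ys where "\<pi> = xs @ A # B # ys" "i = Suc (length xs)" by (rule split_at_block[OF assms])
  then show ?thesis
    using merge_blocks_append[of "map ((`) h) xs" "h ` A" "h ` B"] by (simp add: merge_blocks_append image_Un)
qed

lemma simplex_graph_merge:
  assumes "simplex_graph g (Suc m) (G, \<pi>)" "0 < i" "i \<le> Suc m"
  shows "simplex_graph g m (G, merge_blocks i \<pi>)"
proof -
  have "i < length \<pi>" using assms by (simp add: simplex_graph_iff)
  with assms(2) obtain xs A B ys where p: "\<pi> = xs @ A # B # ys" "i = Suc (length xs)" by (rule split_at_block)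
  have "forest G (\<Union> (set (butlast (xs @ (A \<union> B) # ys))))"
    by (rule forest_subset[of G "\<Union> (set (butlast \<pi>))"])
      (use assms(1) in \<open>auto simp: simplex_graph_iff p butlast_append\<close>)
  then show ?thesis using assms(1)
    by (auto simp: simplex_graph_iff p merge_blocks_append sorted_wrt_append)
qed

lemma simplex_graph_contract:
  assumes "simplex_graph g (Suc m) (G, \<pi>)" "g \<ge> 2"
  shows "simplex_graph g m (contract G (hd \<pi>), tl \<pi>)"
proof -
  obtain A B ys where p: "\<pi> = A # B # ys"
    using assms(1) by (cases \<pi> rule: list.exhaust; cases "tl \<pi>") (auto simp: simplex_graph_iff)
  let ?F = "\<Union> (set (butlast \<pi>))"
  have *: "stable G" "genus G = g" "forest G ?F" "?F \<subseteq> edges G"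
    using assms(1) in_set_butlastD by (fastforce simp: simplex_graph_iff)+
  have A: "A \<subseteq> ?F" by (simp add: p)
  have bl: "set (butlast (B # ys)) \<subseteq> set (B # ys)" by (meson in_set_butlastD subsetI)
  have dj: "A \<inter> X = {}" if "X \<in> set (B # ys)" for X
    using assms(1) that by (auto simp: simplex_graph_iff p)
  have "?F = A \<union> \<Union> (set (butlast (tl \<pi>)))" by (simp add: p)
  moreover have "A \<inter> \<Union> (set (butlast (tl \<pi>))) = {}" using bl dj unfolding p list.sel by blast
  ultimately have "?F - A = \<Union> (set (butlast (tl \<pi>)))" by blast
  then have "forest G A" "forest (contract G A) (\<Union> (set (butlast (tl \<pi>))))"
    using forest_contract[OF _ A *(4)] *(1,3) by (auto simp: stable_def)
  moreover have "edges G = A \<union> \<Union> (set (B # ys))" using assms(1) by (simp add: simplex_graph_iff p)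
  then have "edges G - A = \<Union> (set (tl \<pi>))" using dj unfolding p list.sel by blast
  ultimately show ?thesis
    using assms contract_forest[OF *(1), of A] * A by (auto simp: simplex_graph_iff p)
qed

text \<open>Merging commutes with isomorphisms, so the union that defines the face consists of a single class.\<close>

lemma face_merge:
  assumes "simplex_graph g (Suc m) (G, \<pi>)" "0 < i" "i \<le> Suc m"
  shows "face (Delta g) (Suc m) i (fclass (G, \<pi>)) = fclass (G, merge_blocks i \<pi>)"
proof -
  note f = simplex_graph_filtered[OF assms(1)]
  have "fclass (H, merge_blocks i \<rho>) = fclass (G, merge_blocks i \<pi>)"
    if "(H, \<rho>) \<in> fclass (G, \<pi>)" for H :: "(nat, nat) mgraph" and \<rho>
  proof -
    have iso: "fgraph_isomorphic (G, \<pi>) (H, \<rho>)" using that by (simp add: fclass_def)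
    then obtain f h where "graph_iso G H f h" "map ((`) h) \<pi> = \<rho>" by (auto simp: fgraph_isomorphic_iff)
    then have "fgraph_isomorphic (G, merge_blocks i \<pi>) (H, merge_blocks i \<rho>)"
      using map_merge_blocks[of i \<pi> h] assms unfolding fgraph_isomorphic_iff by (auto simp: simplex_graph_iff)
    then show ?thesis
      using simplex_graph_merge[OF assms] simplex_graph_merge[OF simplex_graph_iso[OF assms(1) iso] assms(2,3)]
        fclass_eq_iff simplex_graph_filtered by metis
  qed
  moreover have "fclass (G, \<pi>) \<noteq> {}" using fgraph_nat_copy[OF f] by (auto simp: fclass_def)
  ultimately have "(\<Union>(H, \<rho>)\<in>fclass (G, \<pi>). fclass (H, merge_blocks i \<rho>)) = fclass (G, merge_blocks i \<pi>)"
    by fastforce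
  then show ?thesis using assms(2) by (simp add: Delta_def)
qed

lemma face_contract:
  assumes "simplex_graph g (Suc m) (G, \<pi>)" "g \<ge> 2"
  shows "face (Delta g) (Suc m) 0 (fclass (G, \<pi>)) = fclass (contract G (hd \<pi>), tl \<pi>)"
proof -
  note f = simplex_graph_filtered[OF assms(1)]
  have "fclass (contract H (hd \<rho>), tl \<rho>) = fclass (contract G (hd \<pi>), tl \<pi>)"
    if "(H, \<rho>) \<in> fclass (G, \<pi>)" for H :: "(nat, nat) mgraph" and \<rho>
  proof -
    have iso: "fgraph_isomorphic (G, \<pi>) (H, \<rho>)" using that by (simp add: fclass_def)
    then obtain f h where i: "graph_iso G H f h" "map ((`) h) \<pi> = \<rho>" by (auto simp: fgraph_isomorphic_iff)
    have "\<pi> \<noteq> []" "graph G" using f by (auto simp: filtered_iff)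
    then have "\<exists>k. graph_iso (contract G (hd \<pi>)) (contract H (hd \<rho>)) k h"
      using contract_iso[OF i(1), of "hd \<pi>"] filtered_subset[OF f hd_in_set] i(2) by (auto simp: hd_map)
    then have "fgraph_isomorphic (contract G (hd \<pi>), tl \<pi>) (contract H (hd \<rho>), tl \<rho>)"
      using i(2) unfolding fgraph_isomorphic_iff by (auto simp: map_tl)
    then show ?thesis
      using simplex_graph_contract[OF assms] simplex_graph_contract[OF simplex_graph_iso[OF assms(1) iso] assms(2)]
        fclass_eq_iff simplex_graph_filtered by metis
  qed
  moreover have "fclass (G, \<pi>) \<noteq> {}" using fgraph_nat_copy[OF f] by (auto simp: fclass_def)
  ultimately have "(\<Union>(H, \<rho>)\<in>fclass (G, \<pi>). fclass (contract H (hd \<rho>), tl \<rho>)) = fclass (contract G (hd \<pi>), tl \<pi>)"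
    by fastforce
  then show ?thesis by (simp add: Delta_def)
qed

lemma merge_merge:
  assumes "0 < i" "i < j" "j < length \<pi>"
  shows "merge_blocks i (merge_blocks j \<pi>) = merge_blocks (j - 1) (merge_blocks i \<pi>)"
proof -
  have "i < length \<pi>" using assms by simp
  with assms(1) obtain xs A B ys where p: "\<pi> = xs @ A # B # ys" "i = Suc (length xs)" by (rule split_at_block)
  show ?thesis
  proof (cases "j = Suc i")
    case True
    then obtain C zs where y: "ys = C # zs" using assms(3) p by (cases ys) auto
    have "merge_blocks j \<pi> = xs @ A # (B \<union> C) # zs"
      using merge_blocks_append[of "xs @ [A]" B C zs] True by (simp add: p y)
    then show ?thesis using True by (simp add: p y merge_blocks_append Un_assoc)
  next
    case False
    define k where "k = j - i - 1"
    have "0 < k" "k < length ys" using False assms(2,3) p by (auto simp: k_def)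
    then obtain us C D zs where y: "ys = us @ C # D # zs" "k = Suc (length us)" by (rule split_at_block)
    have j: "j = Suc (length (xs @ A # B # us))" using y(2) p(2) assms(2) False by (simp add: k_def)
    have "merge_blocks j \<pi> = (xs @ A # B # us) @ (C \<union> D) # zs"
      unfolding j using merge_blocks_append[of "xs @ A # B # us" C D zs] by (simp add: p y)
    moreover have "merge_blocks (j - 1) (xs @ (A \<union> B) # ys) = (xs @ (A \<union> B) # us) @ (C \<union> D) # zs"
      using merge_blocks_append[of "xs @ (A \<union> B) # us" C D zs] by (simp add: j y)
    ultimately show ?thesis by (simp add: p merge_blocks_append)
  qed
qed

lemma face_face:
  assumes x: "simplex_graph g (Suc (Suc m)) (G, \<pi>)" and g: "g \<ge> 2" and ij: "i < j" "j \<le> Suc (Suc m)"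
  shows "face (Delta g) (Suc m) i (face (Delta g) (Suc (Suc m)) j (fclass (G, \<pi>))) =
    face (Delta g) (Suc m) (j - 1) (face (Delta g) (Suc (Suc m)) i (fclass (G, \<pi>)))"
proof -
  obtain A B ys where p: "\<pi> = A # B # ys"
    using x by (cases \<pi> rule: list.exhaust; cases "tl \<pi>") (auto simp: simplex_graph_iff)
  have sj: "simplex_graph g (Suc m) (G, merge_blocks j \<pi>)" using simplex_graph_merge[OF x] ij by simp
  have sc: "simplex_graph g (Suc m) (contract G A, B # ys)" using simplex_graph_contract[OF x g] by (simp add: p)
  show ?thesis
  proof (cases "i = 0")
    case False
    have "simplex_graph g (Suc m) (G, merge_blocks i \<pi>)" using simplex_graph_merge[OF x] False ij by simp
    then show ?thesis
      using False ij x sj merge_merge[of i j \<pi>] by (simp add: face_merge simplex_graph_iff)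
  next
    case i: True
    show ?thesis
    proof (cases "j = 1")
      case True
      have m': "merge_blocks (Suc 0) (A # B # ys) = (A \<union> B) # ys" using merge_blocks_append[of "[]" A B ys] by simp
      then have m: "merge_blocks j \<pi> = (A \<union> B) # ys" by (simp add: p True)
      have G: "graph G" "A \<union> B \<subseteq> edges G" using x by (auto simp: simplex_graph_iff stable_def p)
      obtain k where "graph_iso (contract G (A \<union> B)) (contract (contract G A) B) k id"
        using contract_contract_iso[OF G] by blast
      then have "fgraph_isomorphic (contract G (A \<union> B), ys) (contract (contract G A) B, ys)"
        unfolding fgraph_isomorphic_iff by (auto intro!: exI[of _ k] exI[of _ id] map_idI)
      moreover have "simplex_graph g m (contract G (A \<union> B), ys)" "simplex_graph g m (contract (contract G A) B, ys)"
        using simplex_graph_contract[OF sj g] simplex_graph_contract[OF sc g] by (auto simp: m)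
      ultimately have "fclass (contract G (A \<union> B), ys) = fclass (contract (contract G A) B, ys)"
        using fclass_eq_iff simplex_graph_filtered by metis
      then show ?thesis
        using face_contract[OF x g] face_merge[OF x, of 1] face_contract[OF sj g] face_contract[OF sc g]
        by (simp add: i True m' p)
    next
      case False
      then have "0 < j - 1" "j - 1 < length (B # ys)" using ij i x by (auto simp: simplex_graph_iff p)
      then obtain xs C D zs where y: "B # ys = xs @ C # D # zs" "j - 1 = Suc (length xs)" by (rule split_at_block)
      have "merge_blocks j \<pi> = A # merge_blocks (j - 1) (B # ys)"
      proof -
        have "j = Suc (length (A # xs))" using y(2) by simp
        then have "merge_blocks j \<pi> = (A # xs) @ (C \<union> D) # zs"
          using merge_blocks_append[of "A # xs" C D zs] by (simp add: p y(1))
        then show ?thesis unfolding y by (simp add: merge_blocks_append)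
      qed
      then show ?thesis
        using face_contract[OF x g] face_merge[OF x, of j] face_contract[OF sj g] face_merge[OF sc, of "j - 1"] ij False
        by (simp add: i p)
    qed
  qed
qed

text \<open>The edges of vertex number \<open>i\<close> are those of the blocks from number \<open>i\<close> on (counted from \<open>0\<close>), and their
  number tells the vertices apart.\<close>

lemma vertex_Delta:
  assumes "simplex_graph g m (x :: (nat, nat) fgraph)" "g \<ge> 2" "i \<le> m"
  shows "\<exists>H :: (nat, nat) mgraph. simplex_graph g 0 (H, [edges H]) \<and>
    vertex (Delta g) m i (fclass x) = fclass (H, [edges H]) \<and> card (edges H) = card (\<Union> (set (drop i (snd x))))"
  using assms
proof (induction m arbitrary: x i)
  case 0
  obtain G \<pi> where x: "x = (G, \<pi>)" by fastforce
  have "\<pi> = [edges G]" using 0 by (cases \<pi>) (auto simp: simplex_graph_iff x)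
  then show ?case using 0 by (auto simp: x)
next
  case (Suc m)
  obtain G \<pi> where x: "x = (G, \<pi>)" by fastforce
  note s = Suc(2)[unfolded x]
  show ?case
  proof (cases "i \<le> m")
    case True
    have "0 < Suc m" "Suc m < length \<pi>" using s by (auto simp: simplex_graph_iff)
    then obtain xs A B ys where p: "\<pi> = xs @ A # B # ys" "Suc m = Suc (length xs)" by (rule split_at_block)
    have "ys = []" using s p by (simp add: simplex_graph_iff)
    then have "\<Union> (set (drop i (merge_blocks (Suc m) \<pi>))) = \<Union> (set (drop i \<pi>))"
      using True p by (auto simp: merge_blocks_append)
    then show ?thesis
      using Suc.IH[OF simplex_graph_merge[OF s, of "Suc m"] Suc(3) True] face_merge[OF s, of "Suc m"] True
      by (auto simp: x)
  next
    case False
    then have i: "i = Suc m" using Suc(4) by simp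
    have s': "simplex_graph g m (contract G (hd \<pi>), tl \<pi>)" by (rule simplex_graph_contract[OF s Suc(3)])
    obtain y :: "(nat, nat) fgraph" where y: "fgraph_isomorphic (contract G (hd \<pi>), tl \<pi>) y"
      using fgraph_nat_copy[OF simplex_graph_filtered[OF s']] by blast
    have sy: "simplex_graph g m y" using simplex_graph_iso[OF s' y] .
    then have fy: "fclass (contract G (hd \<pi>), tl \<pi>) = fclass y"
      using y fclass_eq_iff simplex_graph_filtered s' by metis
    obtain h where h: "inj_on h (edges G - hd \<pi>)" "snd y = map ((`) h) (tl \<pi>)"
      using y by (cases y) (auto simp: fgraph_isomorphic_iff graph_iso_def bij_betw_def)
    have "card (\<Union> (set (drop m (snd y)))) = card (h ` \<Union> (set (drop m (tl \<pi>))))"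
      by (simp add: h(2) drop_map image_Union)
    also have "\<dots> = card (\<Union> (set (drop m (tl \<pi>))))"
    proof (rule card_image, rule inj_on_subset[OF h(1)])
      have "\<Union> (set (tl \<pi>)) = edges G - hd \<pi>" using s' by (simp add: simplex_graph_iff)
      then show "\<Union> (set (drop m (tl \<pi>))) \<subseteq> edges G - hd \<pi>" by (metis Union_mono set_drop_subset)
    qed
    finally have "card (\<Union> (set (drop m (snd y)))) = card (\<Union> (set (drop i \<pi>)))" by (simp add: i drop_Suc)
    then show ?thesis
      using fy Suc.IH[OF sy Suc(3) order_refl] face_contract[OF s Suc(3)] by (auto simp: x i)
  qed
qed

lemma gen_simplicial_complex_Delta:
  assumes "g \<ge> 2"
  shows "gen_simplicial_complex (Delta g)"
  unfolding gen_simplicial_complex_def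
proof (intro conjI allI ballI impI)
  fix m i \<sigma> assume "\<sigma> \<in> cells (Delta g) (Suc m)" and i: "i \<le> Suc m"
  then obtain G :: "(nat, nat) mgraph" and \<pi> where x: "\<sigma> = fclass (G, \<pi>)" "simplex_graph g (Suc m) (G, \<pi>)"
    by (auto simp: cells_Delta)
  show "face (Delta g) (Suc m) i \<sigma> \<in> cells (Delta g) m"
  proof (cases "i = 0")
    case True
    then show ?thesis using x face_contract simplex_graph_contract fclass_in_cells assms by metis
  next
    case False
    then show ?thesis using x i face_merge simplex_graph_merge fclass_in_cells by (metis gr0I)
  qed
next
  fix m i j \<sigma> assume "\<sigma> \<in> cells (Delta g) (Suc (Suc m))" and ij: "i < j \<and> j \<le> Suc (Suc m)"
  then obtain G :: "(nat, nat) mgraph" and \<pi> where x: "\<sigma> = fclass (G, \<pi>)" "simplex_graph g (Suc (Suc m)) (G, \<pi>)"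
    by (auto simp: cells_Delta)
  show "face (Delta g) (Suc m) i (face (Delta g) (Suc (Suc m)) j \<sigma>) =
    face (Delta g) (Suc m) (j - 1) (face (Delta g) (Suc (Suc m)) i \<sigma>)"
    unfolding x(1) by (rule face_face[OF x(2) assms]) (use ij in auto)
next
  fix m \<sigma> assume "\<sigma> \<in> cells (Delta g) m"
  then obtain G :: "(nat, nat) mgraph" and \<pi> where x: "\<sigma> = fclass (G, \<pi>)" "simplex_graph g m (G, \<pi>)"
    by (auto simp: cells_Delta)
  show "inj_on (\<lambda>i. vertex (Delta g) m i \<sigma>) {..m}"
  proof (rule linorder_inj_onI)
    fix i j assume ij: "i < j" "i \<in> {..m}" "j \<in> {..m}"
    let ?U = "\<lambda>i. \<Union> (set (drop i \<pi>))"
    have fin: "finite (edges G)" using x(2) by (simp add: simplex_graph_iff stable_def graph_def)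
    have lt: "i < length \<pi>" using ij x(2) by (simp add: simplex_graph_iff)
    have "?U j \<subset> ?U i"
    proof (rule psubsetI)
      show "?U j \<subseteq> ?U i" using ij(1) by (meson Union_mono less_imp_le set_drop_subset_set_drop)
      have "\<pi> ! i \<noteq> {}" using x(2) nth_mem[OF lt] unfolding simplex_graph_iff by metis
      then obtain e where e: "e \<in> \<pi> ! i" by blast
      have "e \<notin> ?U j"
      proof
        assume "e \<in> ?U j"
        then obtain k where "k < length (drop j \<pi>)" "e \<in> drop j \<pi> ! k" by (metis UnionE in_set_conv_nth)
        then have "j + k < length \<pi>" "e \<in> \<pi> ! (j + k)" "i < j + k" using ij(1) by auto
        moreover from this have "\<pi> ! i \<inter> \<pi> ! (j + k) = {}"
          using x(2) sorted_wrt_nth_less[of "\<lambda>A B. A \<inter> B = {}" \<pi>] by (simp add: simplex_graph_iff)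
        ultimately show False using e by blast
      qed
      moreover have "e \<in> ?U i" using e lt by (metis Cons_nth_drop_Suc UnionI list.set_intros(1))
      ultimately show "?U j \<noteq> ?U i" by blast
    qed
    moreover have "?U i \<subseteq> edges G" using x(2) in_set_dropD by (fastforce simp: simplex_graph_iff)
    then have "finite (?U i)" using fin finite_subset by blast
    ultimately have lt: "card (?U j) < card (?U i)" by (rule psubset_card_mono[rotated])
    obtain H :: "(nat, nat) mgraph" where H: "simplex_graph g 0 (H, [edges H])"
      "vertex (Delta g) m i \<sigma> = fclass (H, [edges H])" "card (edges H) = card (?U i)"
      using vertex_Delta[OF x(2) assms, of i] ij x(1) by auto
    obtain K :: "(nat, nat) mgraph" where K: "simplex_graph g 0 (K, [edges K])"
      "vertex (Delta g) m j \<sigma> = fclass (K, [edges K])" "card (edges K) = card (?U j)"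
      using vertex_Delta[OF x(2) assms, of j] ij x(1) by auto
    have "\<not> fgraph_isomorphic (H, [edges H]) (K, [edges K])"
      using graph_iso_card(2) lt H(3) K(3) by (fastforce simp: fgraph_isomorphic_iff)
    then show "vertex (Delta g) m i \<sigma> \<noteq> vertex (Delta g) m j \<sigma>"
      using fclass_eq_iff[OF simplex_graph_filtered[OF H(1)] simplex_graph_filtered[OF K(1)]] H(2) K(2) by simp
  qed auto
qed

section \<open>Isometry classes\<close>

lemma isometry_class_iso:
  assumes "graph G" "graph_iso G H f h" "\<And>e. e \<in> edges G \<Longrightarrow> k (h e) = l e"
  shows "isometry_class G l = isometry_class H k"
proof -
  have G: "\<forall>e\<in>edges G. ends G e \<subseteq> verts G" using assms(1) by (simp add: graph_def)
  let ?f = "inv_into (verts G) f" and ?h = "inv_into (edges G) h"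
  have i: "graph_iso H G ?f ?h" by (rule graph_iso_inv[OF assms(2) G])
  have h: "h ` edges G = edges H" using assms(2) by (auto simp: graph_iso_def bij_betw_def)
  show ?thesis
  proof (intro equalityI subsetI)
    fix x assume "x \<in> isometry_class G l"
    then obtain K j a b where x: "x = (K, j)" "graph_iso G K a b" "\<forall>e\<in>edges G. j (b e) = l e"
      by (auto simp: isometry_class_def)
    have "graph_iso H K (a \<circ> ?f) (b \<circ> ?h)" by (rule graph_iso_trans[OF i x(2)])
    moreover have "\<forall>e\<in>edges H. j ((b \<circ> ?h) e) = k e"
    proof
      fix e assume "e \<in> edges H"
      then have "?h e \<in> edges G" "h (?h e) = e" using h by (auto simp: inv_into_into f_inv_into_f)
      then show "j ((b \<circ> ?h) e) = k e" using x(3) assms(3)[of "?h e"] by simp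
    qed
    ultimately show "x \<in> isometry_class H k" unfolding isometry_class_def x(1) by blast
  next
    fix x assume "x \<in> isometry_class H k"
    then obtain K j a b where x: "x = (K, j)" "graph_iso H K a b" "\<forall>e\<in>edges H. j (b e) = k e"
      by (auto simp: isometry_class_def)
    have "graph_iso G K (a \<circ> f) (b \<circ> h)" by (rule graph_iso_trans[OF assms(2) x(2)])
    moreover have "\<forall>e\<in>edges G. j ((b \<circ> h) e) = l e" using x(3) assms(3) unfolding h[symmetric] by simp
    ultimately show "x \<in> isometry_class G l" unfolding isometry_class_def x(1) by blast
  qed
qed

lemma isometry_class_nat_copy:
  assumes "graph (G :: ('v, 'e) mgraph)"
  shows "\<exists>(H :: (nat, nat) mgraph) k f h. graph_iso G H f h \<and> (\<forall>e\<in>edges G. k (h e) = l e)"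
proof -
  obtain H :: "(nat, nat) mgraph" and f h where i: "graph_iso G H f h" using graph_nat_copy[OF assms] by blast
  then have "\<forall>e\<in>edges G. (l \<circ> inv_into (edges G) h) (h e) = l e"
    by (simp add: graph_iso_def bij_betw_def)
  then show ?thesis using i by blast
qed

text \<open>The members of a class are graphs on natural numbers, so a common copy of \<open>G\<close> and \<open>H\<close> mediates.\<close>

lemma isometry_class_eqD:
  assumes "graph G" "graph H" "isometry_class G l = isometry_class H k"
  shows "\<exists>f h. graph_iso G H f h \<and> (\<forall>e\<in>edges G. k (h e) = l e)"
proof -
  obtain N :: "(nat, nat) mgraph" and j a b where N: "graph_iso H N a b" "\<forall>e\<in>edges H. j (b e) = k e"
    using isometry_class_nat_copy[OF assms(2)] by blast
  then have "(N, j) \<in> isometry_class H k" unfolding isometry_class_def by blast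
  then have "(N, j) \<in> isometry_class G l" by (simp only: assms(3))
  then obtain f h where fh: "graph_iso G N f h" "\<forall>e\<in>edges G. j (h e) = l e" by (auto simp: isometry_class_def)
  let ?a = "inv_into (verts H) a" and ?b = "inv_into (edges H) b"
  have "graph_iso N H ?a ?b" by (rule graph_iso_inv[OF N(1)]) (use assms(2) in \<open>simp add: graph_def\<close>)
  from graph_iso_trans[OF fh(1) this] have "graph_iso G H (?a \<circ> f) (?b \<circ> h)" .
  moreover have "k ((?b \<circ> h) e) = l e" if e: "e \<in> edges G" for e
  proof -
    have "h e \<in> b ` edges H" using e fh(1) N(1) by (auto simp: graph_iso_def bij_betw_def)
    then have "?b (h e) \<in> edges H" "b (?b (h e)) = h e" by (auto simp: inv_into_into f_inv_into_f)
    then show ?thesis using N(2) fh(2) e by (metis comp_apply)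
  qed
  ultimately show ?thesis by blast
qed

section \<open>The metric graph of a point of a simplex\<close>

text \<open>Vertex number \<open>j\<close> of the simplex of \<open>(G, \<pi>)\<close> stands for the graph in which the edges of the blocks
  from \<open>j\<close> on have length \<open>1\<close> and the others length \<open>0\<close>.  In between, lengths are interpolated
  affinely.\<close>

definition block_length :: "('v, 'e) fgraph \<Rightarrow> (nat \<Rightarrow> real) \<Rightarrow> 'e \<Rightarrow> real" where
  "block_length = (\<lambda>(G, \<pi>) t. \<lambda>e\<in>edges G. \<Sum>j<length \<pi>. if e \<in> \<Union> (set (drop j \<pi>)) then t j else 0)"

definition zero_edges :: "('v, 'e) fgraph \<Rightarrow> (nat \<Rightarrow> real) \<Rightarrow> 'e set" where
  "zero_edges x t = {e \<in> edges (fst x). block_length x t e = 0}"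

definition metric_point :: "('v, 'e) fgraph \<Rightarrow> (nat \<Rightarrow> real) \<Rightarrow> ((nat, nat) mgraph \<times> (nat \<Rightarrow> real)) set" where
  "metric_point x t = isometry_class (contract (fst x) (zero_edges x t)) (block_length x t)"

lemma mem_drop_iff:
  assumes "sorted_wrt (\<lambda>A B. A \<inter> B = {}) \<pi>" "i < length \<pi>" "e \<in> \<pi> ! i"
  shows "e \<in> \<Union> (set (drop j \<pi>)) \<longleftrightarrow> j \<le> i"
proof
  assume "e \<in> \<Union> (set (drop j \<pi>))"
  then obtain k where k: "k < length (drop j \<pi>)" "e \<in> drop j \<pi> ! k" by (metis UnionE in_set_conv_nth)
  then have "j + k < length \<pi>" "e \<in> \<pi> ! (j + k)" by auto
  then have "j + k = i"
    using assms sorted_wrt_nth_less[OF assms(1), of i "j + k"] sorted_wrt_nth_less[OF assms(1), of "j + k" i]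
    by (cases "j + k" i rule: linorder_cases) auto
  then show "j \<le> i" by simp
next
  assume "j \<le> i"
  then have "drop j \<pi> ! (i - j) = \<pi> ! i" "i - j < length (drop j \<pi>)" using assms(2) by auto
  then show "e \<in> \<Union> (set (drop j \<pi>))" using assms(3) by (metis UnionI nth_mem)
qed

lemma block_length_nth:
  assumes "filtered (G, \<pi>)" "i < length \<pi>" "e \<in> \<pi> ! i"
  shows "block_length (G, \<pi>) t e = (\<Sum>j\<le>i. t j)"
proof -
  have e: "e \<in> edges G" using filtered_subset[OF assms(1) nth_mem[OF assms(2)]] assms(3) by blast
  have s: "sorted_wrt (\<lambda>A B. A \<inter> B = {}) \<pi>" using assms(1) by (simp add: filtered_iff)
  have "block_length (G, \<pi>) t e = (\<Sum>j<length \<pi>. if j \<le> i then t j else 0)"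
    using e by (simp add: block_length_def mem_drop_iff[OF s assms(2,3)] del: Union_iff)
  also have "\<dots> = sum t ({..<length \<pi>} \<inter> {j. j \<le> i})" by (simp add: sum.inter_restrict[symmetric] sum.If_cases)
  also have "{..<length \<pi>} \<inter> {j. j \<le> i} = {..i}" using assms(2) by auto
  finally show ?thesis .
qed

lemma block_exists:
  assumes "filtered (G, \<pi>)" "e \<in> edges G"
  obtains i where "i < length \<pi>" "e \<in> \<pi> ! i"
proof -
  have "e \<in> \<Union> (set \<pi>)" using assms by (simp add: filtered_iff)
  then show thesis using that by (auto simp: in_set_conv_nth)
qed

lemma metric_point_iso:
  assumes "filtered x" "fgraph_isomorphic x y"
  shows "metric_point x t = metric_point y t"
proof -
  obtain G \<pi> H \<rho> where xy: "x = (G, \<pi>)" "y = (H, \<rho>)" by fastforce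
  obtain f h where i: "graph_iso G H f h" and m: "\<rho> = map ((`) h) \<pi>"
    using assms(2) by (auto simp: xy fgraph_isomorphic_iff)
  have G: "graph G" using assms(1) by (simp add: xy filtered_iff)
  have h: "inj_on h (edges G)" "edges H = h ` edges G" using i by (auto simp: graph_iso_def bij_betw_def)
  have len: "block_length y t (h e) = block_length x t e" if e: "e \<in> edges G" for e
  proof -
    have "h e \<in> \<Union> (set (drop j \<rho>)) \<longleftrightarrow> e \<in> \<Union> (set (drop j \<pi>))" for j
    proof -
      have U: "\<Union> (set (drop j \<rho>)) = h ` \<Union> (set (drop j \<pi>))" by (simp add: m drop_map image_Union)
      have s: "\<Union> (set (drop j \<pi>)) \<subseteq> edges G"
        using assms(1) in_set_dropD by (fastforce simp: xy filtered_iff)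
      show ?thesis unfolding U by (rule inj_on_image_mem_iff[OF h(1) e s])
    qed
    then show ?thesis using e h(2) by (simp add: block_length_def xy m del: Union_iff)
  qed
  have Z: "zero_edges y t = h ` zero_edges x t"
    using len h(2) by (auto simp: zero_edges_def xy)
  have sub: "zero_edges x t \<subseteq> edges G" by (auto simp: zero_edges_def xy)
  obtain g where "graph_iso (contract G (zero_edges x t)) (contract H (zero_edges y t)) g h"
    using contract_iso[OF i G sub] unfolding Z by blast
  from isometry_class_iso[OF graph_contract[OF G sub] this, of "block_length y t" "block_length x t"]
  show ?thesis using len by (simp add: metric_point_def xy)
qed

text \<open>This splits off the vanishing coordinate that \<open>simplical_face i\<close> inserts.\<close>

lemma sum_skip:
  fixes u :: "nat \<Rightarrow> real"
  shows "i \<le> n \<Longrightarrow> u i = 0 \<Longrightarrow> (\<Sum>j<Suc n. u j) = (\<Sum>j<n. u (if j < i then j else Suc j))"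
proof (induction n)
  case (Suc n)
  show ?case
  proof (cases "i \<le> n")
    case True
    then show ?thesis using Suc by simp
  next
    case False
    then have "(\<Sum>j<Suc n. u (if j < i then j else Suc j)) = (\<Sum>j<Suc n. u j)"
      by (intro sum.cong) auto
    then show ?thesis using False Suc(2,3) by (simp add: le_Suc_eq)
  qed
qed simp

text \<open>A point with vanishing coordinate \<open>i\<close> lies on the face opposite to vertex \<open>i\<close>; both simplices
  assign the same metric graph to it.\<close>

lemma metric_point_merge:
  assumes "simplex_graph g (Suc m) (G, \<pi>)" "0 < i" "i \<le> Suc m"
  shows "metric_point (G, merge_blocks i \<pi>) t = metric_point (G, \<pi>) (simplical_face i t)"
proof -
  have l: "length \<pi> = Suc (Suc m)" using assms(1) by (simp add: simplex_graph_iff)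
  then have "i < length \<pi>" using assms(3) by simp
  with assms(2) obtain xs A B ys where p: "\<pi> = xs @ A # B # ys" "i = Suc (length xs)" by (rule split_at_block)
  have l': "length (merge_blocks i \<pi>) = Suc m" using l by (simp add: p merge_blocks_append)
  have U: "\<Union> (set (drop j (merge_blocks i \<pi>))) = \<Union> (set (drop (if j < i then j else Suc j) \<pi>))" for j
  proof (cases "j < i")
    case True
    then show ?thesis by (auto simp: p merge_blocks_append)
  next
    case False
    then obtain k where "j = i + k" by (metis le_add_diff_inverse linorder_not_less)
    then show ?thesis by (simp add: p merge_blocks_append)
  qed
  have "block_length (G, merge_blocks i \<pi>) t = block_length (G, \<pi>) (simplical_face i t)"
  proof
    fix e
    have "(\<Sum>j<Suc (Suc m). if e \<in> \<Union> (set (drop j \<pi>)) then simplical_face i t j else 0) =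
        (\<Sum>j<Suc m. if e \<in> \<Union> (set (drop (if j < i then j else Suc j) \<pi>)) then t j else 0)"
      by (subst sum_skip[OF assms(3)], simp add: simplical_face_def, rule sum.cong)
        (simp_all add: simplical_face_def del: Union_iff)
    then show "block_length (G, merge_blocks i \<pi>) t e = block_length (G, \<pi>) (simplical_face i t) e"
      unfolding block_length_def by (simp only: prod.case l l' U restrict_def)
  qed
  then show ?thesis by (simp add: metric_point_def zero_edges_def)
qed

text \<open>The edges of the first block have length \<open>0\<close> and are contracted in either case.\<close>

lemma metric_point_contract:
  assumes "simplex_graph g (Suc m) (G, \<pi>)"
  shows "metric_point (contract G (hd \<pi>), tl \<pi>) t = metric_point (G, \<pi>) (simplical_face 0 t)"
proof -
  obtain A \<rho> where p: "\<pi> = A # \<rho>" "length \<rho> = Suc m"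
    using assms by (cases \<pi>) (auto simp: simplex_graph_iff)
  have G: "graph G" and A: "A \<subseteq> edges G" and dis: "A \<inter> \<Union> (set \<rho>) = {}"
    using assms by (auto simp: simplex_graph_iff stable_def p)
  let ?x = "(contract G A, \<rho>)" and ?y = "(G, \<pi>)" and ?s = "simplical_face 0 t"
  have len: "block_length ?y ?s e = (if e \<in> A then 0 else block_length ?x t e)" if "e \<in> edges G" for e
  proof -
    have "block_length ?y ?s e = (\<Sum>j<Suc (Suc m). if e \<in> \<Union> (set (drop j \<pi>)) then ?s j else 0)"
      using that by (simp add: block_length_def p del: sum.lessThan_Suc)
    also have "\<dots> = (\<Sum>j<Suc m. if e \<in> \<Union> (set (drop j \<rho>)) then t j else 0)"
      by (subst sum_skip[of 0], simp, simp add: simplical_face_def, rule sum.cong)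
        (simp_all add: simplical_face_def p del: Union_iff)
    also have "\<dots> = (if e \<in> A then 0 else block_length ?x t e)"
    proof (cases "e \<in> A")
      case True
      then have "e \<notin> \<Union> (set (drop j \<rho>))" for j using dis in_set_dropD by fastforce
      then show ?thesis using True by (simp del: Union_iff)
    next
      case False
      then show ?thesis using that by (simp add: block_length_def p del: Union_iff)
    qed
    finally show ?thesis .
  qed
  have Z: "zero_edges ?y ?s = A \<union> zero_edges ?x t" using len A by (auto simp: zero_edges_def split: if_splits)
  have sub: "A \<union> zero_edges ?x t \<subseteq> edges G" using A by (auto simp: zero_edges_def)
  obtain k where "graph_iso (contract G (A \<union> zero_edges ?x t)) (contract (contract G A) (zero_edges ?x t)) k id"
    using contract_contract_iso[OF G sub] by blast
  from isometry_class_iso[OF graph_contract[OF G sub] this, of "block_length ?x t" "block_length ?y ?s"]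
  show ?thesis using len by (simp add: metric_point_def Z[unfolded p(1)] p(1))
qed

lemma metric_point_face:
  assumes "\<sigma> \<in> cells (Delta g) (Suc m)" "g \<ge> 2" "i \<le> Suc m"
    and x: "filtered x" "\<sigma> = fclass (x :: (nat, nat) fgraph)"
    and y: "filtered y" "face (Delta g) (Suc m) i \<sigma> = fclass (y :: (nat, nat) fgraph)"
  shows "metric_point y t = metric_point x (simplical_face i t)"
proof -
  obtain G :: "(nat, nat) mgraph" and \<pi> where G: "\<sigma> = fclass (G, \<pi>)" "simplex_graph g (Suc m) (G, \<pi>)"
    using assms(1) by (auto simp: cells_Delta)
  have *: "metric_point (G, \<pi>) (simplical_face i t) = metric_point x (simplical_face i t)"
    using G x fclass_eq_iff metric_point_iso simplex_graph_filtered by metis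
  show ?thesis
  proof (cases "i = 0")
    case True
    note s = simplex_graph_contract[OF G(2) assms(2)]
    have "fclass (contract G (hd \<pi>), tl \<pi>) = fclass y"
      using y(2) face_contract[OF G(2) assms(2)] G(1) True by simp
    then have "metric_point (contract G (hd \<pi>), tl \<pi>) t = metric_point y t"
      using fclass_eq_iff[OF simplex_graph_filtered[OF s] y(1)] metric_point_iso[OF simplex_graph_filtered[OF s]] by blast
    then show ?thesis using metric_point_contract[OF G(2)] * True by simp
  next
    case False
    then have i: "0 < i" by simp
    note s = simplex_graph_merge[OF G(2) i assms(3)]
    have "fclass (G, merge_blocks i \<pi>) = fclass y"
      using y(2) face_merge[OF G(2) i assms(3)] G(1) by simp
    then have "metric_point (G, merge_blocks i \<pi>) t = metric_point y t"
      using fclass_eq_iff[OF simplex_graph_filtered[OF s] y(1)] metric_point_iso[OF simplex_graph_filtered[OF s]] by blast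
    then show ?thesis using metric_point_merge[OF G(2) i assms(3)] * by simp
  qed
qed

section \<open>Lengths and level sets\<close>

lemma standard_simplex_partial_sums:
  assumes "t \<in> standard_simplex m"
  shows "0 \<le> (\<Sum>j\<le>i. t j)" "(\<Sum>j\<le>i. t j) \<le> 1" "(\<Sum>j\<le>m. t j) = 1"
proof -
  have t: "\<And>i. 0 \<le> t i" "\<And>i. i > m \<Longrightarrow> t i = 0" "(\<Sum>j\<le>m. t j) = 1"
    using assms by (auto simp: standard_simplex_def)
  show "0 \<le> (\<Sum>j\<le>i. t j)" using t(1) by (simp add: sum_nonneg)
  have "(\<Sum>j\<le>i. t j) \<le> (\<Sum>j\<le>max i m. t j)" using t(1) by (intro sum_mono2) auto
  also have "\<dots> = (\<Sum>j\<le>m. t j)" using t(2) by (intro sum.mono_neutral_right) auto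
  finally show "(\<Sum>j\<le>i. t j) \<le> 1" "(\<Sum>j\<le>m. t j) = 1" using t(3) by auto
qed

lemma block_length_simplex:
  assumes "simplex_graph g m (G, \<pi>)" "t \<in> standard_simplex m"
  shows "e \<in> edges G \<Longrightarrow> 0 \<le> block_length (G, \<pi>) t e \<and> block_length (G, \<pi>) t e \<le> 1"
    and "\<exists>e\<in>edges G. block_length (G, \<pi>) t e = 1"
    and "forest G {e \<in> edges G. block_length (G, \<pi>) t e < 1}"
proof -
  note f = simplex_graph_filtered[OF assms(1)]
  have l: "length \<pi> = Suc m" using assms(1) by (simp add: simplex_graph_iff)
  show "0 \<le> block_length (G, \<pi>) t e \<and> block_length (G, \<pi>) t e \<le> 1" if "e \<in> edges G" for e
    using block_exists[OF f that] block_length_nth[OF f] standard_simplex_partial_sums[OF assms(2)] by metis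
  have last: "block_length (G, \<pi>) t e = 1" if "e \<in> \<pi> ! m" for e
    using block_length_nth[OF f _ that] l standard_simplex_partial_sums(3)[OF assms(2)] by simp
  have m: "\<pi> ! m \<in> set \<pi>" using l by simp
  then have "\<pi> ! m \<noteq> {}" "\<pi> ! m \<subseteq> edges G" using f filtered_subset[OF f m] unfolding filtered_iff by metis+
  then show "\<exists>e\<in>edges G. block_length (G, \<pi>) t e = 1" using last by blast
  have "{e \<in> edges G. block_length (G, \<pi>) t e < 1} \<subseteq> \<Union> (set (butlast \<pi>))"
  proof
    fix e assume e: "e \<in> {e \<in> edges G. block_length (G, \<pi>) t e < 1}"
    then have "e \<in> edges G" by simp
    then obtain i where i: "i < length \<pi>" "e \<in> \<pi> ! i" by (rule block_exists[OF f])
    have "i \<noteq> m" using last i(2) e by auto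
    then have "i < length (butlast \<pi>)" "butlast \<pi> ! i = \<pi> ! i" using i(1) l by (auto simp: nth_butlast)
    then show "e \<in> \<Union> (set (butlast \<pi>))" using i(2) by (metis UnionI nth_mem)
  qed
  then show "forest G {e \<in> edges G. block_length (G, \<pi>) t e < 1}"
    using assms(1) forest_subset by (auto simp: simplex_graph_iff)
qed

lemma sum_differences:
  fixes s :: "nat \<Rightarrow> real"
  shows "(\<Sum>j\<le>i. if j = 0 then s 0 else s j - s (j - 1)) = s i"
  by (induction i) auto

text \<open>Conversely, a metric graph is the point of a simplex: the blocks are the level sets of the
  lengths in increasing order, and the coordinates are the differences of consecutive lengths.\<close>

lemma block_length_exists:
  assumes G: "stable G" "genus G = g" and l: "l \<in> extensional (edges G)"
    and ran: "\<forall>e\<in>edges G. 0 \<le> l e \<and> l e \<le> 1" and one: "\<exists>e\<in>edges G. l e = 1"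
    and fo: "forest G {e \<in> edges G. l e < 1}"
  shows "\<exists>m \<pi> t. simplex_graph g m (G, \<pi>) \<and> t \<in> standard_simplex m \<and> block_length (G, \<pi>) t = l"
proof -
  have fin: "finite (l ` edges G)" using G(1) by (simp add: stable_def graph_def)
  define vs where "vs = sorted_list_of_set (l ` edges G)"
  have vs: "sorted_wrt (<) vs" "set vs = l ` edges G" using fin by (auto simp: vs_def)
  have ne: "vs \<noteq> []" using vs(2) one by auto
  define m where "m = length vs - 1"
  have len: "length vs = Suc m" using ne by (cases vs) (auto simp: m_def)
  have last: "vs ! m = 1"
  proof -
    have "1 \<in> set vs" using one vs(2) by force
    then obtain i where i: "i < length vs" "vs ! i = 1" by (auto simp: in_set_conv_nth)
    have "vs ! m \<in> l ` edges G" using len vs(2) nth_mem[of m vs] by simp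
    then have "vs ! m \<le> 1" using ran by auto
    moreover have "\<not> i < m" using sorted_wrt_nth_less[OF vs(1), of i m] len i(2) \<open>vs ! m \<le> 1\<close> by auto
    ultimately show ?thesis using i len by (metis less_Suc_eq)
  qed
  define \<pi> where "\<pi> = map (\<lambda>s. {e \<in> edges G. l e = s}) vs"
  have "sorted_wrt (\<lambda>A B. A \<inter> B = {}) \<pi>"
    unfolding \<pi>_def sorted_wrt_map by (rule sorted_wrt_mono_rel[OF _ vs(1)]) auto
  moreover have U: "\<Union> (set \<pi>) = edges G" "{} \<notin> set \<pi>" using vs(2) by (auto simp: \<pi>_def)
  moreover have "\<Union> (set (butlast \<pi>)) \<subseteq> {e \<in> edges G. l e < 1}"
  proof
    fix e assume "e \<in> \<Union> (set (butlast \<pi>))"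
    then obtain A where "A \<in> set (butlast \<pi>)" "e \<in> A" by blast
    then obtain i where i: "i < length (butlast \<pi>)" "e \<in> butlast \<pi> ! i" by (metis in_set_conv_nth)
    then have "e \<in> edges G" "l e = vs ! i" "i < m" using len by (auto simp: nth_butlast \<pi>_def)
    then show "e \<in> {e \<in> edges G. l e < 1}" using sorted_wrt_nth_less[OF vs(1), of i m] len last by simp
  qed
  ultimately have s: "simplex_graph g m (G, \<pi>)"
    using G fo forest_subset len by (auto simp: simplex_graph_iff \<pi>_def)
  define t where "t i = (if i \<le> m then if i = 0 then vs ! 0 else vs ! i - vs ! (i - 1) else 0)" for i
  have sum: "(\<Sum>j\<le>i. t j) = vs ! i" if "i \<le> m" for i
  proof -
    have "(\<Sum>j\<le>i. t j) = (\<Sum>j\<le>i. if j = 0 then vs ! 0 else vs ! j - vs ! (j - 1))"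
      using that by (intro sum.cong) (auto simp: t_def)
    then show ?thesis using sum_differences[of "\<lambda>i. vs ! i"] by simp
  qed
  have "vs ! 0 \<in> l ` edges G" using len vs(2) nth_mem[of 0 vs] by simp
  then have "0 \<le> vs ! 0" using ran by auto
  then have t0: "0 \<le> t i" for i
    using sorted_wrt_nth_less[OF vs(1), of "i - 1" i] len by (auto simp: t_def)
  have "t i \<le> 1" for i
  proof (cases "i \<le> m")
    case True
    have "t i \<le> (\<Sum>j\<le>m. t j)" using t0 True by (intro member_le_sum) auto
    then show ?thesis using sum[of m] last by simp
  qed (simp add: t_def)
  then have "t \<in> standard_simplex m" using t0 sum[of m] last by (auto simp: standard_simplex_def t_def)
  moreover have "block_length (G, \<pi>) t = l"
  proof
    fix e
    show "block_length (G, \<pi>) t e = l e"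
    proof (cases "e \<in> edges G")
      case True
      then obtain i where i: "i < length \<pi>" "e \<in> \<pi> ! i" by (rule block_exists[OF simplex_graph_filtered[OF s]])
      then have "l e = vs ! i" "i \<le> m" using len by (auto simp: \<pi>_def)
      then show ?thesis using block_length_nth[OF simplex_graph_filtered[OF s] i] sum by simp
    next
      case False
      then show ?thesis using l by (simp add: block_length_def extensional_def)
    qed
  qed
  ultimately show ?thesis using s by blast
qed

text \<open>If all coordinates are positive, then the partial sums increase strictly.  They are recovered as the
  sorted list of all lengths, and the blocks as the level sets.\<close>

lemma block_length_injective:
  assumes x: "simplex_graph g m (G, \<pi>)" "t \<in> standard_simplex m" "\<forall>j\<le>m. t j > 0"
    and y: "simplex_graph g n (H, \<rho>)" "s \<in> standard_simplex n" "\<forall>j\<le>n. s j > 0"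
    and i: "graph_iso G H f h" and len: "\<forall>e\<in>edges G. block_length (H, \<rho>) s (h e) = block_length (G, \<pi>) t e"
  shows "m = n \<and> t = s \<and> fgraph_isomorphic (G, \<pi>) (H, \<rho>)"
proof -
  have *: "length \<pi> = Suc m \<and> block_length (G, \<pi>) t ` edges G = set (map (\<lambda>i. \<Sum>j\<le>i. t j) [0..<Suc m]) \<and>
      sorted_wrt (<) (map (\<lambda>i. \<Sum>j\<le>i. t j) [0..<Suc m]) \<and>
      (\<forall>i\<le>m. \<pi> ! i = {e \<in> edges G. block_length (G, \<pi>) t e = (\<Sum>j\<le>i. t j)})"
    if x: "simplex_graph g m (G, \<pi>)" "\<forall>j\<le>m. t j > 0"
    for G :: "('v, 'e) mgraph" and \<pi> m and t :: "nat \<Rightarrow> real"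
  proof (intro conjI)
    note f = simplex_graph_filtered[OF x(1)]
    show l: "length \<pi> = Suc m" using x by (simp add: simplex_graph_iff)
    have mono: "(\<Sum>j\<le>i. t j) < (\<Sum>j\<le>k. t j)" if "i < k" "k \<le> m" for i k
    proof -
      have "{..k} = {..i} \<union> {i<..k}" using that(1) by auto
      then have "(\<Sum>j\<le>k. t j) = (\<Sum>j\<le>i. t j) + (\<Sum>j\<in>{i<..k}. t j)"
        by (simp add: sum.union_disjoint[symmetric] Int_def)
      moreover have "(\<Sum>j\<in>{i<..k}. t j) > 0" using x(2) that by (intro sum_pos) auto
      ultimately show ?thesis by simp
    qed
    show "sorted_wrt (<) (map (\<lambda>i. \<Sum>j\<le>i. t j) [0..<Suc m])"
      unfolding sorted_wrt_map by (rule sorted_wrt_mono_rel[OF _ sorted_wrt_upt]) (use mono in auto)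
    have ex: "\<exists>e. e \<in> \<pi> ! i" if "i \<le> m" for i
    proof -
      have "\<pi> ! i \<in> set \<pi>" using l that by simp
      then have "\<pi> ! i \<noteq> {}" using f unfolding filtered_iff by metis
      then show ?thesis by blast
    qed
    show "block_length (G, \<pi>) t ` edges G = set (map (\<lambda>i. \<Sum>j\<le>i. t j) [0..<Suc m])"
    proof (intro equalityI subsetI)
      fix r assume "r \<in> block_length (G, \<pi>) t ` edges G"
      then obtain e where e: "e \<in> edges G" "r = block_length (G, \<pi>) t e" by blast
      obtain i where "i < length \<pi>" "e \<in> \<pi> ! i" by (rule block_exists[OF f e(1)])
      then have "r = (\<Sum>j\<le>i. t j)" "i \<in> {0..<Suc m}" using e(2) block_length_nth[OF f] l by auto
      then show "r \<in> set (map (\<lambda>i. \<Sum>j\<le>i. t j) [0..<Suc m])" unfolding set_map set_upt by blast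
    next
      fix r assume "r \<in> set (map (\<lambda>i. \<Sum>j\<le>i. t j) [0..<Suc m])"
      then obtain i where "i \<in> {0..<Suc m}" and r: "r = (\<Sum>j\<le>i. t j)" unfolding set_map set_upt by blast
      then have i: "i \<le> m" "r = (\<Sum>j\<le>i. t j)" by auto
      obtain e where e: "e \<in> \<pi> ! i" using ex[OF i(1)] by blast
      then have "block_length (G, \<pi>) t e = r" "e \<in> edges G"
        using block_length_nth[OF f _ e] filtered_subset[OF f nth_mem[of i \<pi>]] i l by auto
      then show "r \<in> block_length (G, \<pi>) t ` edges G" by blast
    qed
    show "\<forall>i\<le>m. \<pi> ! i = {e \<in> edges G. block_length (G, \<pi>) t e = (\<Sum>j\<le>i. t j)}"
    proof (intro allI impI equalityI subsetI)
      fix i e assume "i \<le> m" "e \<in> \<pi> ! i"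
      then show "e \<in> {e \<in> edges G. block_length (G, \<pi>) t e = (\<Sum>j\<le>i. t j)}"
        using block_length_nth[OF f, of i e] filtered_subset[OF f nth_mem[of i \<pi>]] l by auto
    next
      fix i e assume i: "i \<le> m" and "e \<in> {e \<in> edges G. block_length (G, \<pi>) t e = (\<Sum>j\<le>i. t j)}"
      then have e: "e \<in> edges G" "block_length (G, \<pi>) t e = (\<Sum>j\<le>i. t j)" by auto
      obtain k where k: "k < length \<pi>" "e \<in> \<pi> ! k" by (rule block_exists[OF f e(1)])
      then have "(\<Sum>j\<le>i. t j) = (\<Sum>j\<le>k. t j)" using e(2) block_length_nth[OF f] by simp
      then have "k = i" using mono[of i k] mono[of k i] k l i by (cases i k rule: linorder_cases) auto
      then show "e \<in> \<pi> ! i" using k by simp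
    qed
  qed
  note X = *[OF x(1,3)] and Y = *[OF y(1,3)]
  have h: "h ` edges G = edges H" using i by (auto simp: graph_iso_def bij_betw_def)
  have "block_length (H, \<rho>) s ` edges H = block_length (G, \<pi>) t ` edges G"
    using len unfolding h[symmetric] image_image by (intro image_cong) auto
  then have L: "map (\<lambda>i. \<Sum>j\<le>i. t j) [0..<Suc m] = map (\<lambda>i. \<Sum>j\<le>i. s j) [0..<Suc n]"
    using X Y strict_sorted_equal by metis
  from arg_cong[OF this, of length] have mn: "m = n" by simp
  have sums: "(\<Sum>j\<le>i. t j) = (\<Sum>j\<le>i. s j)" if "i \<le> m" for i
    using arg_cong[OF L, of "\<lambda>xs. xs ! i"] that mn by (simp del: upt_Suc)
  have "t j = s j" for j
  proof (cases "j \<le> m")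
    case True
    then show ?thesis using sums[of j] sums[of "j - 1"] by (cases j) auto
  next
    case False
    then show ?thesis using x(2) y(2) mn by (simp add: standard_simplex_def)
  qed
  moreover have "map ((`) h) \<pi> = \<rho>"
  proof (rule nth_equalityI)
    show "length (map ((`) h) \<pi>) = length \<rho>" using X Y mn by simp
    fix i assume "i < length (map ((`) h) \<pi>)"
    then have i: "i \<le> m" "i \<le> n" using X mn by auto
    have "h ` {e \<in> edges G. block_length (G, \<pi>) t e = (\<Sum>j\<le>i. t j)} =
        {e \<in> edges H. block_length (H, \<rho>) s e = (\<Sum>j\<le>i. s j)}"
      using len sums[OF i(1)] unfolding h[symmetric] by auto
    then show "map ((`) h) \<pi> ! i = \<rho> ! i" using X Y i by simp
  qed
  ultimately show ?thesis using mn i by (auto simp: fgraph_isomorphic_iff)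
qed

section \<open>The realization is the moduli space\<close>

lemma homeomorphic_space_quotients:
  assumes f: "quotient_map X Y f" and h: "quotient_map X Z h"
    and eq: "\<And>x y. x \<in> topspace X \<Longrightarrow> y \<in> topspace X \<Longrightarrow> f x = f y \<longleftrightarrow> h x = h y"
  shows "Y homeomorphic_space Z"
proof -
  obtain a where a: "continuous_map Y Z a" "\<And>x. x \<in> topspace X \<Longrightarrow> a (f x) = h x"
    using quotient_map_lift_exists[OF f quotient_imp_continuous_map[OF h]] eq by metis
  obtain b where b: "continuous_map Z Y b" "\<And>x. x \<in> topspace X \<Longrightarrow> b (h x) = f x"
    using quotient_map_lift_exists[OF h quotient_imp_continuous_map[OF f]] eq by metis
  have "b (a y) = y" if "y \<in> topspace Y" for y
    using that a(2) b(2) quotient_imp_surjective_map[OF f] by (metis imageE)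
  moreover have "a (b z) = z" if "z \<in> topspace Z" for z
    using that a(2) b(2) quotient_imp_surjective_map[OF h] by (metis imageE)
  ultimately show ?thesis using a(1) b(1) unfolding homeomorphic_space_def homeomorphic_maps_def by blast
qed

abbreviation simplex_space :: "nat \<Rightarrow> (nat \<Rightarrow> real) topology" where
  "simplex_space m \<equiv> subtopology (powertop_real UNIV) (standard_simplex m)"

text \<open>One simplex for every filtered graph on natural numbers, rather than for every isomorphism class.
  Both spaces are quotients of this one.\<close>

definition filtered_graphs :: "int \<Rightarrow> (nat, nat) fgraph set" where
  "filtered_graphs g = {x. \<exists>m. simplex_graph g m x}"

definition cell_dim :: "('v, 'e) fgraph \<Rightarrow> nat" where
  "cell_dim x = length (snd x) - 1"

definition simplex_sum :: "int \<Rightarrow> ((nat, nat) fgraph \<times> (nat \<Rightarrow> real)) topology" where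
  "simplex_sum g = sum_topology (\<lambda>x. simplex_space (cell_dim x)) (filtered_graphs g)"

lemma cell_dim_simplex_graph: "simplex_graph g m x \<Longrightarrow> cell_dim x = m"
  by (cases x) (simp add: cell_dim_def simplex_graph_iff)

lemma filtered_graphs_iff: "x \<in> filtered_graphs g \<longleftrightarrow> simplex_graph g (cell_dim x) x"
  unfolding filtered_graphs_def using cell_dim_simplex_graph[of g _ x] by auto

lemma topspace_simplex_sum:
  "topspace (simplex_sum g) = {(x, t). simplex_graph g (cell_dim x) x \<and> t \<in> standard_simplex (cell_dim x)}"
  by (auto simp: simplex_sum_def filtered_graphs_iff)

definition to_cell :: "(nat, nat) fgraph \<times> (nat \<Rightarrow> real) \<Rightarrow> (nat \<times> (nat, nat) fgraph set) \<times> (nat \<Rightarrow> real)" where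
  "to_cell = (\<lambda>(x, t). ((cell_dim x, fclass x), t))"

text \<open>Over each simplex of the complex, the map is the identity on a copy of the same standard simplex.\<close>

lemma quotient_map_to_cell:
  "quotient_map (simplex_sum g)
     (sum_topology (\<lambda>(m, \<sigma>). simplex_space m) (simplices (Delta g))) to_cell"
  unfolding quotient_map_def
proof (intro conjI allI impI)
  let ?A = "sum_topology (\<lambda>(m, \<sigma>). simplex_space m) (simplices (Delta g))"
  have A: "topspace ?A = {((m, \<sigma>), t). \<sigma> \<in> cells (Delta g) m \<and> t \<in> standard_simplex m}"
    by (auto simp: simplices_def)
  show "to_cell ` topspace (simplex_sum g) = topspace ?A"
  proof (intro equalityI subsetI)
    fix y assume "y \<in> to_cell ` topspace (simplex_sum g)"
    then show "y \<in> topspace ?A" unfolding A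
      by (auto simp: topspace_simplex_sum to_cell_def fclass_in_cells)
  next
    fix y assume "y \<in> topspace ?A"
    then obtain m \<sigma> t where y: "y = ((m, \<sigma>), t)" "\<sigma> \<in> cells (Delta g) m" "t \<in> standard_simplex m"
      unfolding A by auto
    then obtain x :: "(nat, nat) fgraph" where x: "\<sigma> = fclass x" "simplex_graph g m x"
      by (auto simp: cells_Delta)
    note d = cell_dim_simplex_graph[OF x(2)]
    have "(x, t) \<in> topspace (simplex_sum g)" using x y d by (simp add: topspace_simplex_sum)
    moreover have "y = to_cell (x, t)" using x y d by (simp add: to_cell_def)
    ultimately show "y \<in> to_cell ` topspace (simplex_sum g)" by blast
  qed
  fix U assume U: "U \<subseteq> topspace ?A"
  let ?V = "{z \<in> topspace (simplex_sum g). to_cell z \<in> U}"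
  have slice: "{t. (x, t) \<in> ?V} = {t. ((cell_dim x, fclass x), t) \<in> U}" if "x \<in> filtered_graphs g" for x
    using that U unfolding A by (auto simp: topspace_simplex_sum to_cell_def filtered_graphs_iff)
  have "openin (simplex_sum g) ?V \<longleftrightarrow>
      (\<forall>x\<in>filtered_graphs g. openin (simplex_space (cell_dim x)) {t. (x, t) \<in> ?V})"
    by (subst simplex_sum_def, subst openin_sum_topology) (auto simp: simplex_sum_def)
  also have "\<dots> \<longleftrightarrow> (\<forall>x\<in>filtered_graphs g. openin (simplex_space (cell_dim x)) {t. ((cell_dim x, fclass x), t) \<in> U})"
    using slice by (intro ball_cong) auto
  also have "\<dots> \<longleftrightarrow> (\<forall>m. \<forall>\<sigma>\<in>cells (Delta g) m. openin (simplex_space m) {t. ((m, \<sigma>), t) \<in> U})"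
  proof (intro iffI allI ballI)
    fix m \<sigma> assume *: "\<forall>x\<in>filtered_graphs g. openin (simplex_space (cell_dim x)) {t. ((cell_dim x, fclass x), t) \<in> U}"
      and "\<sigma> \<in> cells (Delta g) m"
    then obtain x :: "(nat, nat) fgraph" where x: "\<sigma> = fclass x" "simplex_graph g m x"
      by (auto simp: cells_Delta)
    then have "x \<in> filtered_graphs g" by (auto simp: filtered_graphs_def)
    then show "openin (simplex_space m) {t. ((m, \<sigma>), t) \<in> U}"
      using * x(1) cell_dim_simplex_graph[OF x(2)] by blast
  next
    fix x assume *: "\<forall>m. \<forall>\<sigma>\<in>cells (Delta g) m. openin (simplex_space m) {t. ((m, \<sigma>), t) \<in> U}"
      and "x \<in> filtered_graphs g"
    then show "openin (simplex_space (cell_dim x)) {t. ((cell_dim x, fclass x), t) \<in> U}"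
      using fclass_in_cells[of g "cell_dim x" x] by (simp add: filtered_graphs_iff)
  qed
  also have "\<dots> \<longleftrightarrow> openin ?A U"
    using U by (auto simp: openin_sum_topology simplices_def)
  finally show "openin (simplex_sum g) ?V \<longleftrightarrow> openin ?A U" .
qed

text \<open>The underlying set of \<open>X0 g\<close>.\<close>

definition max_one_graphs :: "int \<Rightarrow> ((nat, nat) mgraph \<times> (nat \<Rightarrow> real)) set set" where
  "max_one_graphs g = {isometry_class G l | (G :: (nat, nat) mgraph) l.
     stable G \<and> genus G = g \<and> (\<forall>e\<in>edges G. 0 < l e \<and> l e \<le> 1) \<and> (\<exists>e\<in>edges G. l e = 1) \<and>
     forest G {e \<in> edges G. l e < 1}}"

text \<open>The last block gives the edges of length \<open>1\<close>.  The edges of length \<open>0\<close> are part of the forest of edges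
  shorter than \<open>1\<close>, and what remains of it after their contraction is a forest.\<close>

lemma metric_point_max_one:
  assumes "simplex_graph g m (x :: ('v, 'e) fgraph)" "g \<ge> 2" "t \<in> standard_simplex m"
  shows "metric_point x t \<in> max_one_graphs g"
proof -
  obtain G \<pi> where x: "x = (G, \<pi>)" by fastforce
  let ?l = "block_length x t" and ?Z = "zero_edges x t"
  note l = block_length_simplex[OF assms(1)[unfolded x] assms(3), folded x]
  have G: "stable G" "graph G" "genus G = g" using assms(1) by (auto simp: x simplex_graph_iff stable_def)
  have Z: "?Z \<subseteq> {e \<in> edges G. ?l e < 1}" by (auto simp: zero_edges_def x)
  then have Zf: "?Z \<subseteq> edges G" "forest G ?Z" using l(3) forest_subset by auto
  let ?H = "contract G ?Z"
  have H: "stable ?H" "genus ?H = g" using contract_forest[OF G(1) _ Zf] G(3) assms(2) by auto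
  have fo: "forest ?H {e \<in> edges ?H. ?l e < 1}"
  proof -
    have "{e \<in> edges ?H. ?l e < 1} = {e \<in> edges G. ?l e < 1} - ?Z" by auto
    then show ?thesis using forest_contract[OF G(2) Z] l(3) by auto
  qed
  obtain N :: "(nat, nat) mgraph" and k f h where N: "graph_iso ?H N f h" "\<forall>e\<in>edges ?H. k (h e) = ?l e"
    using isometry_class_nat_copy[OF graph_contract[OF G(2) Zf(1)]] by blast
  have h: "edges N = h ` edges ?H" using N(1) by (auto simp: graph_iso_def bij_betw_def)
  have "\<forall>e\<in>edges ?H. 0 < ?l e \<and> ?l e \<le> 1" using l(1) by (fastforce simp: zero_edges_def x)
  then have "\<forall>e\<in>edges N. 0 < k e \<and> k e \<le> 1" using N(2) unfolding h by simp
  moreover have "\<exists>e\<in>edges N. k e = 1"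
  proof -
    obtain e where e: "e \<in> edges G" "?l e = 1" using l(2) by blast
    then have "e \<in> edges ?H" by (auto simp: zero_edges_def)
    then show ?thesis using N(2) e(2) unfolding h by force
  qed
  moreover have "{e \<in> edges N. k e < 1} = h ` {e \<in> edges ?H. ?l e < 1}" using N(2) unfolding h by auto
  then have "forest N {e \<in> edges N. k e < 1}"
    using graph_iso_forest[OF N(1) graph_contract[OF G(2) Zf(1)], of "{e \<in> edges ?H. ?l e < 1}"] fo by auto
  moreover have "stable N" "genus N = g" using graph_iso_stable[OF N(1)] graph_iso_genus[OF N(1)] H by auto
  moreover have "metric_point x t = isometry_class N k"
    unfolding metric_point_def x fst_conv
    by (rule isometry_class_iso[OF graph_contract[OF G(2)] N(1)[unfolded x]]) (use Zf N(2) x in auto)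
  ultimately show ?thesis unfolding max_one_graphs_def by blast
qed

lemma topspace_length_space:
  "topspace (length_space G) = {l \<in> edges G \<rightarrow>\<^sub>E {0..}. forest G {e \<in> edges G. l e = 0}}"
  by (auto simp: length_space_def)

text \<open>A length function representing a point of \<open>X0\<close> comes from a simplex: contracting a forest does
  not change which sets of edges, together with it, are forests.\<close>

lemma max_one_lengths:
  assumes G: "stable G" "genus G = g" and l: "l \<in> topspace (length_space G)"
    and q: "isometry_class (contract G {e \<in> edges G. l e = 0}) l \<in> max_one_graphs g"
  shows "\<exists>m \<pi> t. simplex_graph g m (G, \<pi>) \<and> t \<in> standard_simplex m \<and> block_length (G, \<pi>) t = l"
proof -
  let ?Z = "{e \<in> edges G. l e = 0}"
  let ?H = "contract G ?Z"
  have gr: "graph G" using G by (simp add: stable_def)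
  obtain N :: "(nat, nat) mgraph" and k where N: "isometry_class ?H l = isometry_class N k"
    "stable N" "\<forall>e\<in>edges N. 0 < k e \<and> k e \<le> 1" "\<exists>e\<in>edges N. k e = 1" "forest N {e \<in> edges N. k e < 1}"
    using q unfolding max_one_graphs_def by blast
  have H: "graph ?H" using graph_contract[OF gr] by simp
  obtain f h where fh: "graph_iso ?H N f h" "\<forall>e\<in>edges ?H. k (h e) = l e"
    using isometry_class_eqD[OF H _ N(1)] N(2) by (auto simp: stable_def)
  have h: "edges N = h ` edges ?H" using fh(1) by (auto simp: graph_iso_def bij_betw_def)
  have l': "l \<in> extensional (edges G)" "\<forall>e\<in>edges G. 0 \<le> l e" "forest G ?Z"
    using l by (auto simp: topspace_length_space PiE_def)
  have "\<forall>e\<in>edges ?H. l e \<le> 1" using N(3) fh(2) unfolding h by simp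
  then have ran: "\<forall>e\<in>edges G. 0 \<le> l e \<and> l e \<le> 1" using l'(2) by auto
  have one: "\<exists>e\<in>edges G. l e = 1" using N(4) fh(2) unfolding h by auto
  have "{e \<in> edges N. k e < 1} = h ` {e \<in> edges ?H. l e < 1}" using fh(2) unfolding h by auto
  then have "forest ?H {e \<in> edges ?H. l e < 1}"
    using graph_iso_forest[OF fh(1) H, of "{e \<in> edges ?H. l e < 1}"] N(5) by auto
  moreover have "{e \<in> edges ?H. l e < 1} = {e \<in> edges G. l e < 1} - ?Z" by auto
  moreover have "?Z \<subseteq> {e \<in> edges G. l e < 1}" by auto
  ultimately have "forest G {e \<in> edges G. l e < 1}"
    using forest_contract[OF gr, of ?Z "{e \<in> edges G. l e < 1}"] l'(3) by auto
  then show ?thesis using block_length_exists[OF G l'(1) ran one] by blast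
qed

lemma continuous_map_block_length:
  assumes "simplex_graph g m (G, \<pi>)"
  shows "continuous_map (simplex_space m) (length_space G) (block_length (G, \<pi>))"
  unfolding length_space_def
proof (rule continuous_map_into_subtopology)
  show "continuous_map (simplex_space m) (product_topology (\<lambda>_. euclideanreal) (edges G)) (block_length (G, \<pi>))"
    unfolding continuous_map_componentwise
  proof (intro conjI ballI)
    show "block_length (G, \<pi>) ` topspace (simplex_space m) \<subseteq> extensional (edges G)"
      by (auto simp: block_length_def)
    fix e assume "e \<in> edges G"
    then have "(\<lambda>t. block_length (G, \<pi>) t e) =
        (\<lambda>t. \<Sum>j<length \<pi>. if e \<in> \<Union> (set (drop j \<pi>)) then t j else 0)"
      by (simp add: block_length_def)
    moreover have "continuous_map (simplex_space m) euclideanreal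
        (\<lambda>t. if e \<in> \<Union> (set (drop j \<pi>)) then t j else 0)" for j
      by (cases "e \<in> \<Union> (set (drop j \<pi>))")
        (auto intro!: continuous_map_from_subtopology continuous_map_product_projection simp del: Union_iff)
    ultimately show "continuous_map (simplex_space m) euclideanreal (\<lambda>t. block_length (G, \<pi>) t e)"
      by (simp add: continuous_map_sum del: Union_iff)
  qed
  show "block_length (G, \<pi>) \<in> topspace (simplex_space m) \<rightarrow>
      {l \<in> edges G \<rightarrow>\<^sub>E {0..}. forest G {e \<in> edges G. l e = 0}}"
  proof
    fix t assume "t \<in> topspace (simplex_space m)"
    then have t: "t \<in> standard_simplex m" by simp
    note l = block_length_simplex[OF assms t]
    have "{e \<in> edges G. block_length (G, \<pi>) t e = 0} \<subseteq> {e \<in> edges G. block_length (G, \<pi>) t e < 1}" by auto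
    then have "forest G {e \<in> edges G. block_length (G, \<pi>) t e = 0}" using l(3) forest_subset by blast
    then show "block_length (G, \<pi>) t \<in> {l \<in> edges G \<rightarrow>\<^sub>E {0..}. forest G {e \<in> edges G. l e = 0}}"
      using l(1) by (auto simp: block_length_def PiE_def extensional_def)
  qed
qed

lemma Hausdorff_length_space: "Hausdorff_space (length_space G)"
  unfolding length_space_def
  by (intro Hausdorff_space_subtopology) (simp add: Hausdorff_space_product_topology)

lemma finite_filtrations:
  assumes "finite (edges G)"
  shows "finite {\<pi>. simplex_graph g m (G, \<pi>)}"
proof (rule finite_subset)
  show "{\<pi>. simplex_graph g m (G, \<pi>)} \<subseteq> {\<pi>. set \<pi> \<subseteq> Pow (edges G) \<and> length \<pi> = Suc m}"
    by (auto simp: simplex_graph_iff)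
  show "finite {\<pi>. set \<pi> \<subseteq> Pow (edges G) \<and> length \<pi> = Suc m}"
    by (rule finite_lists_length_eq) (use assms in simp)
qed

text \<open>For a given graph, the depth of the filtrations is bounded, so there are finitely many of them.\<close>

lemma depth_le_card_edges:
  assumes "simplex_graph g m (G, \<pi>)"
  shows "Suc m \<le> card (edges G)"
proof -
  have fin: "finite (edges G)" using assms by (simp add: simplex_graph_iff stable_def graph_def)
  have "length \<pi> \<le> card (\<Union> (set \<pi>))" if "finite (\<Union> (set \<pi>))" "{} \<notin> set \<pi>" "sorted_wrt (\<lambda>A B. A \<inter> B = {}) \<pi>"
    for \<pi> :: "'b set list"
    using that
  proof (induction \<pi>)
    case (Cons A \<pi>)
    then have "card (A \<union> \<Union> (set \<pi>)) = card A + card (\<Union> (set \<pi>))"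
      by (intro card_Un_disjoint) auto
    moreover have "card A > 0" using Cons by (auto simp: card_gt_0_iff)
    ultimately show ?case using Cons by simp
  qed simp
  from this[of \<pi>] show ?thesis using assms fin by (simp add: simplex_graph_iff)
qed

text \<open>A set \<open>C\<close> is closed in \<open>X0 g\<close> if its preimage is closed in the space of lengths of every graph \<open>G\<close>.  This
  preimage is covered by images of simplices, one for each filtration of \<open>G\<close>, and if the preimage of \<open>C\<close> in
  each simplex is closed, then it is compact and has a closed image.  In particular, \<open>X0 g\<close> itself is closed
  in the space of all metric graphs.\<close>

lemma quotient_map_metric_point:
  assumes "g \<ge> 2"
  shows "quotient_map (simplex_sum g) (X0 g) (\<lambda>(x, t). metric_point x t)"
proof -
  let ?Y = "sum_topology length_space {G :: (nat, nat) mgraph. stable G \<and> genus G = g}"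
  let ?q = "\<lambda>(G, l). isometry_class (contract G {e \<in> edges G. l e = 0}) l"
  let ?p = "\<lambda>(x, t). metric_point x t"
  let ?b = "\<lambda>((G, \<pi>), t). (G, block_length (G, \<pi>) t)"
  have Y: "topspace ?Y = {(G, l). stable G \<and> genus G = g \<and> l \<in> topspace (length_space G)}" by auto
  have q: "quotient_map ?Y (metric_graphs g) ?q"
    unfolding metric_graphs_def by (rule quotient_map_quotient_topology)
  have X0: "X0 g = subtopology (metric_graphs g) (max_one_graphs g)" by (simp add: X0_def max_one_graphs_def)
  have qb: "?q (?b z) = ?p z" for z :: "(nat, nat) fgraph \<times> (nat \<Rightarrow> real)"
    by (cases z) (auto simp: metric_point_def zero_edges_def)
  have b: "?b z \<in> topspace ?Y" if "z \<in> topspace (simplex_sum g)" for z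
  proof -
    obtain G \<pi> t where z: "z = ((G, \<pi>), t)" by (metis prod.exhaust)
    then have s: "simplex_graph g (cell_dim (G, \<pi>)) (G, \<pi>)" "t \<in> standard_simplex (cell_dim (G, \<pi>))"
      using that by (auto simp: topspace_simplex_sum)
    have "block_length (G, \<pi>) t \<in> topspace (length_space G)"
      using continuous_map_block_length[OF s(1)] s(2) by (auto simp: continuous_map_def)
    then show ?thesis unfolding Y z using s(1) by (simp add: simplex_graph_iff)
  qed
  have sum_closed: "closedin (simplex_sum g) U \<longleftrightarrow> U \<subseteq> topspace (simplex_sum g) \<and>
      (\<forall>x\<in>filtered_graphs g. closedin (simplex_space (cell_dim x)) {t. (x, t) \<in> U})" for U
    unfolding simplex_sum_def topspace_sum_topology by (rule closedin_sum_topology)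
  have top: "topspace (X0 g) = ?q ` topspace ?Y \<inter> max_one_graphs g"
    using quotient_imp_surjective_map[OF q] unfolding X0 by auto
  have lift: "\<exists>\<pi> t. ((G, \<pi>), t) \<in> topspace (simplex_sum g) \<and> block_length (G, \<pi>) t = l"
    if "(G, l) \<in> topspace ?Y" "?q (G, l) \<in> max_one_graphs g" for G l
  proof -
    have "stable G" "genus G = g" "l \<in> topspace (length_space G)" using that(1) by (auto simp: Y)
    moreover have "isometry_class (contract G {e \<in> edges G. l e = 0}) l \<in> max_one_graphs g"
      using that(2) by simp
    ultimately obtain m \<pi> t where *: "simplex_graph g m (G, \<pi>)" "t \<in> standard_simplex m"
      "block_length (G, \<pi>) t = l" using max_one_lengths by blast
    then have "((G, \<pi>), t) \<in> topspace (simplex_sum g)"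
      using cell_dim_simplex_graph[OF *(1)] by (simp add: topspace_simplex_sum)
    then show ?thesis using *(3) by blast
  qed
  have p: "?p z \<in> topspace (X0 g)" if "z \<in> topspace (simplex_sum g)" for z
  proof -
    obtain x t where z: "z = (x, t)" by fastforce
    then have "?p z \<in> max_one_graphs g"
      using that metric_point_max_one[OF _ assms, of "cell_dim x" x t] by (simp add: topspace_simplex_sum)
    moreover have "?q (?b z) \<in> ?q ` topspace ?Y" by (rule imageI[OF b[OF that]])
    then have "?p z \<in> ?q ` topspace ?Y" by (simp only: qb)
    ultimately show ?thesis unfolding top by blast
  qed
  show ?thesis
    unfolding quotient_map_closedin
  proof (intro conjI allI impI)
    show "?p ` topspace (simplex_sum g) = topspace (X0 g)"
    proof (intro equalityI subsetI)
      fix y assume "y \<in> topspace (X0 g)"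
      then obtain G l where y: "y = ?q (G, l)" "(G, l) \<in> topspace ?Y" "?q (G, l) \<in> max_one_graphs g"
        unfolding top by auto
      obtain \<pi> t where *: "((G, \<pi>), t) \<in> topspace (simplex_sum g)" "block_length (G, \<pi>) t = l"
        using lift[OF y(2,3)] by blast
      then have "y = ?p ((G, \<pi>), t)" using y(1) qb[of "((G, \<pi>), t)"] by simp
      then show "y \<in> ?p ` topspace (simplex_sum g)" using *(1) by blast
    qed (use p in auto)
    fix C assume C: "C \<subseteq> topspace (X0 g)"
    let ?D = "{z \<in> topspace (simplex_sum g). ?p z \<in> C}" and ?E = "{y \<in> topspace ?Y. ?q y \<in> C}"
    have ps: "{t. ((G, \<pi>), t) \<in> ?D} =
        {t \<in> topspace (simplex_space (cell_dim (G, \<pi>))). block_length (G, \<pi>) t \<in> {l. (G, l) \<in> ?E}}"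
      if "(G, \<pi>) \<in> filtered_graphs g" for G \<pi>
      using that b[of "((G, \<pi>), _)"] qb[of "((G, \<pi>), _)"]
      by (auto simp: filtered_graphs_iff topspace_simplex_sum)
    show "closedin (simplex_sum g) ?D \<longleftrightarrow> closedin (X0 g) C"
    proof
      assume D: "closedin (simplex_sum g) ?D"
      have "closedin (length_space G) {l. (G, l) \<in> ?E}" if G: "stable G" "genus G = g" for G
      proof -
        let ?I = "SIGMA m:{..<card (edges G)}. {\<pi>. simplex_graph g m (G, \<pi>)}"
        let ?K = "\<lambda>\<pi>. {t. ((G, \<pi>), t) \<in> ?D}"
        have "finite (edges G)" using G by (simp add: stable_def graph_def)
        then have fin: "finite ?I" using finite_filtrations by (intro finite_SigmaI) auto
        have "closedin (length_space G) (block_length (G, \<pi>) ` ?K \<pi>)" if "(m, \<pi>) \<in> ?I" for m \<pi>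
        proof -
          have s: "simplex_graph g m (G, \<pi>)" using that by simp
          note d = cell_dim_simplex_graph[OF s]
          have "closedin (simplex_space m) (?K \<pi>)"
          proof -
            have "(G, \<pi>) \<in> filtered_graphs g" using s unfolding filtered_graphs_def by blast
            then show ?thesis using D[unfolded sum_closed] d by blast
          qed
          then have "compactin (simplex_space m) (?K \<pi>)"
            by (rule closedin_compact_space[rotated])
              (simp add: compact_space_subtopology compactin_standard_simplex)
          then have "compactin (length_space G) (block_length (G, \<pi>) ` ?K \<pi>)"
            using continuous_map_block_length[OF s] by (rule image_compactin)
          then show ?thesis by (rule compactin_imp_closedin[OF Hausdorff_length_space])
        qed
        then have "closedin (length_space G) (\<Union>(m, \<pi>)\<in>?I. block_length (G, \<pi>) ` ?K \<pi>)"
          by (intro closedin_Union) (use fin in auto)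
        also have "(\<Union>(m, \<pi>)\<in>?I. block_length (G, \<pi>) ` ?K \<pi>) = {l. (G, l) \<in> ?E}"
        proof (intro equalityI subsetI)
          fix l assume "l \<in> (\<Union>(m, \<pi>)\<in>?I. block_length (G, \<pi>) ` ?K \<pi>)"
          then obtain m \<pi> t where *: "((G, \<pi>), t) \<in> ?D" "l = block_length (G, \<pi>) t" by blast
          then show "l \<in> {l. (G, l) \<in> ?E}" using b[of "((G, \<pi>), t)"] qb[of "((G, \<pi>), t)"] by auto
        next
          fix l assume l: "l \<in> {l. (G, l) \<in> ?E}"
          then have "?q (G, l) \<in> max_one_graphs g" using C unfolding top by blast
          then obtain \<pi> t where *: "((G, \<pi>), t) \<in> topspace (simplex_sum g)" "block_length (G, \<pi>) t = l"
            using lift[of G l] l by blast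
          have "((G, \<pi>), t) \<in> ?D" using l * qb[of "((G, \<pi>), t)"] by simp
          moreover have s: "simplex_graph g (cell_dim (G, \<pi>)) (G, \<pi>)" using *(1) by (simp add: topspace_simplex_sum)
          then have "(cell_dim (G, \<pi>), \<pi>) \<in> ?I" using depth_le_card_edges[OF s] by simp
          ultimately show "l \<in> (\<Union>(m, \<pi>)\<in>?I. block_length (G, \<pi>) ` ?K \<pi>)" using *(2) by blast
        qed
        finally show ?thesis .
      qed
      then have "closedin ?Y ?E" unfolding closedin_sum_topology by (auto simp: Y)
      moreover have "C \<subseteq> topspace (metric_graphs g)" using C by (auto simp: X0)
      ultimately have "closedin (metric_graphs g) C" using q unfolding quotient_map_closedin by blast
      then show "closedin (X0 g) C" unfolding X0 using C by (auto simp: X0 intro: closedin_subset_topspace)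
    next
      assume "closedin (X0 g) C"
      then obtain C' where C': "closedin (metric_graphs g) C'" "C = C' \<inter> max_one_graphs g"
        unfolding X0 closedin_subtopology by blast
      have E: "closedin ?Y {y \<in> topspace ?Y. ?q y \<in> C'}"
        using quotient_imp_continuous_map[OF q] C'(1) by (rule closedin_continuous_map_preimage)
      have "closedin (simplex_space (cell_dim x)) {t. (x, t) \<in> ?D}" if x: "x \<in> filtered_graphs g" for x
      proof -
        obtain G \<pi> where xG: "x = (G, \<pi>)" by fastforce
        have s: "simplex_graph g (cell_dim x) (G, \<pi>)" using x xG by (simp add: filtered_graphs_iff)
        have "closedin (length_space G) {l. (G, l) \<in> {y \<in> topspace ?Y. ?q y \<in> C'}}"
          using E s unfolding closedin_sum_topology by (auto simp: simplex_graph_iff)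
        from closedin_continuous_map_preimage[OF continuous_map_block_length[OF s] this]
        have "closedin (simplex_space (cell_dim x)) {t \<in> topspace (simplex_space (cell_dim x)).
          block_length (G, \<pi>) t \<in> {l. (G, l) \<in> {y \<in> topspace ?Y. ?q y \<in> C'}}}" .
        also have "\<dots> = {t. (x, t) \<in> ?D}"
        proof -
          have "(x, t) \<in> ?D \<longleftrightarrow> t \<in> topspace (simplex_space (cell_dim x)) \<and> (G, block_length (G, \<pi>) t) \<in> topspace ?Y \<and>
              ?q (G, block_length (G, \<pi>) t) \<in> C'" for t
            using b[of "(x, t)"] qb[of "(x, t)"] p[of "(x, t)"] x
            unfolding C'(2) top xG by (auto simp: topspace_simplex_sum filtered_graphs_iff)
          then show ?thesis by auto
        qed
        finally show ?thesis .
      qed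
      then show "closedin (simplex_sum g) ?D"
        unfolding sum_closed by blast
    qed
  qed
qed

lemma glue_refl: "(a, a) \<in> glue K"
  by (simp add: glue_def Let_def)

lemma glue_sym: "(a, b) \<in> glue K \<Longrightarrow> (b, a) \<in> glue K"
  unfolding glue_def Let_def by (rule symD[OF sym_rtrancl[OF sym_Un_converse]])

lemma glue_trans: "(a, b) \<in> glue K \<Longrightarrow> (b, c) \<in> glue K \<Longrightarrow> (a, c) \<in> glue K"
  unfolding glue_def Let_def by (rule rtrancl_trans)

lemma glue_class_eq_iff: "glue K `` {a} = glue K `` {b} \<longleftrightarrow> (a, b) \<in> glue K"
  using glue_refl[of b K] glue_sym[of _ _ K] glue_trans[of _ _ K] by blast

lemma glue_face:
  assumes "\<sigma> \<in> cells K (Suc m)" "i \<le> Suc m" "t \<in> standard_simplex m"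
  shows "(((m, face K (Suc m) i \<sigma>), t), ((Suc m, \<sigma>), simplical_face i t)) \<in> glue K"
  unfolding glue_def Let_def by (rule r_into_rtrancl) (use assms in blast)

text \<open>The value of \<open>metric_point\<close> at an arbitrary representative.  It is constant on the classes of the gluing
  relation.\<close>

definition cell_point ::
  "int \<Rightarrow> (nat \<times> (nat, nat) fgraph set) \<times> (nat \<Rightarrow> real) \<Rightarrow> ((nat, nat) mgraph \<times> (nat \<Rightarrow> real)) set" where
  "cell_point g = (\<lambda>((m, \<sigma>), t). metric_point (SOME x :: (nat, nat) fgraph. simplex_graph g m x \<and> fclass x = \<sigma>) t)"

lemma cell_point_fclass:
  assumes "simplex_graph g m (x :: (nat, nat) fgraph)"
  shows "cell_point g ((m, fclass x), t) = metric_point x t"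
proof -
  define y where "y = (SOME y :: (nat, nat) fgraph. simplex_graph g m y \<and> fclass y = fclass x)"
  have y: "simplex_graph g m y \<and> fclass y = fclass x"
    unfolding y_def by (rule someI[of _ x]) (use assms in simp)
  note f = simplex_graph_filtered[OF conjunct1[OF y]] simplex_graph_filtered[OF assms]
  have "fgraph_isomorphic y x" using y fclass_eq_iff[OF f] by simp
  then have "metric_point y t = metric_point x t" by (rule metric_point_iso[OF f(1)])
  then show ?thesis by (simp add: cell_point_def y_def)
qed

lemma cell_point_face:
  assumes "\<sigma> \<in> cells (Delta g) (Suc m)" "g \<ge> 2" "i \<le> Suc m"
  shows "cell_point g ((m, face (Delta g) (Suc m) i \<sigma>), t) = cell_point g ((Suc m, \<sigma>), simplical_face i t)"
proof -
  obtain x :: "(nat, nat) fgraph" where x: "\<sigma> = fclass x" "simplex_graph g (Suc m) x"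
    using assms(1) by (auto simp: cells_Delta)
  have "face (Delta g) (Suc m) i \<sigma> \<in> cells (Delta g) m"
    using gen_simplicial_complex_Delta[OF assms(2)] assms(1,3) unfolding gen_simplicial_complex_def by blast
  then obtain y :: "(nat, nat) fgraph" where y: "face (Delta g) (Suc m) i \<sigma> = fclass y" "simplex_graph g m y"
    by (auto simp: cells_Delta)
  show ?thesis
    using metric_point_face[OF assms simplex_graph_filtered[OF x(2)] x(1) simplex_graph_filtered[OF y(2)] y(1)]
    by (simp add: cell_point_fclass[OF y(2), folded y(1)] cell_point_fclass[OF x(2), folded x(1)])
qed

lemma cell_point_glue:
  assumes "(a, b) \<in> glue (Delta g)" "g \<ge> 2"
  shows "cell_point g a = cell_point g b"
proof -
  let ?r = "{(((m, face (Delta g) (Suc m) i \<sigma>), t), ((Suc m, \<sigma>), simplical_face i t)) | m i \<sigma> t.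
    \<sigma> \<in> cells (Delta g) (Suc m) \<and> i \<le> Suc m \<and> t \<in> standard_simplex m}"
  have r: "cell_point g y = cell_point g z" if "(y, z) \<in> ?r" for y z
    using that cell_point_face[OF _ assms(2)] by blast
  have "(a, b) \<in> (?r \<union> ?r\<inverse>)\<^sup>*" using assms(1) by (simp add: glue_def Let_def)
  then show ?thesis
  proof (induction rule: rtrancl_induct)
    case (step y z)
    from step(2) have "cell_point g y = cell_point g z"
    proof
      assume "(y, z) \<in> ?r\<inverse>"
      then have "(z, y) \<in> ?r" by (rule converseD)
      from r[OF this] show ?thesis by simp
    qed (rule r)
    then show ?case using step.IH by simp
  qed simp
qed

text \<open>Every point lies in the interior of a simplex: vanishing coordinates are removed one by one.\<close>

lemma glue_positive:
  assumes "simplex_graph g m (x :: (nat, nat) fgraph)" "t \<in> standard_simplex m" "g \<ge> 2"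
  shows "\<exists>n (y :: (nat, nat) fgraph) s. simplex_graph g n y \<and> s \<in> standard_simplex n \<and> (\<forall>j\<le>n. s j > 0) \<and>
    (((m, fclass x), t), ((n, fclass y), s)) \<in> glue (Delta g)"
  using assms
proof (induction m arbitrary: x t)
  case 0
  then have "\<forall>j\<le>0. t j > 0" by (auto simp: standard_simplex_def)
  then show ?case using 0 glue_refl by blast
next
  case (Suc m)
  have t: "\<And>j. 0 \<le> t j" "\<And>j. t j \<le> 1" "\<And>j. j > Suc m \<Longrightarrow> t j = 0" "(\<Sum>j\<le>Suc m. t j) = 1"
    using Suc(3) by (auto simp: standard_simplex_def)
  show ?case
  proof (cases "\<forall>j\<le>Suc m. t j > 0")
    case True
    then show ?thesis using Suc(2,3) glue_refl by blast
  next
    case False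
    then obtain i where "i \<le> Suc m" "\<not> t i > 0" by blast
    then have i: "i \<le> Suc m" "t i = 0" using t(1)[of i] by auto
    define s where "s = (\<lambda>j. t (if j < i then j else Suc j))"
    have ts: "t = simplical_face i s" using i by (auto simp: s_def simplical_face_def fun_eq_iff)
    have "(\<Sum>j\<le>m. s j) = (\<Sum>j\<le>Suc m. t j)"
      using sum_skip[OF i(1), of t] i(2) by (simp only: s_def lessThan_Suc_atMost)
    then have s: "s \<in> standard_simplex m" using t i by (auto simp: standard_simplex_def s_def)
    have c: "fclass x \<in> cells (Delta g) (Suc m)" by (rule fclass_in_cells[OF Suc(2)])
    then have "face (Delta g) (Suc m) i (fclass x) \<in> cells (Delta g) m"
      using gen_simplicial_complex_Delta[OF Suc(4)] i(1) unfolding gen_simplicial_complex_def by blast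
    then obtain y :: "(nat, nat) fgraph" where y: "face (Delta g) (Suc m) i (fclass x) = fclass y" "simplex_graph g m y"
      by (auto simp: cells_Delta)
    have "(((Suc m, fclass x), t), ((m, fclass y), s)) \<in> glue (Delta g)"
      using glue_sym[OF glue_face[OF c i(1) s]] unfolding ts[symmetric] y(1) .
    then show ?thesis using Suc.IH[OF y(2) s Suc(4)] glue_trans by blast
  qed
qed

text \<open>By the preceding lemmas, both points may be assumed to have positive coordinates.  Then no edge has
  length \<open>0\<close>, nothing is contracted, and an isometry is an isomorphism of filtered graphs.\<close>

lemma fibres_agree:
  assumes g: "g \<ge> 2" and x: "simplex_graph g m (x :: (nat, nat) fgraph)" "t \<in> standard_simplex m"
    and y: "simplex_graph g n (y :: (nat, nat) fgraph)" "s \<in> standard_simplex n"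
  shows "(((m, fclass x), t), ((n, fclass y), s)) \<in> glue (Delta g) \<longleftrightarrow> metric_point x t = metric_point y s"
proof
  assume "(((m, fclass x), t), ((n, fclass y), s)) \<in> glue (Delta g)"
  then show "metric_point x t = metric_point y s"
    using cell_point_glue[OF _ g] cell_point_fclass x(1) y(1) by metis
next
  assume eq: "metric_point x t = metric_point y s"
  obtain m' and x' :: "(nat, nat) fgraph" and t' where x': "simplex_graph g m' x'" "t' \<in> standard_simplex m'"
    "\<forall>j\<le>m'. t' j > 0" "(((m, fclass x), t), ((m', fclass x'), t')) \<in> glue (Delta g)"
    using glue_positive[OF x g] by blast
  obtain n' and y' :: "(nat, nat) fgraph" and s' where y': "simplex_graph g n' y'" "s' \<in> standard_simplex n'"
    "\<forall>j\<le>n'. s' j > 0" "(((n, fclass y), s), ((n', fclass y'), s')) \<in> glue (Delta g)"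
    using glue_positive[OF y g] by blast
  have eq': "metric_point x' t' = metric_point y' s'"
    using eq cell_point_glue[OF x'(4) g] cell_point_glue[OF y'(4) g]
    by (simp add: cell_point_fclass[OF x(1)] cell_point_fclass[OF y(1)] cell_point_fclass[OF x'(1)] cell_point_fclass[OF y'(1)])
  have pos: "metric_point z r = isometry_class (fst z) (block_length z r)"
    if z: "simplex_graph g k z" "r \<in> standard_simplex k" "\<forall>j\<le>k. r j > 0"
    for k and z :: "(nat, nat) fgraph" and r
  proof -
    obtain G \<pi> where zG: "z = (G, \<pi>)" by fastforce
    note f = simplex_graph_filtered[OF z(1)[unfolded zG]]
    have "block_length z r e \<noteq> 0" if e: "e \<in> edges G" for e
    proof -
      obtain i where i: "i < length \<pi>" "e \<in> \<pi> ! i" by (rule block_exists[OF f e])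
      have "0 < r 0" using z(3) by simp
      also have "r 0 \<le> (\<Sum>j\<le>i. r j)"
        using z(2) by (intro member_le_sum) (auto simp: standard_simplex_def)
      finally show ?thesis unfolding zG block_length_nth[OF f i] by simp
    qed
    then have "zero_edges z r = {}" by (auto simp: zero_edges_def zG)
    moreover have G: "graph G" using f by (simp add: filtered_iff)
    obtain k where "graph_iso (contract G {}) G k id" using contract_empty_iso[OF G] by blast
    from isometry_class_iso[OF graph_contract[OF G] this, of "block_length z r" "block_length z r"]
    have "isometry_class (contract G {}) (block_length z r) = isometry_class G (block_length z r)" by simp
    ultimately show ?thesis by (simp add: metric_point_def zG)
  qed
  obtain G \<pi> H \<rho> where xy: "x' = (G, \<pi>)" "y' = (H, \<rho>)" by fastforce
  have "isometry_class G (block_length (G, \<pi>) t') = isometry_class H (block_length (H, \<rho>) s')"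
    using eq' pos[OF x'(1-3)] pos[OF y'(1-3)] by (simp add: xy)
  moreover have "graph G" "graph H" using x'(1) y'(1) by (auto simp: xy simplex_graph_iff stable_def)
  ultimately obtain f h where fh: "graph_iso G H f h"
    "\<forall>e\<in>edges G. block_length (H, \<rho>) s' (h e) = block_length (G, \<pi>) t' e"
    using isometry_class_eqD by blast
  have *: "m' = n'" "t' = s'" "fgraph_isomorphic x' y'"
    using block_length_injective[OF x'(1)[unfolded xy] x'(2,3) y'(1)[unfolded xy] y'(2,3) fh] by (auto simp: xy)
  then have "fclass x' = fclass y'" using fclass_eq_iff simplex_graph_filtered x'(1) y'(1) by metis
  then have "(((m, fclass x), t), ((n', fclass y'), s')) \<in> glue (Delta g)" using x'(4) * by simp
  then show "(((m, fclass x), t), ((n, fclass y), s)) \<in> glue (Delta g)"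
    using glue_sym[OF y'(4)] glue_trans by metis
qed

lemma realization_Delta_homeomorphic_X0:
  assumes "g \<ge> 2"
  shows "realization (Delta g) homeomorphic_space X0 g"
proof (rule homeomorphic_space_quotients)
  let ?A = "sum_topology (\<lambda>(m, \<sigma>). simplex_space m) (simplices (Delta g))"
  let ?f = "(\<lambda>a. glue (Delta g) `` {a}) \<circ> to_cell"
  have "quotient_map ?A (realization (Delta g)) (\<lambda>a. glue (Delta g) `` {a})"
    unfolding realization_def by (rule quotient_map_quotient_topology)
  then show "quotient_map (simplex_sum g) (realization (Delta g)) ?f"
    by (rule quotient_map_compose[OF quotient_map_to_cell])
  show "quotient_map (simplex_sum g) (X0 g) (\<lambda>(x, t). metric_point x t)"
    by (rule quotient_map_metric_point[OF assms])
  fix z w assume "z \<in> topspace (simplex_sum g)" "w \<in> topspace (simplex_sum g)"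
  then show "?f z = ?f w \<longleftrightarrow> (\<lambda>(x, t). metric_point x t) z = (\<lambda>(x, t). metric_point x t) w"
    using fibres_agree[OF assms] by (auto simp: topspace_simplex_sum to_cell_def glue_class_eq_iff)
qed

section \<open>Multiplicities and cuts\<close>

text \<open>The number of loops at \<open>u\<close> if \<open>u = w\<close>.\<close>

definition edge_mult :: "('v, 'e) mgraph \<Rightarrow> 'v \<Rightarrow> 'v \<Rightarrow> nat" where
  "edge_mult G u w = card {e \<in> edges G. ends G e = {u, w}}"

lemma mult_commute: "edge_mult G u w = edge_mult G w u"
  by (simp add: edge_mult_def insert_commute)

lemma valency_mult:
  assumes "graph G" "v \<in> verts G"
  shows "valency G v = (\<Sum>w\<in>verts G. edge_mult G v w) + edge_mult G v v"
proof -
  have fin: "finite (verts G)" "finite (edges G)" using assms(1) by (auto simp: graph_def)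
  have "{e \<in> edges G. v \<in> ends G e} = (\<Union>w\<in>verts G. {e \<in> edges G. ends G e = {v, w}})"
  proof (intro equalityI subsetI)
    fix e assume "e \<in> {e \<in> edges G. v \<in> ends G e}"
    then have e: "e \<in> edges G" "v \<in> ends G e" by auto
    obtain a b where "ends G e = {a, b}" "a \<in> verts G" "b \<in> verts G" by (rule graph_ends[OF assms(1) e(1)])
    then show "e \<in> (\<Union>w\<in>verts G. {e \<in> edges G. ends G e = {v, w}})" using e by (auto simp: insert_commute)
  qed auto
  moreover have "card (\<Union>w\<in>verts G. {e \<in> edges G. ends G e = {v, w}}) = (\<Sum>w\<in>verts G. edge_mult G v w)"
    unfolding edge_mult_def by (intro card_UN_disjoint) (use fin in \<open>auto simp: doubleton_eq_iff\<close>)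
  ultimately show ?thesis by (simp add: valency_def edge_mult_def)
qed

lemma sum_valency:
  assumes "graph G"
  shows "(\<Sum>v\<in>verts G. valency G v) = 2 * card (edges G)"
proof -
  have fin: "finite (verts G)" "finite (edges G)" using assms by (auto simp: graph_def)
  have c: "card {e \<in> edges G. P e} = (\<Sum>e\<in>edges G. if P e then 1 else 0)" for P
    using fin by (simp add: sum.If_cases Int_def)
  have "(\<Sum>v\<in>verts G. valency G v) = (\<Sum>v\<in>verts G. \<Sum>e\<in>edges G.
      (if v \<in> ends G e then 1 else 0) + (if ends G e = {v} then 1 else 0))"
    by (simp add: valency_def c sum.distrib)
  also have "\<dots> = (\<Sum>e\<in>edges G. \<Sum>v\<in>verts G. (if v \<in> ends G e then 1 else 0) + (if ends G e = {v} then 1 else 0))"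
    by (rule sum.swap)
  also have "\<dots> = (\<Sum>e\<in>edges G. 2)"
  proof (rule sum.cong)
    fix e assume e: "e \<in> edges G"
    obtain a b where ab: "ends G e = {a, b}" "a \<in> verts G" "b \<in> verts G" by (rule graph_ends[OF assms e])
    have 1: "verts G \<inter> ends G e = {a, b}" using ab by auto
    have 2: "verts G \<inter> {v. ends G e = {v}} = (if a = b then {a} else {})" using ab by auto
    have "(\<Sum>v\<in>verts G. (if v \<in> ends G e then 1 else 0) + (if ends G e = {v} then 1 else 0)) =
        card (verts G \<inter> ends G e) + card (verts G \<inter> {v. ends G e = {v}})"
      using fin by (simp add: sum.distrib sum.If_cases)
    also have "\<dots> = 2" unfolding 1 2 by (cases "a = b") auto
    finally show "(\<Sum>v\<in>verts G. (if v \<in> ends G e then 1 else 0) + (if ends G e = {v} then 1 else 0)) = (2::nat)" .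
  qed simp
  finally show ?thesis by simp
qed

lemma crossing_edge:
  assumes "connected_by G F" "u \<in> S" "u \<in> verts G" "w \<in> verts G" "w \<notin> S"
  shows "\<exists>e\<in>F. \<exists>a\<in>S. \<exists>b. b \<notin> S \<and> ends G e = {a, b}"
proof (rule ccontr)
  assume no: "\<not> ?thesis"
  have "(u, w) \<in> (adj G F)\<^sup>*" using assms by (simp add: connected_by_def)
  then have "w \<in> S"
  proof (induction rule: rtrancl_induct)
    case (step y z)
    then show ?case using no by (auto simp: adj_iff)
  qed (rule assms(2))
  then show False using assms(5) by simp
qed

text \<open>The graph has an edge across the cut, and as this is no bridge, the rest of the graph has another one.\<close>

lemma cut_mult:
  assumes "stable G" "S \<subseteq> verts G" "S \<noteq> {}" "S \<noteq> verts G"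
  shows "2 \<le> (\<Sum>u\<in>S. \<Sum>w\<in>verts G - S. edge_mult G u w)"
proof -
  have G: "graph G" "connected_by G (edges G)" using assms(1) by (auto simp: stable_def graph_def)
  have fin: "finite (verts G)" "finite (edges G)" "finite S"
    using G assms(2) finite_subset by (auto simp: graph_def)
  obtain u w where uw: "u \<in> S" "u \<in> verts G" "w \<in> verts G" "w \<notin> S" using assms by blast
  define X where "X = (\<Union>a\<in>S. \<Union>b\<in>verts G - S. {e \<in> edges G. ends G e = {a, b}})"
  have cross: "\<exists>e\<in>F. e \<in> X" if F: "F \<subseteq> edges G" "connected_by G F" for F
  proof -
    obtain e a b where e: "e \<in> F" "a \<in> S" "b \<notin> S" "ends G e = {a, b}"
      using crossing_edge[OF F(2) uw] by blast
    moreover have "b \<in> verts G" using G(1) e F(1) by (auto simp: graph_def)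
    ultimately show ?thesis using F(1) by (auto simp: X_def)
  qed
  obtain e where e: "e \<in> X" "e \<in> edges G" using cross[OF order_refl G(2)] by blast
  have "connected_by G (edges G - {e})" using assms(1) e(2) by (auto simp: stable_def bridge_def)
  then obtain f where f: "f \<in> X" "f \<noteq> e" using cross[of "edges G - {e}"] by blast
  have "finite X" unfolding X_def using fin by auto
  then have "card {e, f} \<le> card X" using e f by (intro card_mono) auto
  also have "card X \<le> (\<Sum>a\<in>S. card (\<Union>b\<in>verts G - S. {e \<in> edges G. ends G e = {a, b}}))"
    unfolding X_def by (rule card_UN_le[OF fin(3)])
  also have "\<dots> \<le> (\<Sum>a\<in>S. \<Sum>b\<in>verts G - S. edge_mult G a b)"
    unfolding edge_mult_def by (intro sum_mono card_UN_le) (use fin in simp)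
  finally show ?thesis using f(2) by simp
qed

lemma mult_pos: "graph G \<Longrightarrow> e \<in> edges G \<Longrightarrow> ends G e = {u, w} \<Longrightarrow> 1 \<le> edge_mult G u w"
  by (auto simp: edge_mult_def graph_def Suc_le_eq card_gt_0_iff)

section \<open>Automorphisms\<close>

text \<open>Parallel edges can be permuted at will, so a permutation of the vertices that preserves the
  multiplicities extends to an automorphism with prescribed values on some of the edges.\<close>

lemma extend_automorphism:
  assumes G: "graph G" and \<phi>: "bij_betw \<phi> (verts G) (verts G)"
    and mult: "\<And>u w. u \<in> verts G \<Longrightarrow> w \<in> verts G \<Longrightarrow> edge_mult G (\<phi> u) (\<phi> w) = edge_mult G u w"
    and F: "F \<subseteq> edges G" "inj_on k F" "k ` F \<subseteq> edges G" "\<And>e. e \<in> F \<Longrightarrow> ends G (k e) = \<phi> ` ends G e"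
  shows "\<exists>h. graph_iso G G \<phi> h \<and> (\<forall>e\<in>F. h e = k e)"
proof -
  have fin: "finite (edges G)" "finite F" using G F(1) finite_subset by (auto simp: graph_def)
  have inj: "inj_on \<phi> (verts G)" using \<phi> by (simp add: bij_betw_def)
  have ends_eq: "ends G e = ends G f" if "e \<in> edges G" "f \<in> edges G" "\<phi> ` ends G e = \<phi> ` ends G f" for e f
    using that G inj_on_image_eq_iff[OF inj] by (auto simp: graph_def)
  define C where "C s = {e \<in> edges G. ends G e = s}" for s
  have "\<exists>h. bij_betw h (C (ends G e) - F) (C (\<phi> ` ends G e) - k ` F)" if e: "e \<in> edges G" for e
  proof -
    obtain u w where uw: "ends G e = {u, w}" "u \<in> verts G" "w \<in> verts G" by (rule graph_ends[OF G e])
    have "card (C (\<phi> ` ends G e)) = card (C (ends G e))"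
      using mult[OF uw(2,3)] by (simp add: uw(1) C_def edge_mult_def)
    moreover have "C (\<phi> ` ends G e) \<inter> k ` F = k ` (C (ends G e) \<inter> F)"
    proof (intro equalityI subsetI)
      fix y assume "y \<in> C (\<phi> ` ends G e) \<inter> k ` F"
      then obtain x where x: "y = k x" "x \<in> F" "ends G (k x) = \<phi> ` ends G e" by (auto simp: C_def)
      then have "ends G x = ends G e" using ends_eq[of x e] F e by auto
      then show "y \<in> k ` (C (ends G e) \<inter> F)" using x F(1) by (auto simp: C_def)
    next
      fix y assume "y \<in> k ` (C (ends G e) \<inter> F)"
      then show "y \<in> C (\<phi> ` ends G e) \<inter> k ` F" using F(3,4) by (auto simp: C_def)
    qed
    moreover have "card (k ` (C (ends G e) \<inter> F)) = card (C (ends G e) \<inter> F)"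
      by (rule card_image) (rule inj_on_subset[OF F(2)], simp)
    moreover have C: "finite (C s)" for s using fin by (simp add: C_def)
    ultimately have "card (C (ends G e) - F) = card (C (\<phi> ` ends G e) - k ` F)"
      by (simp add: card_Diff_subset_Int)
    then show ?thesis using finite_same_card_bij C by (metis finite_Diff)
  qed
  then obtain b where b: "\<And>e. e \<in> edges G \<Longrightarrow> bij_betw (b (ends G e)) (C (ends G e) - F) (C (\<phi> ` ends G e) - k ` F)"
  proof -
    assume ex: "\<And>e. e \<in> edges G \<Longrightarrow> \<exists>h. bij_betw h (C (ends G e) - F) (C (\<phi> ` ends G e) - k ` F)"
      and goal: "\<And>b. (\<And>e. e \<in> edges G \<Longrightarrow> bij_betw (b (ends G e)) (C (ends G e) - F) (C (\<phi> ` ends G e) - k ` F)) \<Longrightarrow> thesis"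
    show thesis
      by (rule goal[of "\<lambda>s. SOME h. bij_betw h (C s - F) (C (\<phi> ` s) - k ` F)"]) (rule someI_ex[OF ex])
  qed
  define h where "h e = (if e \<in> F then k e else b (ends G e) e)" for e
  have out: "h e \<in> C (\<phi> ` ends G e) - k ` F" if "e \<in> edges G" "e \<notin> F" for e
    using bij_betwE[OF b[OF that(1)]] that by (simp add: h_def C_def)
  have h: "h e \<in> edges G \<and> ends G (h e) = \<phi> ` ends G e" if "e \<in> edges G" for e
    using out[of e] that F(3,4) by (cases "e \<in> F") (auto simp: h_def C_def)
  have "inj_on h (edges G)"
  proof (rule inj_onI)
    fix e f assume ef: "e \<in> edges G" "f \<in> edges G" "h e = h f"
    then have s: "ends G e = ends G f" using ends_eq h by metis
    have "h e \<in> k ` F \<longleftrightarrow> e \<in> F" if "e \<in> edges G" for e using out[OF that] by (auto simp: h_def)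
    then have "e \<in> F \<longleftrightarrow> f \<in> F" using ef by metis
    then show "e = f"
      using ef s F(2) b[OF ef(1)] by (cases "e \<in> F") (auto simp: h_def C_def inj_on_def bij_betw_def)
  qed
  moreover from this have "h ` edges G = edges G" using h endo_inj_surj[OF fin(1), of h] by blast
  ultimately have "graph_iso G G \<phi> h" using \<phi> h by (simp add: graph_iso_def bij_betw_def)
  then show ?thesis by (auto simp: h_def)
qed

lemma transposition_automorphism:
  assumes "graph G" "x \<in> verts G" "y \<in> verts G" "x \<noteq> y"
    and "edge_mult G x x = edge_mult G y y" "\<And>w. w \<in> verts G \<Longrightarrow> w \<noteq> x \<Longrightarrow> w \<noteq> y \<Longrightarrow> edge_mult G x w = edge_mult G y w"
    and "F \<subseteq> edges G" "inj_on k F" "k ` F \<subseteq> edges G"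
      "\<And>e. e \<in> F \<Longrightarrow> ends G (k e) = id(x := y, y := x) ` ends G e"
  shows "\<exists>h. graph_iso G G (id(x := y, y := x)) h \<and> (\<forall>e\<in>F. h e = k e)"
proof (rule extend_automorphism[OF assms(1)])
  show "bij_betw (id(x := y, y := x)) (verts G) (verts G)"
    using assms(2-4) by (auto simp: bij_betw_def inj_on_def image_def)
  fix u w assume "u \<in> verts G" "w \<in> verts G"
  then show "edge_mult G ((id(x := y, y := x)) u) ((id(x := y, y := x)) w) = edge_mult G u w"
    using assms(4-6) mult_commute[of G] by (cases "u = x"; cases "u = y"; cases "w = x"; cases "w = y") auto
qed (use assms in auto)

section \<open>Graphs of genus three\<close>

text \<open>The multiplicities \<open>a, b, c\<close> and the numbers of loops \<open>p, x, y\<close> of a graph with three vertices.\<close>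

lemma three_arith:
  fixes a b c p x y :: nat
  assumes "p + a + b + p \<ge> 3" "a + x + c + x \<ge> 3" "b + c + y + y \<ge> 3" "a + b + c + p + x + y = 5"
     "2 \<le> a + b" "2 \<le> a + c" "2 \<le> b + c"
  shows "a = 1 \<or> b = 1 \<or> c = 1"
    and "a = 1 \<Longrightarrow> b = 1 \<Longrightarrow> x = y"
    and "a \<ge> 2 \<Longrightarrow> b \<ge> 2 \<Longrightarrow> a = b \<and> x = y"
proof -
  have aux: False if "q + b + q \<ge> 3" "z + c + z \<ge> 3" "b + c + q + z \<le> 5" "b \<ge> 2" "c \<ge> 2" for b c q z :: nat
  proof -
    have "q \<noteq> 0 \<or> b \<ge> 3" "z \<noteq> 0 \<or> c \<ge> 3" using that by linarith+
    then show False using that by linarith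
  qed
  show "a = 1 \<or> b = 1 \<or> c = 1"
  proof (rule ccontr)
    assume "\<not> ?thesis"
    then consider "a \<ge> 2" "b \<ge> 2" "c \<ge> 2" | "a = 0" "b \<ge> 2" "c \<ge> 2" | "b = 0" "a \<ge> 2" "c \<ge> 2" | "c = 0" "a \<ge> 2" "b \<ge> 2"
      using assms(5-7) by linarith
    then show False
      using assms aux[of p b x c] aux[of p a y c] aux[of x a y b] by cases simp_all
  qed
  show "x = y" if "a = 1" "b = 1"
  proof -
    have "p \<noteq> 0" "c \<noteq> 0" using assms that by linarith+
    moreover have "c \<noteq> 1"
    proof
      assume "c = 1"
      then have "x \<noteq> 0" "y \<noteq> 0" using assms(2,3) that \<open>c = 1\<close> by linarith+
      then show False using assms(4) that \<open>p \<noteq> 0\<close> \<open>c = 1\<close> by linarith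
    qed
    ultimately show ?thesis using assms(4) that by linarith
  qed
  show "a = b \<and> x = y" if "a \<ge> 2" "b \<ge> 2"
  proof -
    have "c \<noteq> 0"
    proof
      assume "c = 0"
      then have "a \<ge> 3 \<or> x \<noteq> 0" "b \<ge> 3 \<or> y \<noteq> 0" using assms(2,3) that \<open>c = 0\<close> by linarith+
      then show False using assms(4) that by linarith
    qed
    then show ?thesis using assms(4) that by linarith
  qed
qed

locale genus_three =
  fixes G :: "('v, 'e) mgraph"
  assumes stable: "stable G" and genus: "genus G = 3"
begin

lemma graph: "graph G"
  using stable by (simp add: stable_def)

lemma finite_verts: "finite (verts G)"
  using graph by (simp add: graph_def)

lemma valency_ge: "v \<in> verts G \<Longrightarrow> 3 \<le> valency G v"
  using stable_iff_valency[of G] stable genus by simp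

lemma card_edges: "card (edges G) = card (verts G) + 2"
  using genus by (simp add: genus_def)

lemma card_verts: "1 \<le> card (verts G)" "card (verts G) \<le> 4"
proof -
  show "1 \<le> card (verts G)" using graph by (simp add: graph_def Suc_le_eq card_gt_0_iff)
  have "(\<Sum>v\<in>verts G. 3) \<le> (\<Sum>v\<in>verts G. valency G v)" by (rule sum_mono) (rule valency_ge)
  then show "card (verts G) \<le> 4" using sum_valency[OF graph] card_edges by simp
qed

lemma card_forest:
  assumes "Z \<subseteq> edges G" "forest G Z"
  shows "card Z < card (verts G)"
proof -
  have "graph (contract G Z)" by (rule graph_contract[OF graph assms(1)])
  then have "card (verts (contract G Z)) > 0" unfolding graph_def by (simp add: card_gt_0_iff)
  then show ?thesis using card_verts_contract[OF stable _ assms] genus by simp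
qed

text \<open>Up to isomorphism, there are two graphs with three vertices.  One has a loop at a vertex and a double edge
  between the other two; the other one has no loops and the multiplicities \<open>2, 2, 1\<close>.\<close>

lemma three_vertices:
  assumes "verts G = {p, x, y}" "p \<noteq> x" "p \<noteq> y" "x \<noteq> y"
  shows "edge_mult G p x = 1 \<or> edge_mult G p y = 1 \<or> edge_mult G x y = 1"
    and "edge_mult G p x = 1 \<Longrightarrow> edge_mult G p y = 1 \<Longrightarrow> edge_mult G x x = edge_mult G y y"
    and "edge_mult G p x \<ge> 2 \<Longrightarrow> edge_mult G p y \<ge> 2 \<Longrightarrow>
      edge_mult G p x = edge_mult G p y \<and> edge_mult G x x = edge_mult G y y"
proof -
  let ?a = "edge_mult G p x" and ?b = "edge_mult G p y" and ?c = "edge_mult G x y"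
  let ?p = "edge_mult G p p" and ?x = "edge_mult G x x" and ?y = "edge_mult G y y"
  have com: "edge_mult G x p = ?a" "edge_mult G y p = ?b" "edge_mult G y x = ?c"
    by (simp_all add: mult_commute)
  have v: "valency G p = ?p + ?a + ?b + ?p" "valency G x = ?a + ?x + ?c + ?x" "valency G y = ?b + ?c + ?y + ?y"
    using assms by (simp_all add: valency_mult[OF graph] com)
  then have val: "?p + ?a + ?b + ?p \<ge> 3" "?a + ?x + ?c + ?x \<ge> 3" "?b + ?c + ?y + ?y \<ge> 3"
    using valency_ge[of p] valency_ge[of x] valency_ge[of y] assms(1) by simp_all
  have "valency G p + valency G x + valency G y = 10"
    using sum_valency[OF graph] card_edges assms by simp
  then have tot: "?a + ?b + ?c + ?p + ?x + ?y = 5" unfolding v by linarith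
  have V: "verts G - {p} = {x, y}" "verts G - {x} = {p, y}" "verts G - {y} = {p, x}" using assms by auto
  have cut: "2 \<le> ?a + ?b" "2 \<le> ?a + ?c" "2 \<le> ?b + ?c"
    using cut_mult[OF stable, of "{p}"] cut_mult[OF stable, of "{x}"] cut_mult[OF stable, of "{y}"] assms
    unfolding V by (auto simp: com)
  note * = three_arith[OF val tot cut]
  show "?a = 1 \<or> ?b = 1 \<or> ?c = 1" by (rule *(1))
  show "?a = 1 \<Longrightarrow> ?b = 1 \<Longrightarrow> ?x = ?y" by (rule *(2))
  show "?a \<ge> 2 \<Longrightarrow> ?b \<ge> 2 \<Longrightarrow> ?a = ?b \<and> ?x = ?y" by (rule *(3))
qed

text \<open>The valencies add up to \<open>12\<close>, so each of them is \<open>3\<close>.  A loop at a vertex of valency \<open>3\<close> would leave a bridge.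
  The multiplicities of opposite pairs agree by linear algebra, and a triple edge would be cut off from the
  rest of the graph.\<close>

lemma four_vertices:
  assumes "verts G = {p, q, x, y}" "distinct [p, q, x, y]"
  shows "edge_mult G p p = 0" "edge_mult G p q = edge_mult G x y" "edge_mult G p q + edge_mult G p x + edge_mult G p y = 3" "edge_mult G p q \<le> 2"
proof -
  have val: "edge_mult G p p + edge_mult G p q + edge_mult G p x + edge_mult G p y + edge_mult G p p \<ge> 3"
    "edge_mult G q p + edge_mult G q q + edge_mult G q x + edge_mult G q y + edge_mult G q q \<ge> 3"
    "edge_mult G x p + edge_mult G x q + edge_mult G x x + edge_mult G x y + edge_mult G x x \<ge> 3"
    "edge_mult G y p + edge_mult G y q + edge_mult G y x + edge_mult G y y + edge_mult G y y \<ge> 3"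
    using valency_ge[of p] valency_ge[of q] valency_ge[of x] valency_ge[of y] assms
    by (simp_all add: valency_mult[OF graph] add.assoc)
  have tot: "(edge_mult G p p + edge_mult G p q + edge_mult G p x + edge_mult G p y + edge_mult G p p)
    + (edge_mult G q p + edge_mult G q q + edge_mult G q x + edge_mult G q y + edge_mult G q q)
    + (edge_mult G x p + edge_mult G x q + edge_mult G x x + edge_mult G x y + edge_mult G x x)
    + (edge_mult G y p + edge_mult G y q + edge_mult G y x + edge_mult G y y + edge_mult G y y) = 12"
    using sum_valency[OF graph] card_edges assms by (simp add: valency_mult[OF graph])
  have V: "verts G - {p} = {q, x, y}" "verts G - {q} = {p, x, y}" "verts G - {x} = {p, q, y}"
    "verts G - {y} = {p, q, x}" "verts G - {p, q} = {x, y}" using assms by auto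
  have "{p, q} \<noteq> verts G" using assms by auto
  then have cut: "2 \<le> edge_mult G p q + edge_mult G p x + edge_mult G p y" "2 \<le> edge_mult G q p + edge_mult G q x + edge_mult G q y"
    "2 \<le> edge_mult G x p + edge_mult G x q + edge_mult G x y" "2 \<le> edge_mult G y p + edge_mult G y q + edge_mult G y x"
    "2 \<le> edge_mult G p x + edge_mult G p y + edge_mult G q x + edge_mult G q y"
    using cut_mult[OF stable, of "{p}"] cut_mult[OF stable, of "{q}"] cut_mult[OF stable, of "{x}"]
      cut_mult[OF stable, of "{y}"] cut_mult[OF stable, of "{p, q}"] assms
    unfolding V by auto
  note com = mult_commute[of G q p] mult_commute[of G x p] mult_commute[of G y p] mult_commute[of G x q]
    mult_commute[of G y q] mult_commute[of G y x]
  have eq: "edge_mult G p p + edge_mult G p q + edge_mult G p x + edge_mult G p y + edge_mult G p p = 3"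
    "edge_mult G q p + edge_mult G q q + edge_mult G q x + edge_mult G q y + edge_mult G q q = 3"
    "edge_mult G x p + edge_mult G x q + edge_mult G x x + edge_mult G x y + edge_mult G x x = 3"
    "edge_mult G y p + edge_mult G y q + edge_mult G y x + edge_mult G y y + edge_mult G y y = 3"
    using val tot by linarith+
  have loop: "edge_mult G p p = 0" "edge_mult G q q = 0" "edge_mult G x x = 0" "edge_mult G y y = 0"
    using eq cut by linarith+
  then show "edge_mult G p p = 0" by simp
  show "edge_mult G p q = edge_mult G x y" "edge_mult G p q + edge_mult G p x + edge_mult G p y = 3" "edge_mult G p q \<le> 2"
    using eq loop cut com by linarith+
qed

text \<open>The permutation exchanges \<open>p\<close> with \<open>q\<close> and \<open>x\<close> with \<open>y\<close>, hence maps every pair to itself or to its opposite.\<close>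

lemma klein_automorphism:
  assumes V: "verts G = {p, q, x, y}" "distinct [p, q, x, y]"
    and F: "F \<subseteq> edges G" "inj_on k F" "k ` F \<subseteq> edges G"
      "\<And>e. e \<in> F \<Longrightarrow> ends G (k e) = id(p := q, q := p, x := y, y := x) ` ends G e"
  shows "\<exists>h. graph_iso G G (id(p := q, q := p, x := y, y := x)) h \<and> (\<forall>e\<in>F. h e = k e)"
proof (rule extend_automorphism[OF graph])
  show "bij_betw (id(p := q, q := p, x := y, y := x)) (verts G) (verts G)"
    unfolding V(1) using V(2) by (auto simp: bij_betw_def inj_on_def image_def)
  have V': "verts G = {q, p, x, y}" "verts G = {x, y, p, q}" "verts G = {y, x, p, q}" "verts G = {p, x, q, y}"
    "verts G = {p, y, q, x}" using V(1) by auto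
  have D: "distinct [q, p, x, y]" "distinct [x, y, p, q]" "distinct [y, x, p, q]" "distinct [p, x, q, y]"
    "distinct [p, y, q, x]" using V(2) by auto
  have "edge_mult G p p = 0" "edge_mult G q q = 0" "edge_mult G x x = 0" "edge_mult G y y = 0"
    "edge_mult G p q = edge_mult G x y" "edge_mult G p x = edge_mult G q y" "edge_mult G p y = edge_mult G q x"
    using four_vertices(1)[OF V] four_vertices(1)[OF V'(1) D(1)] four_vertices(1)[OF V'(2) D(2)]
      four_vertices(1)[OF V'(3) D(3)] four_vertices(2)[OF V] four_vertices(2)[OF V'(4) D(4)]
      four_vertices(2)[OF V'(5) D(5)] by simp_all
  moreover note com = mult_commute[of G q p] mult_commute[of G x p] mult_commute[of G y p] mult_commute[of G x q]
    mult_commute[of G y q] mult_commute[of G y x]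
  moreover fix u w assume uw: "u \<in> verts G" "w \<in> verts G"
  ultimately show "edge_mult G ((id(p := q, q := p, x := y, y := x)) u) ((id(p := q, q := p, x := y, y := x)) w) = edge_mult G u w"
    using V(2) uw[unfolded V(1)] by (elim insertE emptyE) simp_all
qed (use F in auto)

end

section \<open>Small forests\<close>

lemma forest_edge:
  assumes "graph G" "F \<subseteq> edges G" "forest G F" "e \<in> F"
  obtains a b where "ends G e = {a, b}" "a \<noteq> b" "a \<in> verts G" "b \<in> verts G"
proof -
  have "e \<in> edges G" using assms by blast
  then obtain a b where ab: "ends G e = {a, b}" "a \<in> verts G" "b \<in> verts G" by (rule graph_ends[OF assms(1)])
  have "forest G {e}" using assms forest_subset[of G F "{e}"] by simp
  then have "a \<noteq> b" using forest_single_iff[OF ab(1)] by simp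
  then show thesis using that ab by blast
qed

lemma forest_pair_iff:
  assumes "graph G" "e \<in> edges G" "f \<in> edges G" "e \<noteq> f"
  shows "forest G {e, f} \<longleftrightarrow> forest G {e} \<and> forest G {f} \<and> ends G e \<noteq> ends G f"
proof -
  obtain a b where ab: "ends G e = {a, b}" by (rule graph_ends[OF assms(1,2)])
  obtain c d where cd: "ends G f = {c, d}" by (rule graph_ends[OF assms(1,3)])
  show ?thesis
  proof (intro iffI conjI)
    assume fo: "forest G {e, f}"
    show "forest G {e}" "forest G {f}" by (rule forest_subset[OF fo], simp)+
    show "ends G e \<noteq> ends G f"
    proof
      assume eq: "ends G e = ends G f"
      have "(a, b) \<in> adj G ({e, f} - {e})" unfolding adj_iff
        using assms(4) eq ab by (intro bexI[of _ f]) auto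
      then have "(a, b) \<in> (adj G ({e, f} - {e}))\<^sup>*" by (rule r_into_rtrancl)
      then show False using fo[unfolded forest_iff, rule_format, of e a b] ab by simp
    qed
  next
    assume *: "forest G {e} \<and> forest G {f} \<and> ends G e \<noteq> ends G f"
    then have "c \<noteq> d" using forest_single_iff[OF cd] by simp
    then have "(c, d) \<notin> (adj G {e})\<^sup>*" using * unfolding linked_single[OF ab] ab cd by auto
    then have "forest G (insert f {e})" by (rule forest_insert[OF conjunct1[OF *] cd])
    then show "forest G {e, f}" by (simp add: insert_commute)
  qed
qed

lemma forest_parallel:
  assumes "graph G" "F \<subseteq> edges G" "forest G F" "e \<in> F" "f \<in> F" "e \<noteq> f"
  shows "ends G e \<noteq> ends G f"
proof -
  have "forest G {e, f}" using assms by (intro forest_subset[OF assms(3)]) auto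
  then show ?thesis using forest_pair_iff[OF assms(1)] assms by blast
qed

lemma forest_triangle:
  assumes "forest G F" "e \<in> F" "f \<in> F" "g \<in> F" "e \<noteq> f" "e \<noteq> g"
    and "ends G e = {p, q}" "ends G f = {p, x}" "ends G g = {q, x}"
  shows False
proof -
  have "(p, x) \<in> adj G (F - {e})" "(x, q) \<in> adj G (F - {e})"
    using assms(3-6,8,9) by (auto simp: adj_iff insert_commute)
  then have "(p, q) \<in> (adj G (F - {e}))\<^sup>*" by (rule converse_rtrancl_into_rtrancl[OF _ r_into_rtrancl])
  then show False using assms(1)[unfolded forest_iff, rule_format, of e p q] assms(2,7) by simp
qed

text \<open>Two adjacent edges of a forest, in the coordinates in which the automorphisms are described.\<close>

lemma forest_meet:
  assumes "graph G" "F \<subseteq> edges G" "forest G F" "e \<in> F" "f \<in> F" "e \<noteq> f" "ends G e \<inter> ends G f \<noteq> {}"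
  obtains p q x where "ends G e = {p, q}" "ends G f = {p, x}" "p \<noteq> q" "p \<noteq> x" "q \<noteq> x"
    "p \<in> verts G" "q \<in> verts G" "x \<in> verts G"
proof -
  obtain a b where ab: "ends G e = {a, b}" "a \<noteq> b" "a \<in> verts G" "b \<in> verts G"
    by (rule forest_edge[OF assms(1-4)])
  obtain c d where cd: "ends G f = {c, d}" "c \<noteq> d" "c \<in> verts G" "d \<in> verts G"
    by (rule forest_edge[OF assms(1-3,5)])
  have "{a, b} \<noteq> {c, d}" using forest_parallel[OF assms(1-6)] ab cd by simp
  moreover have "a = c \<or> a = d \<or> b = c \<or> b = d" using assms(7) ab cd by auto
  ultimately show thesis
    using that[of a b d] that[of a b c] that[of b a d] that[of b a c] ab cd by (auto simp: insert_commute)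
qed

lemma fourth_vertex:
  assumes "card V = 4" "p \<in> V" "q \<in> V" "x \<in> V" "distinct [p, q, x]"
  obtains y where "V = {p, q, x, y}" "distinct [p, q, x, y]"
proof -
  have "finite V" using assms(1) card.infinite by fastforce
  then have "card (V - {p, q, x}) = 1" using assms by (simp add: card_Diff_subset)
  then obtain y where y: "V - {p, q, x} = {y}" by (auto simp: card_1_singleton_iff)
  have "V = {p, q, x, y}" using y assms(2-4) by blast
  moreover have "distinct [p, q, x, y]" using y assms(5) by auto
  ultimately show thesis by (rule that)
qed

lemma third_vertex:
  assumes "card V = 3" "p \<in> V" "q \<in> V" "x \<in> V" "distinct [p, q, x]"
  shows "V = {p, q, x}"
proof -
  have "finite V" using assms(1) card.infinite by fastforce
  moreover have "{p, q, x} \<subseteq> V" "card {p, q, x} = card V" using assms by auto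
  ultimately show ?thesis using card_subset_eq by metis
qed

section \<open>Exchanging two edges of a forest\<close>

text \<open>The matching adds edges without parallel ones if possible.  In a graph with two vertices, all edges that
  are not loops are parallel, hence equivalent.\<close>

definition good_edge :: "('v, 'e) mgraph \<Rightarrow> 'e \<Rightarrow> bool" where
  "good_edge G e \<longleftrightarrow> card (verts G) = 2 \<or> (\<forall>f\<in>edges G. ends G f = ends G e \<longrightarrow> f = e)"

text \<open>The two edges of a special pair that is a forest are equivalent under automorphisms: they are exchanged by
  a transposition of two vertices or by an element of Klein's four-group.\<close>

definition special :: "('v, 'e) mgraph \<Rightarrow> 'e set \<Rightarrow> bool" where
  "special G P \<longleftrightarrow> (\<forall>e\<in>P. \<not> good_edge G e) \<or> (\<forall>e\<in>P. \<forall>f\<in>P. e \<noteq> f \<longrightarrow> ends G e \<inter> ends G f = {})"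

definition exchangeable :: "('v, 'e) mgraph \<Rightarrow> 'e set \<Rightarrow> 'e \<Rightarrow> 'e \<Rightarrow> bool" where
  "exchangeable G X f g \<longleftrightarrow> (\<exists>\<phi> h. graph_iso G G \<phi> h \<and> h f = g \<and> h g = f \<and> (\<forall>e\<in>X. h e = e))"

lemma special_pair:
  "e \<noteq> f \<Longrightarrow> special G {e, f} \<longleftrightarrow> \<not> good_edge G e \<and> \<not> good_edge G f \<or> ends G e \<inter> ends G f = {}"
  by (auto simp: special_def)

context genus_three
begin

lemma good_edge_mult:
  assumes "card (verts G) \<noteq> 2" "e \<in> edges G" "ends G e = {u, w}"
  shows "good_edge G e \<longleftrightarrow> edge_mult G u w = 1" "\<not> good_edge G e \<longleftrightarrow> edge_mult G u w \<ge> 2"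
proof -
  have fin: "finite (edges G)" using graph by (simp add: graph_def)
  have e: "e \<in> {f \<in> edges G. ends G f = {u, w}}" using assms by simp
  show *: "good_edge G e \<longleftrightarrow> edge_mult G u w = 1"
  proof
    assume "good_edge G e"
    then have "f = e" if "f \<in> edges G" "ends G f = {u, w}" for f
      using assms that unfolding good_edge_def by metis
    then have "{f \<in> edges G. ends G f = {u, w}} = {e}" using e by blast
    then show "edge_mult G u w = 1" by (simp add: edge_mult_def)
  next
    assume "edge_mult G u w = 1"
    then obtain y where "{f \<in> edges G. ends G f = {u, w}} = {y}"
      unfolding edge_mult_def by (rule card_1_singletonE)
    then have "{f \<in> edges G. ends G f = {u, w}} = {e}" using e by auto
    then show "good_edge G e" unfolding good_edge_def assms(3) by blast
  qed
  have "edge_mult G u w \<ge> 1" using mult_pos[OF graph assms(2,3)] .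
  then show "\<not> good_edge G e \<longleftrightarrow> edge_mult G u w \<ge> 2" unfolding * by linarith
qed

lemma exchange_transposition:
  assumes fg: "f \<in> edges G" "g \<in> edges G" "ends G f = {p, x}" "ends G g = {p, y}"
    and pxy: "p \<noteq> x" "p \<noteq> y" "x \<noteq> y" "x \<in> verts G" "y \<in> verts G"
    and m: "edge_mult G x x = edge_mult G y y" "\<And>w. w \<in> verts G \<Longrightarrow> w \<noteq> x \<Longrightarrow> w \<noteq> y \<Longrightarrow> edge_mult G x w = edge_mult G y w"
    and X: "X \<subseteq> edges G" "f \<notin> X" "g \<notin> X" "\<And>e. e \<in> X \<Longrightarrow> id(x := y, y := x) ` ends G e = ends G e"
  shows "exchangeable G X f g"
proof -
  let ?k = "id(f := g, g := f)"
  have "f \<noteq> g" using fg(3,4) pxy by (auto simp: doubleton_eq_iff)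
  have "\<exists>h. graph_iso G G (id(x := y, y := x)) h \<and> (\<forall>e\<in>insert f (insert g X). h e = ?k e)"
  proof (rule transposition_automorphism[OF graph pxy(4,5,3) m])
    show "inj_on ?k (insert f (insert g X))" using X(2,3) by (auto simp: inj_on_def)
    show "?k ` insert f (insert g X) \<subseteq> edges G" using fg X(1) by auto
    fix e assume "e \<in> insert f (insert g X)"
    then show "ends G (?k e) = id(x := y, y := x) ` ends G e"
      using X(2-4) fg(3,4) pxy \<open>f \<noteq> g\<close> by auto
  qed (use fg X in auto)
  then obtain h where h: "graph_iso G G (id(x := y, y := x)) h" "\<forall>e\<in>insert f (insert g X). h e = ?k e" by blast
  then have "h f = g" "h g = f" using \<open>f \<noteq> g\<close> by auto
  moreover have "\<forall>e\<in>X. h e = e" using h(2) X(2,3) by auto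
  ultimately show ?thesis using h(1) unfolding exchangeable_def by blast
qed

lemma exchange_klein:
  assumes fg: "f \<in> edges G" "g \<in> edges G" "ends G f = {p, x}" "ends G g = {q, y}"
    and V: "verts G = {p, q, x, y}" "distinct [p, q, x, y]"
    and X: "X \<subseteq> {e \<in> edges G. ends G e = {p, q}}"
  shows "exchangeable G X f g"
proof -
  let ?k = "id(f := g, g := f)" and ?\<phi> = "id(p := q, q := p, x := y, y := x)"
  have "f \<noteq> g" using fg(3,4) V(2) by (auto simp: doubleton_eq_iff)
  have "ends G f \<noteq> {p, q}" "ends G g \<noteq> {p, q}" using fg(3,4) V(2) by (auto simp: doubleton_eq_iff)
  then have fgX: "f \<notin> X" "g \<notin> X" using X by blast+
  have "\<exists>h. graph_iso G G ?\<phi> h \<and> (\<forall>e\<in>insert f (insert g X). h e = ?k e)"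
  proof (rule klein_automorphism[OF V])
    show "inj_on ?k (insert f (insert g X))" using fgX by (auto simp: inj_on_def)
    show "?k ` insert f (insert g X) \<subseteq> edges G" using fg X by auto
    fix e assume "e \<in> insert f (insert g X)"
    then consider "e = f" | "e = g" | "e \<in> X" "e \<noteq> f" "e \<noteq> g" using fgX by blast
    then show "ends G (?k e) = ?\<phi> ` ends G e"
    proof cases
      case 3
      then have "ends G e = {p, q}" using X by blast
      then show ?thesis using 3 V(2) by (auto simp: insert_commute)
    qed (use fg(3,4) V(2) \<open>f \<noteq> g\<close> in auto)
  qed (use fg X in auto)
  then obtain h where h: "graph_iso G G ?\<phi> h" "\<forall>e\<in>insert f (insert g X). h e = ?k e" by blast
  then have "h f = g" "h g = f" using \<open>f \<noteq> g\<close> by auto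
  moreover have "\<forall>e\<in>X. h e = e" using h(2) fgX by auto
  ultimately show ?thesis using h(1) unfolding exchangeable_def by blast
qed

text \<open>If both edges are good, then there are a loop at \<open>p\<close> and a double edge between \<open>x\<close> and \<open>y\<close>.  If both are
  bad, then there are no loops, and both have multiplicity \<open>2\<close>.  In either case, the transposition of \<open>x\<close>
  and \<open>y\<close> is an automorphism.\<close>

lemma exchange_three:
  assumes fg: "f \<in> edges G" "g \<in> edges G" "ends G f = {p, x}" "ends G g = {p, y}"
    and V: "verts G = {p, x, y}" "p \<noteq> x" "p \<noteq> y" "x \<noteq> y"
    and good: "good_edge G f \<longleftrightarrow> good_edge G g"
    and X: "X \<subseteq> {e \<in> edges G. ends G e = {x, y}}"
  shows "exchangeable G X f g"
proof -
  have n: "card (verts G) \<noteq> 2" using V by simp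
  have m: "edge_mult G p x = edge_mult G p y \<and> edge_mult G x x = edge_mult G y y"
    using good_edge_mult[OF n fg(1,3)] good_edge_mult[OF n fg(2,4)] good three_vertices(2,3)[OF V] by metis
  have "ends G f \<noteq> {x, y}" "ends G g \<noteq> {x, y}" using fg(3,4) V(2-4) by (auto simp: doubleton_eq_iff)
  then have fgX: "f \<notin> X" "g \<notin> X" using X by blast+
  show ?thesis
  proof (rule exchange_transposition[OF fg V(2-4)])
    show "edge_mult G x w = edge_mult G y w" if "w \<in> verts G" "w \<noteq> x" "w \<noteq> y" for w
      using that m V by (auto simp: mult_commute[of G _ p])
    show "id(x := y, y := x) ` ends G e = ends G e" if "e \<in> X" for e
    proof -
      have "ends G e = {x, y}" using that X by blast
      then show ?thesis using V by auto
    qed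
  qed (use m V X fgX in auto)
qed

lemma exchange_four:
  assumes fg: "f \<in> edges G" "g \<in> edges G" "ends G f = {p, x}" "ends G g = {p, y}"
    and V: "verts G = {p, q, x, y}" "distinct [p, q, x, y]"
    and m: "edge_mult G p x = edge_mult G p y"
    and X: "X \<subseteq> {e \<in> edges G. ends G e = {p, q}}"
  shows "exchangeable G X f g"
proof -
  have V': "verts G = {x, q, p, y}" "verts G = {y, q, p, x}" "verts G = {p, x, q, y}" "verts G = {p, y, q, x}"
    using V by auto
  have D: "distinct [x, q, p, y]" "distinct [y, q, p, x]" "distinct [p, x, q, y]" "distinct [p, y, q, x]"
    using V(2) by auto
  have "ends G f \<noteq> {p, q}" "ends G g \<noteq> {p, q}" using fg(3,4) V(2) by (auto simp: doubleton_eq_iff)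
  then have fgX: "f \<notin> X" "g \<notin> X" using X by blast+
  have loops: "edge_mult G x x = edge_mult G y y"
    using four_vertices(1)[OF V'(1) D(1)] four_vertices(1)[OF V'(2) D(2)] by simp
  have opp: "edge_mult G x q = edge_mult G y q"
    using four_vertices(2)[OF V'(3) D(3)] four_vertices(2)[OF V'(4) D(4)] m by (simp add: mult_commute[of G _ q])
  show ?thesis
  proof (rule exchange_transposition[OF fg])
    show "edge_mult G x w = edge_mult G y w" if "w \<in> verts G" "w \<noteq> x" "w \<noteq> y" for w
      using that m opp V by (auto simp: mult_commute[of G _ p])
    show "id(x := y, y := x) ` ends G e = ends G e" if "e \<in> X" for e
    proof -
      have "ends G e = {p, q}" using that X by blast
      then show ?thesis using V by auto
    qed
  qed (use V X fgX loops in auto)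
qed

text \<open>Two disjoint edges are exchanged by an element of Klein's group.  For adjacent edges, their other ends are
  transposed, which preserves multiplicities if both edges are good or both are bad; the latter does not
  happen with four vertices.\<close>

lemma exchange_pair:
  assumes F: "f \<in> edges G" "g \<in> edges G" "f \<noteq> g" "forest G {f, g}"
    and good: "good_edge G f \<and> good_edge G g \<or> special G {f, g}"
  shows "exchangeable G {} f g"
proof -
  have sub: "{f, g} \<subseteq> edges G" using F by simp
  have n: "3 \<le> card (verts G)" using card_forest[OF sub F(4)] F(3) by simp
  show ?thesis
  proof (cases "ends G f \<inter> ends G g = {}")
    case True
    obtain p x where px: "ends G f = {p, x}" "p \<noteq> x" "p \<in> verts G" "x \<in> verts G"
      by (rule forest_edge[OF graph sub F(4)]) auto
    obtain q y where qy: "ends G g = {q, y}" "q \<noteq> y" "q \<in> verts G" "y \<in> verts G"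
      by (rule forest_edge[OF graph sub F(4), of g]) auto
    have d: "distinct [p, q, x, y]" using True px qy by auto
    have "{p, q, x, y} \<subseteq> verts G" using px qy by auto
    moreover have "card {p, q, x, y} = 4" using d by simp
    ultimately have "verts G = {p, q, x, y}" using card_verts(2) card_seteq finite_verts by metis
    then show ?thesis using exchange_klein[OF F(1,2) px(1) qy(1) _ d] by blast
  next
    case False
    obtain p x y where p: "ends G f = {p, x}" "ends G g = {p, y}" "p \<noteq> x" "p \<noteq> y" "x \<noteq> y"
      "p \<in> verts G" "x \<in> verts G" "y \<in> verts G"
      by (rule forest_meet[OF graph sub F(4) _ _ F(3) False]) auto
    have gb: "good_edge G f \<and> good_edge G g \<or> \<not> good_edge G f \<and> \<not> good_edge G g"
      using good False F(3) by (simp add: special_pair)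
    show ?thesis
    proof (cases "card (verts G) = 3")
      case True
      have "verts G = {p, x, y}" by (rule third_vertex[OF True]) (use p in auto)
      then show ?thesis using exchange_three[OF F(1,2) p(1,2) _ p(3-5)] gb by blast
    next
      case False
      then have n4: "card (verts G) = 4" using n card_verts(2) by linarith
      then obtain q where q: "verts G = {p, x, y, q}" "distinct [p, x, y, q]"
        by (rule fourth_vertex[of _ p x y]) (use p in auto)
      have V: "verts G = {p, q, x, y}" "distinct [p, q, x, y]" using q by auto
      have n2: "card (verts G) \<noteq> 2" using n4 by simp
      have "edge_mult G p x = edge_mult G p y"
        using gb good_edge_mult[OF n2 F(1) p(1)] good_edge_mult[OF n2 F(2) p(2)] four_vertices(3)[OF V] by linarith
      then show ?thesis using exchange_four[OF F(1,2) p(1,2) V] by blast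
    qed
  qed
qed

text \<open>The tree is a path with middle edge \<open>e\<close>, which is reversed by an element of Klein's group, or the three
  edges share a vertex.  In the latter case, they exhaust its valency, so that all multiplicities are \<open>1\<close>.\<close>

lemma exchange_tree:
  assumes T: "{e, f, g} \<subseteq> edges G" "distinct [e, f, g]" "forest G {e, f, g}"
    and meet: "ends G e \<inter> ends G f \<noteq> {}" "ends G e \<inter> ends G g \<noteq> {}"
  shows "exchangeable G {e} f g"
proof -
  have fg: "e \<in> edges G" "f \<in> edges G" "g \<in> edges G" using T(1) by auto
  have n4: "card (verts G) = 4" using card_forest[OF T(1,3)] T(2) card_verts(2) by simp
  obtain p q x where p: "ends G e = {p, q}" "ends G f = {p, x}" "p \<noteq> q" "p \<noteq> x" "q \<noteq> x"
    "p \<in> verts G" "q \<in> verts G" "x \<in> verts G"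
    by (rule forest_meet[OF graph T(1,3) _ _ _ meet(1)]) (use T(2) in auto)
  obtain y where V: "verts G = {p, q, x, y}" "distinct [p, q, x, y]"
    by (rule fourth_vertex[OF n4 p(6-8)]) (use p in auto)
  obtain a b where ab: "ends G g = {a, b}" "a \<noteq> b" "a \<in> verts G" "b \<in> verts G"
    by (rule forest_edge[OF graph T(1,3), of g]) auto
  have "ends G g \<noteq> {p, q}" "ends G g \<noteq> {p, x}"
    using forest_parallel[OF graph T(1,3), of g e] forest_parallel[OF graph T(1,3), of g f] p T(2) by auto
  moreover have "ends G g \<noteq> {q, x}"
    using forest_triangle[OF T(3) _ _ _ _ _ p(1,2)] T(2) by auto
  moreover have "p \<in> ends G g \<or> q \<in> ends G g" using meet(2) p(1) by auto
  ultimately have "ends G g = {p, y} \<or> ends G g = {q, y}"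
    using ab(2-4) unfolding ab(1) V(1) doubleton_eq_iff by auto
  then show ?thesis
  proof
    assume g: "ends G g = {p, y}"
    have "edge_mult G p q \<ge> 1" "edge_mult G p x \<ge> 1" "edge_mult G p y \<ge> 1"
      using mult_pos[OF graph] fg p g by blast+
    then have "edge_mult G p x = edge_mult G p y" using four_vertices(3)[OF V] by linarith
    then show ?thesis using exchange_four[OF fg(2,3) p(2) g V, of "{e}"] fg p by blast
  next
    assume g: "ends G g = {q, y}"
    show ?thesis using exchange_klein[OF fg(2,3) p(2) g V, of "{e}"] fg p by blast
  qed
qed

text \<open>With three vertices, a good edge joins an end of the bad edge \<open>e\<close> to the third vertex.  With four
  vertices, there is room for just one further edge at each end of \<open>e\<close>, and Klein's group exchanges the two.\<close>

lemma exchange_bad: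
  assumes E: "e \<in> edges G" "f \<in> edges G" "g \<in> edges G" "distinct [e, f, g]"
    and fo: "forest G {e, f}" "forest G {e, g}"
    and bad: "\<not> good_edge G e" "\<not> special G {e, f}" "\<not> special G {e, g}"
  shows "exchangeable G {e} f g"
proof -
  have sub: "{e, f} \<subseteq> edges G" "{e, g} \<subseteq> edges G" using E by auto
  have n2: "card (verts G) \<noteq> 2" using bad(1) by (auto simp: good_edge_def)
  have n: "3 \<le> card (verts G)" using card_forest[OF sub(1) fo(1)] E(4) by simp
  have good: "good_edge G f" "good_edge G g" "ends G e \<inter> ends G f \<noteq> {}" "ends G e \<inter> ends G g \<noteq> {}"
    using bad E(4) by (auto simp: special_pair)
  have par: "ends G f \<noteq> ends G g" "ends G e \<noteq> ends G f" "ends G e \<noteq> ends G g"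
    using good(1,2) n2 E by (auto simp: good_edge_def)
  obtain p q x where p: "ends G e = {p, q}" "ends G f = {p, x}" "p \<noteq> q" "p \<noteq> x" "q \<noteq> x"
    "p \<in> verts G" "q \<in> verts G" "x \<in> verts G"
    by (rule forest_meet[OF graph sub(1) fo(1) _ _ _ good(3)]) (use E(4) in auto)
  obtain a b where ab: "ends G g = {a, b}" "a \<noteq> b" "a \<in> verts G" "b \<in> verts G"
    by (rule forest_edge[OF graph sub(2) fo(2), of g]) auto
  show ?thesis
  proof (cases "card (verts G) = 3")
    case True
    have V: "verts G = {x, p, q}" by (rule third_vertex[OF True]) (use p in auto)
    then have "ends G g = {x, q}"
      using ab(2-4) par(1,3) unfolding ab(1) V(1) p(1,2) doubleton_eq_iff by auto
    moreover have "ends G f = {x, p}" using p by auto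
    ultimately show ?thesis using exchange_three[OF E(2,3) _ _ V, of "{e}"] p good E(1) by auto
  next
    case False
    then have n4: "card (verts G) = 4" using n card_verts(2) by linarith
    obtain y where V: "verts G = {p, q, x, y}" "distinct [p, q, x, y]"
      by (rule fourth_vertex[OF n4 p(6-8)]) (use p in auto)
    have V': "verts G = {p, y, q, x}" "distinct [p, y, q, x]" using V by auto
    have "edge_mult G p q \<ge> 2" "edge_mult G p x = 1"
      using good_edge_mult[OF n2 E(1) p(1)] good_edge_mult[OF n2 E(2) p(2)] bad(1) good(1) by auto
    then have "edge_mult G p y = 0" "edge_mult G q x = 0"
      using four_vertices(3)[OF V] four_vertices(2)[OF V'] by linarith+
    then have "ends G g \<noteq> {p, y}" "ends G g \<noteq> {q, x}" using mult_pos[OF graph E(3)] by fastforce+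
    moreover have "p \<in> ends G g \<or> q \<in> ends G g" using good(4) p(1) by auto
    ultimately have "ends G g = {q, y}"
      using ab(2-4) par(1,3) unfolding ab(1) V(1) p(1,2) doubleton_eq_iff by auto
    then show ?thesis using exchange_klein[OF E(2,3) p(2) _ V, of "{e}"] E(1) p(1) by blast
  qed
qed

text \<open>With four vertices, the three multiplicities at a vertex add up to \<open>3\<close> and are at most \<open>2\<close>, so one of them
  is \<open>1\<close>.\<close>

lemma good_edge_exists:
  assumes "2 \<le> card (verts G)"
  shows "\<exists>e\<in>edges G. good_edge G e \<and> forest G {e}"
proof -
  have mult: "\<exists>e\<in>edges G. ends G e = {u, w}" if "edge_mult G u w \<noteq> 0" for u w
  proof -
    have "{e \<in> edges G. ends G e = {u, w}} \<noteq> {}" using that unfolding edge_mult_def by (metis card.empty)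
    then show ?thesis by blast
  qed
  consider "card (verts G) = 2" | "card (verts G) = 3" | "card (verts G) = 4"
    using assms card_verts(2) by linarith
  then show ?thesis
  proof cases
    case 1
    then obtain u w where uw: "verts G = {u, w}" "u \<noteq> w" by (auto simp: card_2_iff)
    have "verts G - {u} = {w}" using uw by auto
    then have "edge_mult G u w \<noteq> 0" using cut_mult[OF stable, of "{u}"] uw by auto
    then obtain e where e: "e \<in> edges G" "ends G e = {u, w}" using mult by blast
    then have "forest G {e}" "good_edge G e" using uw(2) 1 forest_single_iff[OF e(2)] by (auto simp: good_edge_def)
    then show ?thesis using e(1) by blast
  next
    case 2
    then obtain p x y where V: "verts G = {p, x, y}" "p \<noteq> x" "p \<noteq> y" "x \<noteq> y"
      by (auto simp: card_3_iff)
    obtain u w where uw: "edge_mult G u w = 1" "u \<noteq> w" using three_vertices(1)[OF V] V by blast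
    then obtain e where e: "e \<in> edges G" "ends G e = {u, w}" using mult[of u w] by auto
    then have "forest G {e}" "good_edge G e"
      using uw 2 forest_single_iff[OF e(2)] good_edge_mult(1)[OF _ e] by auto
    then show ?thesis using e(1) by blast
  next
    case 3
    obtain p where p: "p \<in> verts G" using graph by (auto simp: graph_def)
    have "card (verts G - {p}) = 3" using 3 p finite_verts by simp
    then obtain q x y where qxy: "verts G - {p} = {q, x, y}" "q \<noteq> x" "q \<noteq> y" "x \<noteq> y"
      by (auto simp: card_3_iff)
    have V: "verts G = {p, q, x, y}" using qxy(1) p by blast
    have "p \<notin> {q, x, y}" using qxy(1) by blast
    then have D: "distinct [p, q, x, y]" using qxy by auto
    have V': "verts G = {p, x, q, y}" "distinct [p, x, q, y]" "verts G = {p, y, q, x}" "distinct [p, y, q, x]"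
      using V D by auto
    have "edge_mult G p q = 1 \<or> edge_mult G p x = 1 \<or> edge_mult G p y = 1"
      using four_vertices(3,4)[OF V D] four_vertices(4)[OF V'(1,2)] four_vertices(4)[OF V'(3,4)] by linarith
    then obtain w where uw: "edge_mult G p w = 1" "p \<noteq> w" using D by auto
    then obtain e where e: "e \<in> edges G" "ends G e = {p, w}" using mult[of p w] by auto
    then have "forest G {e}" "good_edge G e"
      using uw 3 forest_single_iff[OF e(2)] good_edge_mult(1)[OF _ e] by auto
    then show ?thesis using e(1) by blast
  qed
qed

text \<open>In a graph with four vertices, one of two adjacent edges is good, as there are only three edges at
  their common vertex.\<close>

lemma adjacent_not_special:
  assumes "card (verts G) = 4" "F \<subseteq> edges G" "forest G F" "e \<in> F" "f \<in> F" "e \<noteq> f" "ends G e \<inter> ends G f \<noteq> {}"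
  shows "\<not> special G {e, f}"
proof -
  obtain p q x where p: "ends G e = {p, q}" "ends G f = {p, x}" "p \<noteq> q" "p \<noteq> x" "q \<noteq> x"
    "p \<in> verts G" "q \<in> verts G" "x \<in> verts G"
    by (rule forest_meet[OF graph assms(2-7)])
  obtain y where V: "verts G = {p, q, x, y}" "distinct [p, q, x, y]"
    by (rule fourth_vertex[OF assms(1) p(6-8)]) (use p in auto)
  have n2: "card (verts G) \<noteq> 2" using assms(1) by simp
  have E: "e \<in> edges G" "f \<in> edges G" using assms by auto
  have "good_edge G e \<or> good_edge G f"
    using good_edge_mult[OF n2 E(1) p(1)] good_edge_mult[OF n2 E(2) p(2)] four_vertices(3)[OF V] by linarith
  then show ?thesis using assms(6,7) by (simp add: special_pair)
qed

text \<open>With three vertices, any good edge is adjacent to \<open>e\<close>.  With four vertices, \<open>e\<close> is one of two parallel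
  edges, and the third edge at either of its ends is good.\<close>

lemma normal_neighbour_exists:
  assumes e: "e \<in> edges G" "forest G {e}" "\<not> good_edge G e"
  shows "\<exists>f\<in>edges G. f \<noteq> e \<and> forest G {e, f} \<and> \<not> special G {e, f}"
proof -
  have n2: "card (verts G) \<noteq> 2" using e(3) by (auto simp: good_edge_def)
  have n: "2 \<le> card (verts G)" using card_forest[of "{e}"] e by simp
  obtain p q where p: "ends G e = {p, q}" "p \<noteq> q" "p \<in> verts G" "q \<in> verts G"
    by (rule forest_edge[OF graph _ e(2), of e]) (use e in auto)
  have "\<exists>f\<in>edges G. good_edge G f \<and> forest G {f} \<and> ends G e \<inter> ends G f \<noteq> {}"
  proof (cases "card (verts G) = 3")
    case True
    obtain f where f: "f \<in> edges G" "good_edge G f" "forest G {f}" using good_edge_exists[OF n] by blast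
    obtain a b where ab: "ends G f = {a, b}" "a \<noteq> b" "a \<in> verts G" "b \<in> verts G"
      by (rule forest_edge[OF graph _ f(3), of f]) (use f in auto)
    have "card ({p, q} \<union> {a, b}) \<le> 3"
      using True p ab finite_verts card_mono[of "verts G" "{p, q} \<union> {a, b}"] by auto
    moreover have "card ({p, q} \<union> {a, b}) = card {p, q} + card {a, b}" if "{p, q} \<inter> {a, b} = {}"
      by (rule card_Un_disjoint) (use that in simp_all)
    moreover have "card {p, q} + card {a, b} = 4" using p(2) ab(2) by simp
    ultimately have "{p, q} \<inter> {a, b} \<noteq> {}" by linarith
    then show ?thesis using f p(1) ab(1) by auto
  next
    case False
    then have n4: "card (verts G) = 4" using n n2 card_verts(2) by linarith
    have "card (verts G - {p, q}) = 2" using n4 p finite_verts by (simp add: card_Diff_subset)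
    then obtain x y where xy: "verts G - {p, q} = {x, y}" "x \<noteq> y" by (auto simp: card_2_iff)
    have V: "verts G = {p, q, x, y}" using xy(1) p by blast
    have "x \<notin> {p, q}" "y \<notin> {p, q}" using xy(1) by blast+
    then have D: "distinct [p, q, x, y]" using xy p by auto
    have "edge_mult G p q \<ge> 2" using good_edge_mult[OF n2 e(1) p(1)] e(3) by simp
    then have "edge_mult G p x = 1 \<or> edge_mult G p y = 1" using four_vertices(3,4)[OF V D] by linarith
    then obtain w where w: "edge_mult G p w = 1" "w \<noteq> p" using D by auto
    then have "{e \<in> edges G. ends G e = {p, w}} \<noteq> {}" unfolding edge_mult_def by (metis card.empty zero_neq_one)
    then obtain f where f: "f \<in> edges G" "ends G f = {p, w}" by blast
    then have "good_edge G f" "forest G {f}" using good_edge_mult(1)[OF n2 f] w forest_single_iff[OF f(2)] by auto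
    then show ?thesis using f p(1) by auto
  qed
  then obtain f where f: "f \<in> edges G" "good_edge G f" "forest G {f}" "ends G e \<inter> ends G f \<noteq> {}" by blast
  have "f \<noteq> e" using f(2) e(3) by auto
  moreover have "ends G e \<noteq> ends G f" using f(2) n2 e(1) \<open>f \<noteq> e\<close> by (auto simp: good_edge_def)
  then have "forest G {e, f}" using forest_pair_iff[OF graph e(1) f(1)] e f \<open>f \<noteq> e\<close> by simp
  moreover have "\<not> special G {e, f}" using f \<open>f \<noteq> e\<close> by (simp add: special_pair)
  ultimately show ?thesis using f(1) by blast
qed

text \<open>Otherwise, \<open>f\<close> and \<open>g\<close> would be parallel, as only two vertices are left for their ends.\<close>

lemma tree_neighbour_exists:
  assumes T: "{e, f, g} \<subseteq> edges G" "distinct [e, f, g]" "forest G {e, f, g}"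
  shows "ends G e \<inter> ends G f \<noteq> {} \<or> ends G e \<inter> ends G g \<noteq> {}"
proof (rule ccontr)
  assume no: "\<not> ?thesis"
  have n4: "card (verts G) = 4" using card_forest[OF T(1,3)] T(2) card_verts(2) by simp
  obtain p q where p: "ends G e = {p, q}" "p \<noteq> q" "p \<in> verts G" "q \<in> verts G"
    by (rule forest_edge[OF graph T(1,3), of e]) auto
  obtain a b where ab: "ends G f = {a, b}" "a \<noteq> b" "a \<in> verts G" "b \<in> verts G"
    by (rule forest_edge[OF graph T(1,3), of f]) auto
  obtain c d where cd: "ends G g = {c, d}" "c \<noteq> d" "c \<in> verts G" "d \<in> verts G"
    by (rule forest_edge[OF graph T(1,3), of g]) auto
  have "card (verts G - {p, q}) = 2" using n4 p finite_verts by (simp add: card_Diff_subset)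
  then obtain x y where xy: "verts G - {p, q} = {x, y}" "x \<noteq> y" by (auto simp: card_2_iff)
  have "a \<in> {x, y}" "b \<in> {x, y}" "c \<in> {x, y}" "d \<in> {x, y}"
    using no p(1) ab cd unfolding xy(1)[symmetric] by auto
  then have "ends G f = ends G g" using ab cd by auto
  then show False using forest_parallel[OF graph T(1,3), of f g] T(2) by auto
qed

end

section \<open>A criterion for collapsibility\<close>

text \<open>A matching of facets with simplices is acyclic if some rank is constant on the pairs and increases
  strictly along all other facets.  The pairs can then be removed in decreasing order of rank: a simplex
  above the facet of a pair of maximal rank would have to have the same rank.\<close>

lemma collapsible_matching:
  fixes r :: "nat \<times> 'a \<Rightarrow> nat"
  assumes fin: "finite (simplices K)" and v: "v \<in> cells K 0"
    and min: "\<And>s. s \<in> simplices K \<Longrightarrow> s \<noteq> (0, v) \<Longrightarrow> r (0, v) < r s"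
    and mono: "\<And>a b. (a, b) \<in> facet_rel K \<Longrightarrow> r a < r b \<or> r a = r b \<and> M a b"
    and M: "\<And>a b. M a b \<Longrightarrow> a \<in> simplices K \<and> b \<in> simplices K \<and> (a, b) \<in> facet_rel K \<and> r a = r b"
    and low: "\<And>a b c. M a b \<Longrightarrow> \<not> M b c"
    and right_unique: "\<And>a b b'. M a b \<Longrightarrow> M a b' \<Longrightarrow> b = b'"
    and left_unique: "\<And>a a' b. M a b \<Longrightarrow> M a' b \<Longrightarrow> a = a'"
    and total: "\<And>s. s \<in> simplices K \<Longrightarrow> s \<noteq> (0, v) \<Longrightarrow> \<exists>t. M s t \<or> M t s"
  shows "collapsible K"
proof -
  have rank: "r x \<le> r y" if "(x, y) \<in> (facet_rel K)\<^sup>*" for x y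
    using that by (induction rule: rtrancl_induct) (use mono in \<open>auto intro: order_trans dest: mono\<close>)
  have "(elementary_collapse K)\<^sup>*\<^sup>* T {(0, v)}"
    if "finite T" "T \<subseteq> simplices K" "(0, v) \<in> T" "\<forall>s\<in>T. \<forall>t. M s t \<or> M t s \<longrightarrow> t \<in> T" for T
    using that
  proof (induction "card T" arbitrary: T rule: less_induct)
    case less
    show ?case
    proof (cases "T = {(0, v)}")
      case False
      then have "T - {(0, v)} \<noteq> {}" using less.prems(3) by blast
      then have "Max (r ` (T - {(0, v)})) \<in> r ` (T - {(0, v)})" using less.prems(1) by (intro Max_in) auto
      then obtain s where "s \<in> T - {(0, v)}" "Max (r ` (T - {(0, v)})) = r s" by (rule imageE)
      then have s: "s \<in> T" "s \<noteq> (0, v)" "r s = Max (r ` (T - {(0, v)}))" by simp_all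
      have sv: "r (0, v) < r s" using min s(1,2) less.prems(2) by blast
      have max: "r t \<le> r s" if "t \<in> T" for t
        using that sv less.prems(1) by (cases "t = (0, v)") (auto simp: s(3))
      obtain t where t: "M s t \<or> M t s" using total s less.prems(2) by blast
      then obtain a b where ab: "M a b" "{a, b} = {s, t}" by (metis insert_commute)
      have "t \<in> T" using t s(1) less.prems(4) by blast
      then have abT: "a \<in> T" "b \<in> T" using ab(2) s(1) by (auto simp: doubleton_eq_iff)
      have rab: "r a = r s" "r b = r s" using M[OF ab(1)] ab(2) by (auto simp: doubleton_eq_iff)
      have "a \<noteq> b" using low[OF ab(1), of b] ab(1) by metis
      have free: "\<rho> = b" if \<rho>: "\<rho> \<in> T" "(a, \<rho>) \<in> (facet_rel K)\<^sup>+" for \<rho>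
      proof -
        obtain c where c: "(a, c) \<in> facet_rel K" "(c, \<rho>) \<in> (facet_rel K)\<^sup>*" using tranclD[OF \<rho>(2)] by blast
        have "r c \<le> r a" using rank[OF c(2)] max[OF \<rho>(1)] rab by simp
        then have "M a c" using mono[OF c(1)] by auto
        then have cb: "c = b" using right_unique ab(1) by blast
        from c(2) show ?thesis
        proof (cases rule: converse_rtranclE)
          case (step d)
          have "r d \<le> r b" using rank[OF step(2)] max[OF \<rho>(1)] rab by simp
          then have "M b d" using mono[OF step(1)] cb by auto
          then show ?thesis using low[OF ab(1)] by blast
        qed (use cb in simp)
      qed
      let ?T = "T - {b, a}"
      have "elementary_collapse K T ?T"
        unfolding elementary_collapse_def
        by (intro bexI[of _ b] bexI[of _ a] conjI ballI impI refl) (use M[OF ab(1)] free abT in auto)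
      moreover have "(elementary_collapse K)\<^sup>*\<^sup>* ?T {(0, v)}"
      proof (rule less.hyps)
        show "card ?T < card T" using abT less.prems(1) by (intro psubset_card_mono) auto
        show "(0, v) \<in> ?T" using less.prems(3) sv rab by auto
        show "\<forall>s\<in>?T. \<forall>t. M s t \<or> M t s \<longrightarrow> t \<in> ?T"
        proof (intro ballI allI impI)
          fix s' t' assume st: "s' \<in> ?T" "M s' t' \<or> M t' s'"
          then have "t' \<in> T" using less.prems(4) by blast
          moreover have "t' \<noteq> a" using st low[of s' a b] right_unique[of a b s'] ab(1) by auto
          moreover have "t' \<noteq> b" using st low[of a b s'] left_unique[of a b s'] ab(1) by auto
          ultimately show "t' \<in> ?T" by simp
        qed
      qed (use less.prems in auto)
      ultimately show ?thesis by (rule converse_rtranclp_into_rtranclp)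
    qed simp
  qed
  from this[OF fin] have "(elementary_collapse K)\<^sup>*\<^sup>* (simplices K) {(0, v)}"
    using v M by (auto simp: simplices_def)
  then show ?thesis using v by (auto simp: collapsible_def)
qed

section \<open>Chains of forests\<close>

text \<open>In a filtration by forests, the last block is determined by the others.\<close>

definition chain :: "('v, 'e) mgraph \<Rightarrow> 'e set list \<Rightarrow> bool" where
  "chain G ps \<longleftrightarrow> {} \<notin> set ps \<and> \<Union> (set ps) \<subseteq> edges G \<and> sorted_wrt (\<lambda>A B. A \<inter> B = {}) ps \<and> forest G (\<Union> (set ps))"

definition complete_chain :: "('v, 'e) mgraph \<Rightarrow> 'e set list \<Rightarrow> 'e set list" where
  "complete_chain G ps = ps @ [edges G - \<Union> (set ps)]"

definition merge :: "nat \<Rightarrow> 'e set list \<Rightarrow> 'e set list" where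
  "merge i ps = (if i = length ps then butlast ps else merge_blocks i ps)"

lemma butlast_complete [simp]: "butlast (complete_chain G ps) = ps"
  by (simp add: complete_chain_def)

lemma (in genus_three) simplex_graph_complete:
  assumes "chain G ps"
  shows "simplex_graph 3 (length ps) (G, complete_chain G ps)"
proof -
  have ps: "\<Union> (set ps) \<subseteq> edges G" "forest G (\<Union> (set ps))" using assms by (auto simp: chain_def)
  have "edges G - \<Union> (set ps) \<noteq> {}"
  proof
    assume "edges G - \<Union> (set ps) = {}"
    then have "\<Union> (set ps) = edges G" using ps(1) by blast
    then show False using card_forest[OF ps] card_edges by simp
  qed
  then show ?thesis using assms stable genus ps(1)
    by (auto simp: simplex_graph_iff chain_def complete_chain_def sorted_wrt_append)
qed

lemma simplex_graph_chain:
  assumes "simplex_graph 3 m (G, \<pi>)"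
  shows "genus_three G" "chain G (butlast \<pi>)" "\<pi> = complete_chain G (butlast \<pi>)" "length (butlast \<pi>) = m"
proof -
  have "\<pi> \<noteq> []" using assms by (auto simp: simplex_graph_iff)
  then obtain ps L where p: "\<pi> = ps @ [L]" by (metis append_butlast_last_id)
  show "genus_three G" using assms by (simp add: simplex_graph_iff genus_three_def)
  show "chain G (butlast \<pi>)" using assms by (auto simp: simplex_graph_iff p chain_def sorted_wrt_append)
  have "L \<inter> \<Union> (set ps) = {}" "edges G = \<Union> (set ps) \<union> L"
    using assms by (auto simp: simplex_graph_iff p sorted_wrt_append)
  then have "L = edges G - \<Union> (set ps)" by blast
  then show "\<pi> = complete_chain G (butlast \<pi>)" by (simp add: p complete_chain_def)
  show "length (butlast \<pi>) = m" using assms by (simp add: simplex_graph_iff)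
qed

lemma merge_complete:
  assumes "chain G ps" "0 < i" "i \<le> length ps"
  shows "merge_blocks i (complete_chain G ps) = complete_chain G (merge i ps)"
proof (cases "i = length ps")
  case True
  then have "ps \<noteq> []" using assms(2) by auto
  then obtain xs A where p: "ps = xs @ [A]" by (metis append_butlast_last_id)
  have "A \<union> (edges G - \<Union> (set ps)) = edges G - \<Union> (set xs)"
    using assms(1) by (auto simp: chain_def p sorted_wrt_append)
  then show ?thesis
    using merge_blocks_append[of xs A "edges G - \<Union> (set ps)" "[]"] True by (simp add: complete_chain_def merge_def p)
next
  case False
  then have "i < length ps" using assms(3) by simp
  with assms(2) obtain xs A B ys where p: "ps = xs @ A # B # ys" "i = Suc (length xs)" by (rule split_at_block)
  have "merge i ps = xs @ (A \<union> B) # ys" using False by (simp add: merge_def p merge_blocks_append)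
  then show ?thesis
    using merge_blocks_append[of xs A B "ys @ [edges G - \<Union> (set ps)]"] p by (simp add: complete_chain_def Un_assoc)
qed

lemma chain_shape:
  assumes "genus_three G" "chain G ps"
  obtains "ps = []"
    | e where "ps = [{e}]"
    | e f where "e \<noteq> f" "ps = [{e, f}]"
    | e f g where "distinct [e, f, g]" "ps = [{e, f, g}]"
    | e f where "e \<noteq> f" "ps = [{e}, {f}]"
    | e f g where "distinct [e, f, g]" "ps = [{e}, {f, g}]"
    | e f g where "distinct [e, f, g]" "ps = [{e, f}, {g}]"
    | e f g where "distinct [e, f, g]" "ps = [{e}, {f}, {g}]"
proof -
  have ps: "{} \<notin> set ps" "\<Union> (set ps) \<subseteq> edges G" "sorted_wrt (\<lambda>A B. A \<inter> B = {}) ps" "forest G (\<Union> (set ps))"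
    using assms(2) by (auto simp: chain_def)
  have fin: "finite (\<Union> (set ps))"
    using genus_three.graph[OF assms(1)] finite_subset[OF ps(2)] by (simp add: graph_def)
  have c3: "card (\<Union> (set ps)) \<le> 3"
    using genus_three.card_forest[OF assms(1) ps(2,4)] genus_three.card_verts(2)[OF assms(1)] by simp
  have one: "\<exists>e. A = {e}" if "card A = 1" for A :: "'b set" using that by (simp add: card_1_singleton_iff)
  have two: "\<exists>e f. A = {e, f} \<and> e \<noteq> f" if "card A = 2" for A :: "'b set" using that by (simp add: card_2_iff)
  have three: "\<exists>e f g. A = {e, f, g} \<and> distinct [e, f, g]" if "card A = 3" for A :: "'b set"
    using that by (auto simp: card_3_iff)
  have pos: "card A \<ge> 1" if "A \<in> set ps" for A
  proof -
    have "finite A" using that fin by (meson Union_upper finite_subset)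
    moreover have "A \<noteq> {}" using that ps(1) by blast
    ultimately show ?thesis by (simp add: Suc_le_eq card_gt_0_iff)
  qed
  have sum: "card (\<Union> (set qs)) = sum_list (map card qs)"
    if "finite (\<Union> (set qs))" "sorted_wrt (\<lambda>A B. A \<inter> B = {}) qs" for qs :: "'b set list"
    using that
  proof (induction qs)
    case (Cons A qs)
    then have "card (A \<union> \<Union> (set qs)) = card A + card (\<Union> (set qs))"
      by (intro card_Un_disjoint) auto
    then show ?case using Cons by simp
  qed simp
  have s3: "sum_list (map card ps) \<le> 3" using sum[OF fin ps(3)] c3 by simp
  show thesis
  proof (cases ps)
    case Nil
    then show ?thesis by (rule that(1))
  next
    case A: (Cons A ps1)
    show ?thesis
    proof (cases ps1)
      case Nil
      then consider "card A = 1" | "card A = 2" | "card A = 3" using A s3 pos[of A] by fastforce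
      then show ?thesis
      proof cases
        case 1
        then obtain e where "A = {e}" using one by blast
        then show ?thesis using that(2)[of e] A Nil by simp
      next
        case 2
        then obtain e f where "A = {e, f}" "e \<noteq> f" using two by blast
        then show ?thesis using that(3)[of e f] A Nil by simp
      next
        case 3
        then obtain e f g where "A = {e, f, g}" "distinct [e, f, g]" using three by blast
        then show ?thesis using that(4)[of e f g] A Nil by simp
      qed
    next
      case B: (Cons B ps2)
      show ?thesis
      proof (cases ps2)
        case Nil
        have dis: "A \<inter> B = {}" using ps(3) by (simp add: A B)
        have "card A \<ge> 1" "card B \<ge> 1" "card A + card B \<le> 3" using pos[of A] pos[of B] s3 by (simp_all add: A B Nil)
        then consider "card A = 1" "card B = 1" | "card A = 1" "card B = 2" | "card A = 2" "card B = 1" by linarith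
        then show ?thesis
        proof cases
          case 1
          obtain e where e: "A = {e}" using one[OF 1(1)] by blast
          obtain f where f: "B = {f}" using one[OF 1(2)] by blast
          have "e \<noteq> f" using dis e f by auto
          then show ?thesis using that(5)[of e f] A B Nil e f by simp
        next
          case 2
          obtain e where e: "A = {e}" using one[OF 2(1)] by blast
          obtain f g where f: "B = {f, g}" "f \<noteq> g" using two[OF 2(2)] by blast
          have "distinct [e, f, g]" using dis e f by auto
          then show ?thesis using that(6)[of e f g] A B Nil e f by simp
        next
          case 3
          obtain e f where e: "A = {e, f}" "e \<noteq> f" using two[OF 3(1)] by blast
          obtain g where g: "B = {g}" using one[OF 3(2)] by blast
          have "distinct [e, f, g]" using dis e g by auto
          then show ?thesis using that(7)[of e f g] A B Nil e g by simp
        qed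
      next
        case C: (Cons C ps3)
        have "card A \<ge> 1" "card B \<ge> 1" "card C \<ge> 1" "card A + card B + card C + sum_list (map card ps3) \<le> 3"
          using pos[of A] pos[of B] pos[of C] s3 by (simp_all add: A B C add.assoc)
        moreover have "ps3 = []"
        proof (cases ps3)
          case (Cons D qs)
          then have "card D \<ge> 1" using pos by (simp add: A B C)
          then show ?thesis using calculation Cons by simp
        qed simp
        ultimately have "card A = 1" "card B = 1" "card C = 1" by simp_all
        then obtain e f g where efg: "A = {e}" "B = {f}" "C = {g}" by (elim card_1_singletonE)
        have "distinct [e, f, g]" using ps(3) by (auto simp: A B C efg)
        then show ?thesis using that(8)[of e f g] A B C \<open>ps3 = []\<close> efg by simp
      qed
    qed
  qed
qed

section \<open>The matching\<close>

text \<open>The blocks of the smaller chain are on the left.  The rules toggle a good edge in the empty chain, and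
  otherwise the first edge of a pair, with two kinds of exceptions.  A bad edge cannot be matched with the
  empty chain and is extended to a pair instead.  If the chain has a tree with three edges but no special
  pair, then a pair that is not special is inserted below the tree: such pairs always exist, and are
  permuted by the automorphisms of \<open>G\<close> that preserve the tree and the edge below the pair.\<close>

inductive partner :: "('v, 'e) mgraph \<Rightarrow> 'e set list \<Rightarrow> 'e set list \<Rightarrow> bool" for G where
  empty: "good_edge G e \<Longrightarrow> partner G [] [{e}]"
| pair: "e \<noteq> f \<Longrightarrow> special G {e, f} \<or> good_edge G e \<Longrightarrow> partner G [{e, f}] [{e}, {f}]"
| bad: "e \<noteq> f \<Longrightarrow> \<not> good_edge G e \<Longrightarrow> \<not> special G {e, f} \<Longrightarrow> partner G [{e}] [{e}, {f}]"
| tree: "distinct [e, f, g] \<Longrightarrow> \<not> special G {e, f} \<Longrightarrow> partner G [{e, f, g}] [{e, f}, {g}]"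
| edge_tree: "distinct [e, f, g] \<Longrightarrow> \<not> special G {e, f} \<Longrightarrow> partner G [{e}, {f, g}] [{e}, {f}, {g}]"
| pair_tree: "distinct [e, f, g] \<Longrightarrow> special G {e, f} \<Longrightarrow> partner G [{e, f}, {g}] [{e}, {f}, {g}]"

text \<open>The values are chosen such that partners have the same rank and all other ways to omit a forest decrease
  it.  They grow with the dimension of the smaller partner, and, in the same dimension, are larger for trees
  and for special pairs than for bad edges and for other pairs.\<close>

fun chain_rank :: "('v, 'e) mgraph \<Rightarrow> 'e set list \<Rightarrow> nat" where
  "chain_rank G [] = 0"
| "chain_rank G [A] =
     (if card A = 1 then (if \<forall>e\<in>A. good_edge G e then 0 else 2)
      else if card A = 2 then (if special G A then 3 else 1) else 4)"
| "chain_rank G [A, B] =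
     (if card A = 2 then (if special G A then 6 else 4)
      else if card B = 2 then 5
      else if special G (A \<union> B) then 3 else if \<forall>e\<in>A. good_edge G e then 1 else 2)"
| "chain_rank G (A # B # C # ps) = (if special G (A \<union> B) then 6 else 5)"

lemma chain_rank_le: "chain_rank G ps \<le> 6"
  by (cases "(G, ps)" rule: chain_rank.cases) auto

lemma partner_rank: "partner G qs ps \<Longrightarrow> chain_rank G qs = chain_rank G ps"
  by (erule partner.cases) (auto simp: insert_commute)

lemma partner_merge:
  assumes "partner G qs ps"
  shows "\<exists>i. 0 < i \<and> i \<le> length ps \<and> qs = merge i ps"
  using assms
proof (cases rule: partner.cases)
  case (empty e)
  then show ?thesis by (auto intro!: exI[of _ 1] simp: merge_def)
next
  case (pair e f)
  then show ?thesis by (auto intro!: exI[of _ 1] simp: merge_def merge_blocks_def)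
next
  case (bad e f)
  then show ?thesis by (auto intro!: exI[of _ 2] simp: merge_def)
next
  case (tree e f g)
  then show ?thesis by (auto intro!: exI[of _ 1] simp: merge_def merge_blocks_def)
next
  case (edge_tree e f g)
  then show ?thesis by (auto intro!: exI[of _ 2] simp: merge_def merge_blocks_def)
next
  case (pair_tree e f g)
  then show ?thesis by (auto intro!: exI[of _ 1] simp: merge_def merge_blocks_def)
qed

text \<open>This makes the matching acyclic among the simplices of one graph.  It is a matter of inspecting the shapes of
  chains, since the ranks were chosen for it.\<close>

lemma merge_rank:
  assumes "genus_three G" "chain G ps" "0 < i" "i \<le> length ps"
  shows "chain_rank G (merge i ps) < chain_rank G ps \<or> partner G (merge i ps) ps"
proof -
  have i: "i = 1 \<or> i = 2 \<or> i = 3" if "length ps \<le> 3" using that assms(3,4) by auto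
  show ?thesis
    using assms(1,2)
  proof (cases rule: chain_shape)
    case 1
    then show ?thesis using assms by simp
  next
    case (2 e)
    then have "i = 1" using assms by simp
    then show ?thesis using 2 partner.empty[of G e] by (auto simp: merge_def)
  next
    case (3 e f)
    then have "i = 1" using assms by simp
    then show ?thesis using 3 by (auto simp: merge_def)
  next
    case (4 e f g)
    then have "i = 1" using assms by simp
    then show ?thesis using 4 by (auto simp: merge_def)
  next
    case (5 e f)
    then have "i = 1 \<or> i = 2" using assms by auto
    then show ?thesis using 5 partner.pair[of e f G] partner.bad[of e f G]
      by (auto simp: merge_def merge_blocks_def insert_commute)
  next
    case (6 e f g)
    then have "i = 1 \<or> i = 2" using assms by auto
    then show ?thesis using 6 by (auto simp: merge_def merge_blocks_def)
  next
    case (7 e f g)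
    then have "i = 1 \<or> i = 2" using assms by auto
    then show ?thesis using 7 partner.tree[of e f g G]
      by (auto simp: merge_def merge_blocks_def insert_commute)
  next
    case (8 e f g)
    then have "i = 1 \<or> i = 2 \<or> i = 3" using assms by auto
    then show ?thesis using 8 partner.edge_tree[of e f g G] partner.pair_tree[of e f g G]
      by (auto simp: merge_def merge_blocks_def insert_commute)
  qed
qed

lemma partner_left_unique: "partner G qs ps \<Longrightarrow> partner G qs' ps \<Longrightarrow> qs = qs'"
  by (erule partner.cases; erule partner.cases) (auto simp: doubleton_eq_iff)

lemma partner_not_both: "partner G qs ps \<Longrightarrow> \<not> partner G ps rs"
  by (rule notI, erule partner.cases; erule partner.cases) (auto simp: doubleton_eq_iff insert_commute)

lemma chain_cong_Union:
  assumes "chain G ps" "\<Union> (set qs) = \<Union> (set ps)" "{} \<notin> set qs" "sorted_wrt (\<lambda>A B. A \<inter> B = {}) qs"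
  shows "chain G qs"
  using assms unfolding chain_def by simp

text \<open>In each shape, either the chain itself is the larger partner in one of the rules, or the forest to be
  inserted is provided by one of the existence lemmas above.\<close>

lemma partner_exists:
  assumes G: "genus_three G" and n: "2 \<le> card (verts G)" and ps: "chain G ps"
  shows "\<exists>qs. chain G qs \<and> (partner G ps qs \<or> partner G qs ps)"
proof -
  interpret genus_three G by (rule G)
  have sub: "\<Union> (set ps) \<subseteq> edges G" "forest G (\<Union> (set ps))" using ps by (auto simp: chain_def)
  show ?thesis
    using G ps
  proof (cases rule: chain_shape)
    case 1
    obtain e where "e \<in> edges G" "good_edge G e" "forest G {e}" using good_edge_exists[OF n] by blast
    then have "chain G [{e}]" "partner G ps [{e}]" using partner.empty 1 by (auto simp: chain_def)
    then show ?thesis by blast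
  next
    case (2 e)
    show ?thesis
    proof (cases "good_edge G e")
      case True
      then have "chain G []" "partner G [] ps" using partner.empty 2 by (auto simp: chain_def forest_empty)
      then show ?thesis by blast
    next
      case False
      obtain f where f: "f \<in> edges G" "f \<noteq> e" "forest G {e, f}" "\<not> special G {e, f}"
        using normal_neighbour_exists[OF _ _ False] sub 2 by auto
      then have "chain G [{e}, {f}]" using sub 2 by (auto simp: chain_def insert_commute)
      moreover have "partner G ps [{e}, {f}]" using partner.bad[OF _ False f(4)] f(2) 2 by auto
      ultimately show ?thesis by blast
    qed
  next
    case (3 e f)
    then have c: "chain G [{e}, {f}]" "chain G [{f}, {e}]"
      using ps by (auto intro: chain_cong_Union[of G ps])
    have "special G {e, f} \<or> good_edge G e \<or> good_edge G f" using 3(1) by (auto simp: special_pair)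
    then have "partner G ps [{e}, {f}] \<or> partner G ps [{f}, {e}]"
      using partner.pair[of e f G] partner.pair[of f e G] 3 by (auto simp: insert_commute)
    then show ?thesis using c by blast
  next
    case (4 e f g)
    have c: "chain G [{e, f}, {g}]" "chain G [{e, g}, {f}]"
      by (rule chain_cong_Union[OF ps]; use 4 in auto)+
    have "\<Union> (set ps) = {e, f, g}" using 4(2) by auto
    then have T: "{e, f, g} \<subseteq> edges G" "forest G {e, f, g}" using sub by simp_all
    have n4: "card (verts G) = 4" using card_forest[OF T] card_verts(2) 4(1) by simp
    have "\<not> special G {e, f} \<or> \<not> special G {e, g}"
      using tree_neighbour_exists[OF T(1) 4(1) T(2)] adjacent_not_special[OF n4 T] 4(1) by auto
    moreover have "distinct [e, g, f]" "{e, g, f} = {e, f, g}" using 4(1) by auto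
    ultimately have "partner G ps [{e, f}, {g}] \<or> partner G ps [{e, g}, {f}]"
      using partner.tree[of e f g G] partner.tree[of e g f G] 4 by metis
    then show ?thesis using c by blast
  next
    case (5 e f)
    have F: "forest G {e, f}" using sub(2) 5(2) by (simp add: insert_commute)
    then have "forest G {e}" using forest_subset[of G "{e, f}" "{e}"] by simp
    then have c: "chain G [{e}]" "chain G [{e, f}]"
      using F sub(1) 5(2) by (simp_all add: chain_def)
    have "partner G [{e, f}] ps \<or> partner G [{e}] ps"
      using partner.pair[of e f G] partner.bad[of e f G] 5 by blast
    then show ?thesis using c by blast
  next
    case (6 e f g)
    have c: "chain G [{e}, {f}, {g}]" "chain G [{e}, {g}, {f}]"
      by (rule chain_cong_Union[OF ps]; use 6 in auto)+
    have "\<Union> (set ps) = {e, f, g}" using 6(2) by auto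
    then have T: "{e, f, g} \<subseteq> edges G" "forest G {e, f, g}" using sub by simp_all
    have n4: "card (verts G) = 4" using card_forest[OF T] card_verts(2) 6(1) by simp
    have "\<not> special G {e, f} \<or> \<not> special G {e, g}"
      using tree_neighbour_exists[OF T(1) 6(1) T(2)] adjacent_not_special[OF n4 T] 6(1) by auto
    moreover have "distinct [e, g, f]" "{g, f} = {f, g}" using 6(1) by auto
    ultimately have "partner G ps [{e}, {f}, {g}] \<or> partner G ps [{e}, {g}, {f}]"
      using partner.edge_tree[of e f g G] partner.edge_tree[of e g f G] 6 by metis
    then show ?thesis using c by blast
  next
    case (7 e f g)
    have c: "chain G [{e}, {f}, {g}]" "chain G [{e, f, g}]"
      by (rule chain_cong_Union[OF ps]; use 7 in auto)+
    have "partner G ps [{e}, {f}, {g}] \<or> partner G [{e, f, g}] ps"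
      using partner.pair_tree[of e f g G] partner.tree[of e f g G] 7 by blast
    then show ?thesis using c by blast
  next
    case (8 e f g)
    have c: "chain G [{e, f}, {g}]" "chain G [{e}, {f, g}]"
      by (rule chain_cong_Union[OF ps]; use 8 in auto)+
    have "partner G [{e, f}, {g}] ps \<or> partner G [{e}, {f, g}] ps"
      using partner.pair_tree[of e f g G] partner.edge_tree[of e f g G] 8 by blast
    then show ?thesis using c by blast
  qed
qed

definition similar :: "('v, 'e) mgraph \<Rightarrow> 'e set list \<Rightarrow> 'e set list \<Rightarrow> bool" where
  "similar G ps qs \<longleftrightarrow> (\<exists>\<phi> h. graph_iso G G \<phi> h \<and> map ((`) h) ps = qs)"

lemma similar_refl: "similar G ps ps"
  unfolding similar_def
  by (intro exI[of _ id] conjI graph_iso_id) (simp add: map_idI)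

lemma exchangeable_similar:
  assumes "exchangeable G X f g"
  shows "similar G [{f}] [{g}]" "similar G [{f}, {g}] [{g}, {f}]"
    "e \<in> X \<Longrightarrow> similar G [{e}, {f}] [{e}, {g}]"
    "e \<in> X \<Longrightarrow> similar G [{e, f}, {g}] [{e, g}, {f}]"
    "e \<in> X \<Longrightarrow> similar G [{e}, {f}, {g}] [{e}, {g}, {f}]"
    "e \<in> X \<Longrightarrow> similar G [{f}, {g}, {e}] [{g}, {f}, {e}]"
proof -
  obtain \<phi> h where h: "graph_iso G G \<phi> h" "h f = g" "h g = f" "\<forall>e\<in>X. h e = e"
    using assms by (auto simp: exchangeable_def)
  have *: "similar G ps qs" if "map ((`) h) ps = qs" for ps qs
    using that h(1) unfolding similar_def by blast
  show "similar G [{f}] [{g}]" "similar G [{f}, {g}] [{g}, {f}]"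
    "e \<in> X \<Longrightarrow> similar G [{e}, {f}] [{e}, {g}]"
    "e \<in> X \<Longrightarrow> similar G [{e, f}, {g}] [{e, g}, {f}]"
    "e \<in> X \<Longrightarrow> similar G [{e}, {f}, {g}] [{e}, {g}, {f}]"
    "e \<in> X \<Longrightarrow> similar G [{f}, {g}, {e}] [{g}, {f}, {e}]"
    using h(2-4) by (auto intro!: *)
qed

lemma partner_empty_iff: "partner G [] rs \<longleftrightarrow> (\<exists>e. rs = [{e}] \<and> good_edge G e)"
  by (auto intro: partner.empty elim: partner.cases)

lemma partner_pairD:
  assumes "e \<noteq> f" "partner G [{e, f}] rs"
  shows "rs = [{e}, {f}] \<and> (special G {e, f} \<or> good_edge G e) \<or> rs = [{f}, {e}] \<and> (special G {e, f} \<or> good_edge G f)"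
  using assms(2)
proof cases
  case (pair a b)
  then have "a = e \<and> b = f \<or> a = f \<and> b = e" by (auto simp: doubleton_eq_iff)
  then show ?thesis using pair by (elim disjE conjE) (simp_all add: insert_commute)
next
  case (bad a b)
  then show ?thesis using assms(1) by auto
next
  case (tree a b c)
  then have "card {e, f} = card {a, b, c}" by simp
  then show ?thesis using tree(3) assms(1) by simp
qed

lemma partner_badD:
  assumes "partner G [{e}] rs"
  shows "\<exists>f. rs = [{e}, {f}] \<and> e \<noteq> f \<and> \<not> good_edge G e \<and> \<not> special G {e, f}"
  using assms
proof cases
  case (tree a b c)
  then have "card {e} = card {a, b, c}" by simp
  then show ?thesis using tree(3) by simp
qed auto

lemma partner_treeD:
  assumes "partner G [T] rs" "card T = 3"
  shows "\<exists>e f g. T = {e, f, g} \<and> distinct [e, f, g] \<and> rs = [{e, f}, {g}] \<and> \<not> special G {e, f}"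
  using assms by cases auto

lemma partner_edge_treeD:
  assumes "partner G [{e}, {f, g}] rs" "f \<noteq> g"
  shows "rs = [{e}, {f}, {g}] \<and> \<not> special G {e, f} \<or> rs = [{e}, {g}, {f}] \<and> \<not> special G {e, g}"
  using assms by cases (auto simp: doubleton_eq_iff)

lemma partner_pair_treeD:
  assumes "partner G [{e, f}, {g}] rs" "e \<noteq> f"
  shows "rs = [{e}, {f}, {g}] \<or> rs = [{f}, {e}, {g}]"
  using assms by cases (auto simp: doubleton_eq_iff)

text \<open>For each shape, the choices for the additional forest differ by the exchange of two edges, and the exchange
  lemmas provide an automorphism that fixes the rest of the chain.\<close>

lemma partner_unique:
  assumes G: "genus_three G" and c: "chain G ps" "chain G rs" and p: "partner G qs ps" "partner G qs rs"
  shows "similar G ps rs"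
proof -
  interpret genus_three G by (rule G)
  have sub: "\<Union> (set ps) \<subseteq> edges G" "forest G (\<Union> (set ps))" "\<Union> (set rs) \<subseteq> edges G" "forest G (\<Union> (set rs))"
    using c by (auto simp: chain_def)
  from p(1) show ?thesis
  proof cases
    case (empty e)
    have "partner G [] rs" using p(2) empty(1) by simp
    then obtain f where f: "rs = [{f}]" "good_edge G f" unfolding partner_empty_iff by blast
    have E: "e \<in> edges G" "f \<in> edges G" "forest G {e}" "forest G {f}" using sub empty(2) f(1) by simp_all
    show ?thesis
    proof (cases "e = f")
      case False
      show ?thesis
      proof (cases "ends G e = ends G f")
        case True
        let ?k = "id(e := f, f := e)"
        have "\<exists>h. graph_iso G G id h \<and> (\<forall>x\<in>{e, f}. h x = ?k x)"
          by (rule extend_automorphism[OF graph]) (use E True False in \<open>auto simp: inj_on_def\<close>)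
        then obtain h where "graph_iso G G id h" "h e = f" using False by auto
        then show ?thesis unfolding similar_def empty f by auto
      next
        case neq: False
        have "forest G {e, f}" using forest_pair_iff[OF graph E(1,2) False] E neq by simp
        then have exch: "exchangeable G {} e f" using exchange_pair[OF E(1,2) False] empty f by simp
        then show ?thesis using exchangeable_similar(1)[OF exch] empty(2) f(1) by simp
      qed
    qed (use similar_refl empty f in simp)
  next
    case (pair e f)
    have E: "e \<in> edges G" "f \<in> edges G" "forest G {e, f}" using sub(1,2) pair(2) by (simp_all add: insert_commute)
    have "partner G [{e, f}] rs" using p(2) pair(1) by simp
    from partner_pairD[OF pair(3) this]
    have "rs = ps \<or> rs = [{f}, {e}] \<and> (special G {e, f} \<or> good_edge G f)" using pair(2) by blast
    then show ?thesis
    proof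
      assume *: "rs = [{f}, {e}] \<and> (special G {e, f} \<or> good_edge G f)"
      then have exch: "exchangeable G {} e f" using exchange_pair[OF E(1,2) pair(3) E(3)] pair(4) by blast
      then show ?thesis using exchangeable_similar(2)[OF exch] pair(2) * by simp
    qed (simp add: similar_refl)
  next
    case (bad e f)
    have "partner G [{e}] rs" using p(2) bad(1) by simp
    from partner_badD[OF this] obtain g where g: "rs = [{e}, {g}]" "e \<noteq> g" "\<not> special G {e, g}" by blast
    have E: "e \<in> edges G" "f \<in> edges G" "g \<in> edges G" "forest G {e, f}" "forest G {e, g}"
      using sub bad(2) g(1) by (simp_all add: insert_commute)
    show ?thesis
    proof (cases "f = g")
      case False
      have exch: "exchangeable G {e} f g"
        by (rule exchange_bad[OF E(1-3) _ E(4,5)]) (use bad g False in auto)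
      then show ?thesis using exchangeable_similar(3)[OF exch singletonI] bad(2) g(1) by simp
    qed (use similar_refl bad g in simp)
  next
    case (tree e f g)
    have "\<Union> (set ps) = {e, f, g}" using tree(2) by auto
    then have T: "{e, f, g} \<subseteq> edges G" "forest G {e, f, g}" using sub(1,2) by simp_all
    have c3: "card {e, f, g} = 3" using tree(3) by simp
    have "partner G [{e, f, g}] rs" using p(2) tree(1) by simp
    from partner_treeD[OF this c3]
    obtain a b d where abd: "{e, f, g} = {a, b, d}" "distinct [a, b, d]" "rs = [{a, b}, {d}]" "\<not> special G {a, b}"
      by (elim exE conjE)
    have meet: "ends G x \<inter> ends G y \<noteq> {}" if "\<not> special G {x, y}" "x \<noteq> y" for x y
      using that by (auto simp: special_pair)
    have ex: "similar G [{x, y}, {z}] [{x, z}, {y}]"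
      if "{x, y, z} = {e, f, g}" "distinct [x, y, z]" "\<not> special G {x, y}" "\<not> special G {x, z}" for x y z
    proof -
      have exch: "exchangeable G {x} y z"
        by (rule exchange_tree) (use that T meet in auto)
      then show ?thesis using exchangeable_similar(4)[OF exch singletonI] by simp
    qed
    consider "d = g" | "d = f" | "d = e" using abd(1) by blast
    then show ?thesis
    proof cases
      case 1
      then have "{a, b} = {e, f}" using abd(1,2) tree(3) by auto
      then show ?thesis using abd(3) tree(2) 1 similar_refl by simp
    next
      case 2
      then have ab: "{a, b} = {e, g}" using abd(1,2) tree(3) by auto
      then have "\<not> special G {e, g}" using abd(4) by simp
      then show ?thesis using ex[of e f g] tree ab abd(3) 2 by simp
    next
      case 3
      then have ab: "{a, b} = {f, g}" using abd(1,2) tree(3) by auto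
      then have "\<not> special G {f, g}" "\<not> special G {f, e}" using abd(4) tree(4) by (simp_all add: insert_commute)
      moreover have "{f, e, g} = {e, f, g}" "distinct [f, e, g]" using tree(3) by auto
      ultimately have "similar G [{f, e}, {g}] [{f, g}, {e}]" using ex[of f e g] by blast
      then show ?thesis using tree(2) ab abd(3) 3 by (simp add: insert_commute)
    qed
  next
    case (edge_tree e f g)
    have "\<Union> (set ps) = {e, f, g}" using edge_tree(2) by auto
    then have T: "{e, f, g} \<subseteq> edges G" "forest G {e, f, g}" using sub(1,2) by simp_all
    have fg: "f \<noteq> g" using edge_tree(3) by simp
    have "partner G [{e}, {f, g}] rs" using p(2) edge_tree(1) by simp
    from partner_edge_treeD[OF this fg]
    have "rs = ps \<or> rs = [{e}, {g}, {f}] \<and> \<not> special G {e, g}" unfolding edge_tree(2) by (elim disjE conjE) simp_all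
    then show ?thesis
    proof
      assume *: "rs = [{e}, {g}, {f}] \<and> \<not> special G {e, g}"
      have "ends G e \<inter> ends G f \<noteq> {}" "ends G e \<inter> ends G g \<noteq> {}"
        using edge_tree(3,4) * by (auto simp: special_pair)
      then have exch: "exchangeable G {e} f g" using exchange_tree[OF T(1) edge_tree(3) T(2)] by blast
      then show ?thesis using exchangeable_similar(5)[OF exch singletonI] edge_tree(2) * by simp
    qed (simp add: similar_refl)
  next
    case (pair_tree e f g)
    have "\<Union> (set ps) = {e, f, g}" "{e, f, g} = {g, e, f}" "{f, e, g} = {e, f, g}" using pair_tree(2) by auto
    then have T: "{g, e, f} \<subseteq> edges G" "forest G {g, e, f}" "distinct [g, e, f]"
      and T': "{e, f, g} \<subseteq> edges G" "forest G {e, f, g}" "{f, e, g} \<subseteq> edges G" "forest G {f, e, g}"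
      using sub(1,2) pair_tree(3) by auto
    have ef: "e \<noteq> f" using pair_tree(3) by simp
    have "partner G [{e, f}, {g}] rs" using p(2) pair_tree(1) by simp
    from partner_pair_treeD[OF this ef] have "rs = ps \<or> rs = [{f}, {e}, {g}]" unfolding pair_tree(2) .
    then show ?thesis
    proof
      assume *: "rs = [{f}, {e}, {g}]"
      have n4: "card (verts G) = 4" using card_forest[OF T(1,2)] T(3) card_verts(2) by simp
      \<comment> \<open>The edges of the special pair are disjoint, so each of them meets the third edge of the tree.\<close>
      have dis: "ends G e \<inter> ends G f = {}"
        using adjacent_not_special[OF n4 T(1,2), of e f] pair_tree(3,4) by auto
      have "ends G g \<inter> ends G e \<noteq> {}"
        using tree_neighbour_exists[OF T'(1) pair_tree(3) T'(2)] dis by (simp add: Int_commute)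
      moreover have "ends G g \<inter> ends G f \<noteq> {}"
        using tree_neighbour_exists[OF T'(3) _ T'(4)] dis T(3) by (auto simp: Int_commute)
      ultimately have exch: "exchangeable G {g} e f" using exchange_tree[OF T(1,3,2)] by blast
      then show ?thesis using exchangeable_similar(6)[OF exch singletonI] pair_tree(2) * by simp
    qed (simp add: similar_refl)
  qed
qed

section \<open>Invariance under isomorphisms\<close>

lemma good_edge_iso:
  assumes "graph_iso G H f h" "graph G" "e \<in> edges G"
  shows "good_edge H (h e) \<longleftrightarrow> good_edge G e"
proof -
  have h: "edges H = h ` edges G" "inj_on h (edges G)" and f: "inj_on f (verts G)"
    using assms(1) by (auto simp: graph_iso_def bij_betw_def)
  have "ends H (h x) = ends H (h e) \<longleftrightarrow> ends G x = ends G e" if "x \<in> edges G" for x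
    using that assms graph_iso_ends[OF assms(1)] inj_on_image_eq_iff[OF f] by (simp add: graph_def)
  moreover have "h x = h e \<longleftrightarrow> x = e" if "x \<in> edges G" for x
    using that assms(3) h(2) by (auto simp: inj_on_def)
  ultimately show ?thesis using graph_iso_card(1)[OF assms(1)] by (simp add: good_edge_def h(1))
qed

lemma special_iso:
  assumes "graph_iso G H f h" "graph G" "P \<subseteq> edges G"
  shows "special H (h ` P) \<longleftrightarrow> special G P"
proof -
  have h: "inj_on h (edges G)" and f: "inj_on f (verts G)"
    using assms(1) by (auto simp: graph_iso_def bij_betw_def)
  have "good_edge H (h x) \<longleftrightarrow> good_edge G x" if "x \<in> P" for x
    using good_edge_iso[OF assms(1,2)] that assms(3) by blast
  moreover have "h x = h y \<longleftrightarrow> x = y" if "x \<in> P" "y \<in> P" for x y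
    using that assms(3) h by (auto simp: inj_on_def)
  moreover have "ends H (h x) \<inter> ends H (h y) = {} \<longleftrightarrow> ends G x \<inter> ends G y = {}" if "x \<in> P" "y \<in> P" for x y
  proof -
    have xy: "x \<in> edges G" "y \<in> edges G" using that assms(3) by auto
    then have "ends G x \<subseteq> verts G" "ends G y \<subseteq> verts G" using assms(2) by (auto simp: graph_def)
    then have "f ` (ends G x \<inter> ends G y) = f ` ends G x \<inter> f ` ends G y" by (rule inj_on_image_Int[OF f])
    then show ?thesis using graph_iso_ends[OF assms(1)] xy by (metis image_is_empty)
  qed
  ultimately show ?thesis by (simp add: special_def)
qed

lemma chain_rank_iso:
  assumes "graph_iso G H f h" "graph G" "\<Union> (set ps) \<subseteq> edges G"
  shows "chain_rank H (map ((`) h) ps) = chain_rank G ps"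
proof -
  have h: "inj_on h (edges G)" using assms(1) by (auto simp: graph_iso_def bij_betw_def)
  have card: "card (h ` A) = card A" if "A \<subseteq> edges G" for A
    by (rule card_image) (rule inj_on_subset[OF h that])
  have sp: "special H (h ` A) = special G A" if "A \<subseteq> edges G" for A
    by (rule special_iso[OF assms(1,2) that])
  have good: "(\<forall>e\<in>A. good_edge H (h e)) = (\<forall>e\<in>A. good_edge G e)" if "A \<subseteq> edges G" for A
    using that good_edge_iso[OF assms(1,2)] by blast
  show ?thesis
    using assms(3) by (cases "(G, ps)" rule: chain_rank.cases) (simp_all add: card sp good image_Un[symmetric])
qed

lemma partner_iso:
  assumes "graph_iso G H f h" "graph G" "\<Union> (set ps) \<subseteq> edges G" "\<Union> (set qs) \<subseteq> edges G" "partner G qs ps"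
  shows "partner H (map ((`) h) qs) (map ((`) h) ps)"
proof -
  have h: "inj_on h (edges G)" using assms(1) by (auto simp: graph_iso_def bij_betw_def)
  have sp: "special H {h x, h y} = special G {x, y}" if "x \<in> edges G" "y \<in> edges G" for x y
    using special_iso[OF assms(1,2), of "{x, y}"] that by simp
  note good = good_edge_iso[OF assms(1,2)]
  have neq: "h x = h y \<longleftrightarrow> x = y" if "x \<in> edges G" "y \<in> edges G" for x y
    using that h by (auto simp: inj_on_def)
  from assms(5,3,4) show ?thesis
    by cases (simp_all add: partner.intros sp good neq)
qed

section \<open>The collapse\<close>

definition cell_of :: "('v, 'e) mgraph \<Rightarrow> 'e set list \<Rightarrow> nat \<times> (nat, nat) fgraph set" where
  "cell_of G ps = (length ps, fclass (G, complete_chain G ps))"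

text \<open>The last block of a filtration is no longer visible in a chain, but isomorphisms take complements to
  complements.\<close>

lemma map_complete:
  assumes "graph_iso G H f h" "\<Union> (set ps) \<subseteq> edges G"
  shows "map ((`) h) (complete_chain G ps) = complete_chain H (map ((`) h) ps)"
proof -
  have h: "inj_on h (edges G)" "edges H = h ` edges G" using assms(1) by (auto simp: graph_iso_def bij_betw_def)
  have "h ` (edges G - \<Union> (set ps)) = edges H - \<Union> (set (map ((`) h) ps))"
    using inj_on_image_set_diff[OF h(1), of "edges G" "\<Union> (set ps)"] assms(2) h(2) by (simp add: image_Union)
  then show ?thesis by (simp add: complete_chain_def)
qed

lemma cell_of_iso:
  assumes "genus_three G" "chain G ps" "graph_iso G H f h"
  shows "genus_three H" "chain H (map ((`) h) ps)" "cell_of H (map ((`) h) ps) = cell_of G ps"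
proof -
  have s: "simplex_graph 3 (length ps) (G, complete_chain G ps)"
    using genus_three.simplex_graph_complete[OF assms(1,2)] .
  have i: "fgraph_isomorphic (G, complete_chain G ps) (H, complete_chain H (map ((`) h) ps))"
    unfolding fgraph_isomorphic_iff using assms(3) map_complete[OF assms(3)] assms(2)[unfolded chain_def]
    by (intro exI[of _ f] exI[of _ h]) simp
  note s' = simplex_graph_iso[OF s i]
  show "genus_three H" "chain H (map ((`) h) ps)" using simplex_graph_chain(1,2)[OF s'] by simp_all
  have "fclass (G, complete_chain G ps) = fclass (H, complete_chain H (map ((`) h) ps))"
    using fclass_eq_iff[OF simplex_graph_filtered[OF s] simplex_graph_filtered[OF s']] i by simp
  then show "cell_of H (map ((`) h) ps) = cell_of G ps" by (simp add: cell_of_def)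
qed

lemma cell_of_eqD:
  assumes "genus_three G" "chain G ps" "genus_three H" "chain H qs" "cell_of G ps = cell_of H qs"
  shows "\<exists>f h. graph_iso G H f h \<and> map ((`) h) ps = qs"
proof -
  note s = genus_three.simplex_graph_complete[OF assms(1,2)] genus_three.simplex_graph_complete[OF assms(3,4)]
  have "fgraph_isomorphic (G, complete_chain G ps) (H, complete_chain H qs)"
    using fclass_eq_iff[OF simplex_graph_filtered[OF s(1)] simplex_graph_filtered[OF s(2)]] assms(5)
    by (simp add: cell_of_def)
  then obtain f h where i: "graph_iso G H f h" "map ((`) h) (complete_chain G ps) = complete_chain H qs"
    by (auto simp: fgraph_isomorphic_iff)
  have "map ((`) h) ps = butlast (map ((`) h) (complete_chain G ps))" by (simp add: map_butlast[symmetric])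
  then have "map ((`) h) ps = qs" by (simp add: i(2))
  then show ?thesis using i(1) by blast
qed

lemma simplex_cell_of:
  assumes "simplex_graph 3 m (G, \<pi>)"
  shows "genus_three G" "chain G (butlast \<pi>)" "(m, fclass (G, \<pi>)) = cell_of G (butlast \<pi>)"
proof -
  note c = simplex_graph_chain[OF assms]
  show "genus_three G" "chain G (butlast \<pi>)" by (rule c)+
  have "complete_chain G (butlast \<pi>) = \<pi>" using c(3) by (rule sym)
  then show "(m, fclass (G, \<pi>)) = cell_of G (butlast \<pi>)" using c(4) by (simp add: cell_of_def)
qed

lemma simplices_Delta_iff:
  "s \<in> simplices (Delta 3) \<longleftrightarrow>
     (\<exists>(G :: (nat, nat) mgraph) ps. genus_three G \<and> chain G ps \<and> s = cell_of G ps)"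
proof
  assume "s \<in> simplices (Delta 3)"
  then obtain m and G :: "(nat, nat) mgraph" and \<pi> where "s = (m, fclass (G, \<pi>))" "simplex_graph 3 m (G, \<pi>)"
    by (auto simp: simplices_def cells_Delta)
  then show "\<exists>(G :: (nat, nat) mgraph) ps. genus_three G \<and> chain G ps \<and> s = cell_of G ps"
    using simplex_cell_of[of m G \<pi>] by (intro exI[of _ G] exI[of _ "butlast \<pi>"]) simp
next
  assume "\<exists>(G :: (nat, nat) mgraph) ps. genus_three G \<and> chain G ps \<and> s = cell_of G ps"
  then obtain G :: "(nat, nat) mgraph" and ps where "genus_three G" "chain G ps" "s = cell_of G ps" by blast
  then show "s \<in> simplices (Delta 3)"
    using fclass_in_cells[OF genus_three.simplex_graph_complete] by (simp add: simplices_def cell_of_def)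
qed

text \<open>Every simplex has a representative with vertices \<open>0, 1, \<dots>\<close> and edges \<open>0, 1, \<dots>\<close>, of bounded numbers.\<close>

lemma finite_simplices: "finite (simplices (Delta 3))"
proof (rule finite_subset)
  let ?E = "{en. \<forall>e. (e \<in> {..<6} \<longrightarrow> en e \<in> Pow {..<4}) \<and> (e \<notin> {..<6} \<longrightarrow> en e = {})} :: (nat \<Rightarrow> nat set) set"
  let ?P = "{ps. set ps \<subseteq> Pow {..<6} \<and> length ps \<le> 3} :: nat set list set"
  let ?N = "{..4} \<times> {..6} \<times> ?E \<times> ?P :: (nat \<times> nat \<times> (nat \<Rightarrow> nat set) \<times> nat set list) set"
  let ?g = "\<lambda>(n, k, en, ps). cell_of \<lparr>verts = {0..<n}, edges = {0..<k}, ends = en\<rparr> ps"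
  have "finite ?N"
    by (intro finite_cartesian_product finite_atMost finite_set_of_finite_funs finite_lists_length_le) auto
  then show "finite (?g ` ?N)" by (rule finite_imageI)
  show "simplices (Delta 3) \<subseteq> ?g ` ?N"
  proof
    fix s assume "s \<in> simplices (Delta 3)"
    then obtain G :: "(nat, nat) mgraph" and ps where G: "genus_three G" "chain G ps" "s = cell_of G ps"
      unfolding simplices_Delta_iff by blast
    interpret genus_three G by (rule G(1))
    let ?n = "card (verts G)" and ?k = "card (edges G)"
    have fin: "finite (edges G)" using graph by (simp add: graph_def)
    obtain f where f: "bij_betw f (verts G) {0..<?n}" using ex_bij_betw_finite_nat[OF finite_verts] by blast
    obtain h where h: "bij_betw h (edges G) {0..<?k}" using ex_bij_betw_finite_nat[OF fin] by blast
    let ?en = "\<lambda>e. if e < ?k then f ` ends G (inv_into (edges G) h e) else {}"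
    let ?H = "\<lparr>verts = {0..<?n}, edges = {0..<?k}, ends = ?en\<rparr>"
    have i: "graph_iso G ?H f h" using f h by (auto simp: graph_iso_def bij_betw_def)
    note c = cell_of_iso[OF G(1,2) i]
    have k: "?k \<le> 6" using card_edges card_verts(2) by simp
    have "?en \<in> ?E"
    proof -
      have "?en e \<subseteq> {..<4}" if "e < ?k" for e
      proof -
        have "f ` ends G (inv_into (edges G) h e) \<subseteq> {0..<?n}"
          using genus_three.graph[OF c(1)] that by (simp add: graph_def)
        also have "{0..<?n} \<subseteq> {..<4}" using card_verts(2) by auto
        finally show ?thesis using that by simp
      qed
      then show ?thesis using k by auto
    qed
    moreover have "map ((`) h) ps \<in> ?P"
    proof -
      have "length ps \<le> 3" using G(1,2) by (cases rule: chain_shape) auto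
      moreover have "\<Union> (set (map ((`) h) ps)) \<subseteq> {0..<?k}" using c(2) by (simp add: chain_def)
      then have "set (map ((`) h) ps) \<subseteq> Pow {..<6}" using k by fastforce
      ultimately show ?thesis by simp
    qed
    ultimately have "(?n, ?k, ?en, map ((`) h) ps) \<in> ?N" using k card_verts(2) by simp
    moreover have "s = ?g (?n, ?k, ?en, map ((`) h) ps)" using c(3) G(3) by simp
    ultimately show "s \<in> ?g ` ?N" by (rule image_eqI[rotated])
  qed
qed

text \<open>As \<open>chain_rank\<close> is less than \<open>10\<close>, the number of vertices counts first.\<close>

definition cell_rank :: "nat \<times> (nat, nat) fgraph set \<Rightarrow> nat" where
  "cell_rank s = (let (G, ps) = SOME (G :: (nat, nat) mgraph, ps). genus_three G \<and> chain G ps \<and> s = cell_of G ps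
     in 10 * card (verts G) + chain_rank G ps)"

lemma cell_rank_cell_of:
  assumes "genus_three (G :: (nat, nat) mgraph)" "chain G ps"
  shows "cell_rank (cell_of G ps) = 10 * card (verts G) + chain_rank G ps"
proof -
  let ?P = "\<lambda>(H :: (nat, nat) mgraph, qs). genus_three H \<and> chain H qs \<and> cell_of G ps = cell_of H qs"
  obtain H qs where Hq: "Eps ?P = (H, qs)" by fastforce
  have "?P (Eps ?P)" by (rule someI[of ?P "(G, ps)"]) (use assms in simp)
  then have H: "genus_three H" "chain H qs" "cell_of G ps = cell_of H qs" unfolding Hq by auto
  obtain f h where i: "graph_iso G H f h" "map ((`) h) ps = qs"
    using cell_of_eqD[OF assms H] by blast
  have "chain_rank H qs = chain_rank G ps"
    using chain_rank_iso[OF i(1) genus_three.graph[OF assms(1)], of ps] assms(2) i(2) by (simp add: chain_def)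
  then show ?thesis using graph_iso_card(1)[OF i(1)] by (simp add: cell_rank_def Hq)
qed

definition matched :: "nat \<times> (nat, nat) fgraph set \<Rightarrow> nat \<times> (nat, nat) fgraph set \<Rightarrow> bool" where
  "matched a b \<longleftrightarrow> (\<exists>(G :: (nat, nat) mgraph) qs ps. genus_three G \<and> chain G qs \<and> chain G ps \<and>
     partner G qs ps \<and> a = cell_of G qs \<and> b = cell_of G ps)"

lemma merge_facet:
  assumes "genus_three (G :: (nat, nat) mgraph)" "chain G ps" "0 < i" "i \<le> length ps"
  shows "chain G (merge i ps)" "face (Delta 3) (length ps) i (snd (cell_of G ps)) = snd (cell_of G (merge i ps))"
    "(cell_of G (merge i ps), cell_of G ps) \<in> facet_rel (Delta 3)"
proof -
  obtain m where m: "length ps = Suc m" using assms(3,4) by (cases "length ps") auto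
  have s: "simplex_graph 3 (Suc m) (G, complete_chain G ps)"
    using genus_three.simplex_graph_complete[OF assms(1,2)] m by simp
  have i: "0 < i" "i \<le> Suc m" using assms(3,4) m by auto
  have s': "simplex_graph 3 m (G, complete_chain G (merge i ps))"
    using simplex_graph_merge[OF s i] merge_complete[OF assms(2-4)] by simp
  have l: "length (merge i ps) = m" using simplex_graph_chain(4)[OF s'] by simp
  show "chain G (merge i ps)" using simplex_graph_chain(2)[OF s'] by simp
  have f: "face (Delta 3) (Suc m) i (fclass (G, complete_chain G ps)) = fclass (G, complete_chain G (merge i ps))"
    using face_merge[OF s i] merge_complete[OF assms(2-4)] by simp
  then show "face (Delta 3) (length ps) i (snd (cell_of G ps)) = snd (cell_of G (merge i ps))"
    by (simp add: cell_of_def m)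
  have "fclass (G, complete_chain G ps) \<in> cells (Delta 3) (Suc m)" by (rule fclass_in_cells[OF s])
  then have "((m, face (Delta 3) (Suc m) i (fclass (G, complete_chain G ps))), (Suc m, fclass (G, complete_chain G ps)))
      \<in> facet_rel (Delta 3)"
    unfolding facet_rel_def using i(2) by blast
  then show "(cell_of G (merge i ps), cell_of G ps) \<in> facet_rel (Delta 3)"
    unfolding f by (simp add: cell_of_def l m)
qed

text \<open>Contracting the first forest of a chain decreases the number of vertices.  The other facets belong
  to the same graph.\<close>

lemma facet_rank:
  assumes "(a, b) \<in> facet_rel (Delta 3)"
  shows "cell_rank a < cell_rank b \<or> cell_rank a = cell_rank b \<and> matched a b"
proof -
  obtain m i \<sigma> where ab: "a = (m, face (Delta 3) (Suc m) i \<sigma>)" "b = (Suc m, \<sigma>)"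
    "\<sigma> \<in> cells (Delta 3) (Suc m)" "i \<le> Suc m"
    using assms by (auto simp: facet_rel_def)
  have "b \<in> simplices (Delta 3)" using ab by (simp add: simplices_def)
  then obtain G :: "(nat, nat) mgraph" and ps where G: "genus_three G" "chain G ps" "b = cell_of G ps"
    unfolding simplices_Delta_iff by blast
  interpret genus_three G by (rule G(1))
  have l: "length ps = Suc m" and \<sigma>: "\<sigma> = fclass (G, complete_chain G ps)" using G(3) ab(2) by (auto simp: cell_of_def)
  have s: "simplex_graph 3 (Suc m) (G, complete_chain G ps)" using simplex_graph_complete[OF G(2)] l by simp
  show ?thesis
  proof (cases "i = 0")
    case True
    let ?A = "hd ps"
    have ne: "ps \<noteq> []" using l by auto
    then have A: "?A \<in> set ps" "hd (complete_chain G ps) = ?A" by (auto simp: complete_chain_def)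
    let ?y = "(contract G ?A, tl (complete_chain G ps))"
    have sy: "simplex_graph 3 m ?y" using simplex_graph_contract[OF s] A(2) by simp
    obtain H :: "(nat, nat) mgraph" and \<rho> where i: "fgraph_isomorphic ?y (H, \<rho>)"
      using fgraph_nat_copy[OF simplex_graph_filtered[OF sy]] by fastforce
    note sH = simplex_graph_iso[OF sy i]
    have "a = (m, fclass ?y)" using face_contract[OF s] True A(2) by (simp add: ab \<sigma>)
    also have "\<dots> = (m, fclass (H, \<rho>))"
      using fclass_eq_iff[OF simplex_graph_filtered[OF sy] simplex_graph_filtered[OF sH]] i by simp
    also have "\<dots> = cell_of H (butlast \<rho>)" by (rule simplex_cell_of(3)[OF sH])
    finally have "cell_rank a = 10 * card (verts H) + chain_rank H (butlast \<rho>)"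
      using cell_rank_cell_of simplex_cell_of(1,2)[OF sH] by simp
    moreover have "card (verts H) < card (verts G)"
    proof -
      obtain f h where "graph_iso (contract G ?A) H f h" using i by (auto simp: fgraph_isomorphic_iff)
      then have "card (verts H) = card (verts (contract G ?A))" by (rule graph_iso_card)
      moreover have sub: "?A \<subseteq> edges G" "forest G ?A" "?A \<noteq> {}"
        using G(2) A(1) forest_subset[of G "\<Union> (set ps)" ?A] by (auto simp: chain_def)
      moreover have "card ?A > 0"
        using sub graph finite_subset by (auto simp: card_gt_0_iff graph_def)
      ultimately show ?thesis using card_verts_contract[OF stable _ sub(1,2)] genus by simp
    qed
    moreover have "cell_rank b = 10 * card (verts G) + chain_rank G ps"
      using cell_rank_cell_of[OF G(1,2)] G(3) by simp
    ultimately show ?thesis using chain_rank_le[of H "butlast \<rho>"] by linarith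
  next
    case False
    then have i: "0 < i" "i \<le> length ps" using ab(4) l by auto
    note mf = merge_facet[OF G(1,2) i]
    have "length (merge i ps) = m"
      using simplex_graph_chain(4)[OF simplex_graph_merge[OF s, of i]] merge_complete[OF G(2) i] i l by simp
    then have a: "a = cell_of G (merge i ps)" using mf(2) by (simp add: ab \<sigma> cell_of_def l)
    have r: "cell_rank a = 10 * card (verts G) + chain_rank G (merge i ps)"
      "cell_rank b = 10 * card (verts G) + chain_rank G ps"
      using cell_rank_cell_of[OF G(1,2)] cell_rank_cell_of[OF G(1) mf(1)] a G(3) by simp_all
    from merge_rank[OF G(1,2) i] show ?thesis
    proof
      assume p: "partner G (merge i ps) ps"
      then have "matched a b" unfolding matched_def using G mf(1) a by blast
      then show ?thesis using r partner_rank[OF p] by simp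
    qed (use r in simp)
  qed
qed

definition rose :: "(nat, nat) mgraph" where
  "rose = \<lparr>verts = {0}, edges = {0, 1, 2}, ends = (\<lambda>_. {0})\<rparr>"

lemma genus_three_rose: "genus_three rose"
proof
  have "connected_by rose F" for F by (auto simp: connected_by_def rose_def)
  then show "stable rose" by (auto simp: stable_def graph_def bridge_def rose_def)
  show "genus rose = 3" by (simp add: genus_def rose_def)
qed

lemma chain_rose: "chain rose []"
  by (simp add: chain_def forest_empty)

text \<open>A graph with one vertex has three loops, hence no forests but the empty one.\<close>

lemma one_vertex:
  assumes G: "genus_three (G :: (nat, nat) mgraph)" "chain G ps" and one: "card (verts G) = 1"
  shows "cell_of G ps = cell_of rose []"
proof -
  interpret genus_three G by (rule G(1))
  have ps: "{} \<notin> set ps" "\<Union> (set ps) \<subseteq> edges G" "forest G (\<Union> (set ps))" using G(2) by (auto simp: chain_def)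
  have fin: "finite (edges G)" using graph by (simp add: graph_def)
  have "card (\<Union> (set ps)) = 0" using card_forest[OF ps(2,3)] one by simp
  then have "\<Union> (set ps) = {}" using finite_subset[OF ps(2) fin] by simp
  then have nil: "ps = []" using ps(1) by (cases ps) auto
  obtain u where u: "verts G = {u}" using one by (auto simp: card_1_singleton_iff)
  have ends: "ends G e = {u}" if e: "e \<in> edges G" for e
  proof -
    obtain a b where "ends G e = {a, b}" "a \<in> verts G" "b \<in> verts G" by (rule graph_ends[OF graph e])
    then show ?thesis using u by simp
  qed
  have "card (edges G) = card {0, 1, 2 :: nat}" using card_edges one by simp
  then obtain h where h: "bij_betw h (edges G) {0, 1, 2 :: nat}"
    using finite_same_card_bij[OF fin, of "{0, 1, 2 :: nat}"] by auto
  have "graph_iso G rose (\<lambda>_. 0) h"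
    using h u ends by (auto simp: graph_iso_def rose_def bij_betw_def)
  from cell_of_iso(3)[OF G this] show ?thesis by (simp add: nil)
qed

text \<open>The relation \<open>matched\<close> is defined with representatives; isomorphisms move the partners of one representative
  to another one, where uniqueness up to automorphisms applies.\<close>

lemma collapsible_Delta_3: "collapsible (Delta 3)"
proof (rule collapsible_matching[where r = cell_rank and M = matched and v = "snd (cell_of rose [])"])
  let ?v = "(0, snd (cell_of rose []))"
  have v: "?v = cell_of rose []" by (simp add: cell_of_def)
  have v_rank: "cell_rank ?v = 10"
    unfolding v cell_rank_cell_of[OF genus_three_rose chain_rose] by (simp add: rose_def)
  have big: "2 \<le> card (verts G)"
    if "genus_three G" "chain G ps" "cell_of G ps \<noteq> ?v" for G :: "(nat, nat) mgraph" and ps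
    using that one_vertex[OF that(1,2)] genus_three.card_verts(1)[OF that(1)] unfolding v by fastforce
  show "finite (simplices (Delta 3))" by (rule finite_simplices)
  have "?v \<in> simplices (Delta 3)"
    unfolding simplices_Delta_iff v using genus_three_rose chain_rose by blast
  then show "snd (cell_of rose []) \<in> cells (Delta 3) 0" by (simp add: simplices_def)
  show "cell_rank ?v < cell_rank s" if s: "s \<in> simplices (Delta 3)" "s \<noteq> ?v" for s
  proof -
    obtain G :: "(nat, nat) mgraph" and ps where G: "genus_three G" "chain G ps" "s = cell_of G ps"
      using s(1) unfolding simplices_Delta_iff by blast
    then have "2 \<le> card (verts G)" using big s(2) by blast
    then show ?thesis unfolding v_rank G(3) cell_rank_cell_of[OF G(1,2)] by simp
  qed
  show "cell_rank a < cell_rank b \<or> cell_rank a = cell_rank b \<and> matched a b"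
    if "(a, b) \<in> facet_rel (Delta 3)" for a b
    by (rule facet_rank[OF that])
  show "a \<in> simplices (Delta 3) \<and> b \<in> simplices (Delta 3) \<and> (a, b) \<in> facet_rel (Delta 3) \<and> cell_rank a = cell_rank b"
    if "matched a b" for a b
  proof -
    obtain G :: "(nat, nat) mgraph" and qs ps where G: "genus_three G" "chain G qs" "chain G ps"
      "partner G qs ps" "a = cell_of G qs" "b = cell_of G ps"
      using \<open>matched a b\<close> unfolding matched_def by blast
    obtain i where i: "0 < i" "i \<le> length ps" "qs = merge i ps" using partner_merge[OF G(4)] by blast
    have "(a, b) \<in> facet_rel (Delta 3)" using merge_facet(3)[OF G(1,3) i(1,2)] G(5,6) i(3) by simp
    moreover have "a \<in> simplices (Delta 3)" "b \<in> simplices (Delta 3)" unfolding simplices_Delta_iff using G by blast+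
    moreover have "cell_rank a = cell_rank b"
      using cell_rank_cell_of[OF G(1,2)] cell_rank_cell_of[OF G(1,3)] partner_rank[OF G(4)] G(5,6) by simp
    ultimately show ?thesis by blast
  qed
  show "\<not> matched b c" if ab: "matched a b" for a b c
  proof
    assume bc: "matched b c"
    obtain G :: "(nat, nat) mgraph" and qs ps where G: "genus_three G" "chain G qs" "chain G ps"
      "partner G qs ps" "b = cell_of G ps" using ab unfolding matched_def by blast
    obtain H :: "(nat, nat) mgraph" and ps' rs where H: "genus_three H" "chain H ps'"
      "partner H ps' rs" "b = cell_of H ps'" using bc unfolding matched_def by blast
    obtain f h where i: "graph_iso G H f h" "map ((`) h) ps = ps'"
      using cell_of_eqD[OF G(1,3) H(1,2)] G(5) H(4) by auto
    have "partner H (map ((`) h) qs) ps'"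
      using partner_iso[OF i(1) genus_three.graph[OF G(1)] _ _ G(4)] G(2,3) i(2) by (simp add: chain_def)
    then show False using partner_not_both H(3) by blast
  qed
  show "b = b'" if m: "matched a b" "matched a b'" for a b b'
  proof -
    obtain G :: "(nat, nat) mgraph" and qs ps where G: "genus_three G" "chain G qs" "chain G ps"
      "partner G qs ps" "a = cell_of G qs" "b = cell_of G ps" using m(1) unfolding matched_def by blast
    obtain H :: "(nat, nat) mgraph" and qs' rs where H: "genus_three H" "chain H qs'" "chain H rs"
      "partner H qs' rs" "a = cell_of H qs'" "b' = cell_of H rs" using m(2) unfolding matched_def by blast
    obtain f h where i: "graph_iso G H f h" "map ((`) h) qs = qs'"
      using cell_of_eqD[OF G(1,2) H(1,2)] G(5) H(5) by auto
    note c = cell_of_iso[OF G(1,3) i(1)]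
    have "partner H qs' (map ((`) h) ps)"
      using partner_iso[OF i(1) genus_three.graph[OF G(1)] _ _ G(4)] G(2,3) i(2) by (simp add: chain_def)
    then have "similar H (map ((`) h) ps) rs" using partner_unique[OF H(1) c(2) H(3) _ H(4)] by blast
    then obtain \<phi> k where k: "graph_iso H H \<phi> k" "map ((`) k) (map ((`) h) ps) = rs"
      unfolding similar_def by blast
    have "cell_of H rs = cell_of H (map ((`) h) ps)" using cell_of_iso(3)[OF H(1) c(2) k(1)] k(2) by simp
    then show "b = b'" using c(3) G(6) H(6) by simp
  qed
  show "a = a'" if m: "matched a b" "matched a' b" for a a' b
  proof -
    obtain G :: "(nat, nat) mgraph" and qs ps where G: "genus_three G" "chain G qs" "chain G ps"
      "partner G qs ps" "a = cell_of G qs" "b = cell_of G ps" using m(1) unfolding matched_def by blast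
    obtain H :: "(nat, nat) mgraph" and qs' rs where H: "genus_three H" "chain H qs'" "chain H rs"
      "partner H qs' rs" "a' = cell_of H qs'" "b = cell_of H rs" using m(2) unfolding matched_def by blast
    obtain f h where i: "graph_iso G H f h" "map ((`) h) ps = rs"
      using cell_of_eqD[OF G(1,3) H(1,3)] G(6) H(6) by auto
    have "partner H (map ((`) h) qs) rs"
      using partner_iso[OF i(1) genus_three.graph[OF G(1)] _ _ G(4)] G(2,3) i(2) by (simp add: chain_def)
    then have "map ((`) h) qs = qs'" using partner_left_unique H(4) by blast
    then show "a = a'" using cell_of_iso(3)[OF G(1,2) i(1)] G(5) H(5) by simp
  qed
  show "\<exists>t. matched s t \<or> matched t s" if s: "s \<in> simplices (Delta 3)" "s \<noteq> ?v" for s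
  proof -
    obtain G :: "(nat, nat) mgraph" and ps where G: "genus_three G" "chain G ps" "s = cell_of G ps"
      using s(1) unfolding simplices_Delta_iff by blast
    have "2 \<le> card (verts G)" using big G s(2) by blast
    then obtain qs where "chain G qs" "partner G ps qs \<or> partner G qs ps" using partner_exists[OF G(1) _ G(2)] by blast
    then show ?thesis unfolding matched_def using G by blast
  qed
qed

theorem theorem6p1:
  shows "gen_simplicial_complex (Delta 3) \<and>
    realization (Delta 3) homeomorphic_space X0 3 \<and>
    collapsible (Delta 3)"
  using gen_simplicial_complex_Delta[of 3] realization_Delta_homeomorphic_X0[of 3] collapsible_Delta_3 by simp

end
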